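(* Let $A\in\mathbb{R}^{m\times n}$ with $m\ge n$ have the singular value decomposition $A=U\Sigma V^T$, with singular values $\sigma_1\ge\sigma_2\ge\cdots\ge\sigma_n$ satisfying \[\sigma_1\ge\cdots\ge\sigma_k>\theta>\sigma_{k+1}\ge\cdots\ge\sigma_n\] for a given threshold $\theta>0$ and integer $k$. Let $b\le k$ be a positive integer (block size), $q\ge 0$ an integer (power parameter), and let $\Omega_1$ be an $n\times b$ standard Gaussian matrix. Let $\widehat Q_1\in\mathbb{R}^{m\times b}$ be a matrix with orthonormal columns spanning the range of $(AA^T)^qA\Omega_1$, let $\widehat U_1$ be a $b\times b$ orthogonal matrix whose columns are eigenvectors of $\widehat Q_1^TAA^T\widehat Q_1$ (ordered by decreasing eigenvalues), and set $Q_1=\widehat Q_1\widehat U_1$. Partition \[\widehat\Omega:=V^T\Omega_1=\begin{bmatrix}\widehat\Omega_1\\ \widehat\Omega_2\end{bmatrix},\qquad \widehat\Omega_1\in\mathbb{R}^{b\times b},\ \widehat\Omega_2\in\mathbb{R}^{(n-b)\times b},\] and assume $\widehat\Omega_1$ is nonsingular. For $1\le j\le b$ let $\hat\tau_j=\sigma_{b+1}/\sigma_j$. Let $\Sigma_{(b)\perp}$ denote the trailing $(m-b)\times(n-b)$ diagonal block of $\Sigma$ (containing $\sigma_{b+1},\dots,\sigma_n$). Then, for every integer $t$ with $b\le t\le k$, writing $U_{(t)}$ for the first $t$ columns of $U$: \[\|(I-Q_1Q_1^T)A\|_{\xi}\le\big(1+\hat\tau_b^{4q}\|\widehat\Omega_2\widehat\Omega_1^{-1}\|_2^2\big)^{1/2}\|\Sigma_{(b)\perp}\|_{\xi},\quad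 \xi\in\{2,F\},\] \[\sigma_j\ge\sigma_j(Q_1^TA)\ge\frac{\sigma_j}{\sqrt{1+\hat\tau_j^{4q+2}\|\widehat\Omega_2\widehat\Omega_1^{-1}\|_2^2}},\qquad 1\le j\le b,\] \[\mathbf{d}(\mathcal{R}(Q_1),\mathcal{R}(U_{(t)}))\le\Big(\frac{\sigma_{t+1}}{\sigma_b}\Big)^{2q+1}\|\widehat\Omega_2\widehat\Omega_1^{-1}\|_2 .\] Moreover, for $0<\delta<1$, with probability at least $1-\delta$, \[\|\widehat\Omega_2\|_2\|\widehat\Omega_1^{-1}\|_2\le\mathcal{C}_{\delta,b,b}=2e\sqrt{b}\,\frac{2}{\delta}\Big(\sqrt{n-b}+\sqrt{b}+\sqrt{2\log\tfrac{2}{\delta}}\Big).\]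
   Context: $\sigma_j(M)$ denotes the $j$-th largest singular value of $M$; $\|\cdot\|_2,\|\cdot\|_F$ are the spectral and Frobenius norms; $\mathcal{R}(\cdot)$ is the column space. For matrices $W_1\in\mathbb{R}^{m\times s}$, $Z_1\in\mathbb{R}^{m\times t}$ with orthonormal columns, $\mathcal{P}_{W}=WW^T$ and the deviation $\mathbf{d}(\mathcal{R}(W_1),\mathcal{R}(Z_1))=\|(I-\mathcal{P}_{Z_1})\mathcal{P}_{W_1}\|_2$. A standard Gaussian matrix has i.i.d. $N(0,1)$ entries. The general constant is $\mathcal{C}_{\delta,r,\ell}=\frac{2e\sqrt{\ell}}{\ell-r+1}(2/\delta)^{1/(\ell-r+1)}(\sqrt{n-r}+\sqrt r+\sqrt{2\log(2/\delta)})$, here with $r=\ell=b$. *)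

theory Defs
  imports "HOL-Probability.Probability"
          "Jordan_Normal_Form.Gauss_Jordan_Elimination"
          "Jordan_Normal_Form.Char_Poly"
begin

definition vnorm :: "real Matrix.vec \<Rightarrow> real" where
  "vnorm v = sqrt (v \<bullet> v)"

definition spec_norm :: "real mat \<Rightarrow> real" where
  "spec_norm M = Sup {vnorm (M *\<^sub>v x) | x. x \<in> carrier_vec (dim_col M) \<and> vnorm x \<le> 1}"

definition frob_norm :: "real mat \<Rightarrow> real" where
  "frob_norm M = sqrt (\<Sum>i<dim_row M. \<Sum>j<dim_col M. (M $$ (i,j))\<^sup>2)"

(* j-th largest singular value (1-based j): square root of the j-th largest
   eigenvalue (counted with multiplicity) of M^T M *)
definition sing_val :: "real mat \<Rightarrow> nat \<Rightarrow> real" where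
  "sing_val M j = sqrt (rev (sorted_list_of_multiset
       (proots (char_poly (transpose_mat M * M)))) ! (j - 1))"

definition col_space :: "real mat \<Rightarrow> real Matrix.vec set" where
  "col_space M = {M *\<^sub>v x | x. x \<in> carrier_vec (dim_col M)}"

(* deviation d(R(W),R(Z)) = ||(I - P_Z) P_W||_2 for orthonormal-column W, Z *)
definition deviation :: "real mat \<Rightarrow> real mat \<Rightarrow> real" where
  "deviation W Z = spec_norm ((1\<^sub>m (dim_row Z) - Z * transpose_mat Z) * (W * transpose_mat W))"

definition sub_mat :: "real mat \<Rightarrow> nat \<Rightarrow> nat \<Rightarrow> nat \<Rightarrow> nat \<Rightarrow> real mat" where
  "sub_mat M r0 r1 c0 c1 = mat (r1 - r0) (c1 - c0) (\<lambda>(i,j). M $$ (i + r0, j + c0))"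

definition minv :: "real mat \<Rightarrow> real mat" where
  "minv M = the (mat_inverse M)"

(* law of an r x c standard Gaussian matrix: i.i.d. N(0,1) entries, given as
   the product measure on the entry functions; a function f corresponds to the
   matrix  mat r c f *)
definition gauss_entries :: "nat \<Rightarrow> nat \<Rightarrow> (nat \<times> nat \<Rightarrow> real) measure" where
  "gauss_entries r c = PiM ({0..<r} \<times> {0..<c}) (\<lambda>_. std_normal_distribution)"

definition C_const :: "real \<Rightarrow> nat \<Rightarrow> nat \<Rightarrow> nat \<Rightarrow> real" where
  "C_const \<delta> n r l = 2 * exp 1 * sqrt (real l) / real (l - r + 1)
      * (2 / \<delta>) powr (1 / real (l - r + 1))
      * (sqrt (real n - real r) + sqrt (real r) + sqrt (2 * ln (2 / \<delta>)))"

end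

theory Submission
  imports Defs
begin

text \<open>
  Deterministic part. Write \<open>p = 2 q + 1\<close> and \<open>F\<close> for the product of the lower block of \<open>V\<^sup>T \<Omega>\<close> with the inverse
  of the upper block. In the basis \<open>U\<close> the range of \<open>(A A\<^sup>T)\<^sup>q A \<Omega>\<close> is the graph of \<open>\<Sigma>\<^sub>2\<^sup>p F \<Sigma>\<^sub>1\<^sup>-\<^sup>p\<close> over the first
  \<open>b\<close> coordinates. The residual bounds compare \<open>A\<close> with an explicit matrix whose range is that graph, the deviation
  bound reads off the coordinates beyond \<open>t\<close>, and the singular value bounds are Courant--Fischer on the graph.

  Probabilistic part. The constant \<open>2 e\<close> leaves enough room to replace sharp concentration by test vectors.
  For a Gaussian \<open>G\<close> and a fixed \<open>v\<close>, rotating \<open>v\<close> to a multiple of \<open>e\<^sub>0\<close> shows that \<open>|G\<^sup>-\<^sup>1 v|\<close> is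
  \<open>|v|\<close> divided by the absolute value of a standard normal variable; averaging over a Gaussian \<open>v\<close> gives
  \<open>P(\<parallel>G\<^sup>-\<^sup>1\<parallel> > t) \<le> 2.78 \<surd>b / t\<close>. Testing the lower block on Gaussian vectors conditioned to a cap bounds its
  exponential moment, so its expected norm is at most \<open>\<surd>(10 (n + 3))\<close>. The two blocks are independent, and
  integrating the first bound against the norm of the lower block gives the claim.
\<close>

section \<open>Orthogonal invariance of Gaussian product measures\<close>

text \<open>The failure probability only has to be linear in 1 / C: for r = l = b,
  \<open>C_const\<close> is 4 * e * sqrt b * D / \<delta>, where D is the last factor of its
  definition, and so is of order 1 / \<delta> itself. A tail of order sqrt b / t for the inverse is
  therefore enough. As that tail is linear in 1 / t, conditioning on the lower block leaves only the
  mean of its norm; \<delta> is not divided between two events. The slack pays for crude constants: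
  D^2 >= n + 3 and 2.78 * sqrt 10 < 4 * e.

  Two encodings shape the rest. The inverse is a partial operation, so events about it are written
  with adjugate and determinant, which are polynomials in the entries and hence measurable; norms,
  being suprema, are reduced to rational test vectors. Singular values are defined by the
  characteristic polynomial of M^T M, whereas the eigenvectors in the hypotheses diagonalise the
  smaller product B B^T with B = Q^T A; a determinant identity links the two spectra.\<close>

abbreviation gauss :: "'i set \<Rightarrow> ('i \<Rightarrow> real) measure" where
  "gauss I \<equiv> PiM I (\<lambda>_. std_normal_distribution)"

interpretation lborel_product: product_sigma_finite "\<lambda>_. lborel :: real measure"
  by standard

lemma prob_space_std_normal: "prob_space std_normal_distribution"
  by (simp add: prob_space_normal_density)

interpretation gauss_product: product_sigma_finite "\<lambda>_. std_normal_distribution"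
  by (simp add: product_sigma_finite_def prob_space_std_normal prob_space_imp_sigma_finite)

lemma prob_space_gauss: "prob_space (gauss I)"
  by (intro prob_space_PiM prob_space_std_normal)

lemma sets_gauss: "sets (gauss I) = sets (PiM I (\<lambda>_. borel))"
  by (intro sets_PiM_cong) auto

lemma sets_PiM_lborel: "sets (PiM I (\<lambda>_. lborel)) = sets (PiM I (\<lambda>_. borel))"
  by (intro sets_PiM_cong) auto

lemma measurable_gauss: "measurable (gauss I) N = measurable (PiM I (\<lambda>_. borel)) N"
  by (intro measurable_cong_sets sets_gauss refl)

lemma measurable_PiM_lborel: "measurable (PiM I (\<lambda>_. lborel)) N = measurable (PiM I (\<lambda>_. borel)) N"
  by (intro measurable_cong_sets sets_PiM_lborel refl)

lemma gauss_eq_density: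
  assumes "finite I"
  shows "gauss I = density (PiM I (\<lambda>_. lborel)) (\<lambda>x. \<Prod>i\<in>I. ennreal (std_normal_density (x i)))"
proof (rule gauss_product.PiM_eqI[OF assms, symmetric])
  show "sets (density (PiM I (\<lambda>_. lborel)) (\<lambda>x. \<Prod>i\<in>I. ennreal (std_normal_density (x i)))) = sets (gauss I)"
    by (simp add: sets_gauss sets_PiM_lborel)
  fix A :: "'a \<Rightarrow> real set" assume A: "\<And>i. i \<in> I \<Longrightarrow> A i \<in> sets std_normal_distribution"
  have [measurable]: "(\<lambda>x. \<Prod>i\<in>I. ennreal (std_normal_density (x i))) \<in> borel_measurable (PiM I (\<lambda>_. lborel))"
    by measurable
  have AE: "PiE I A \<in> sets (PiM I (\<lambda>_. lborel))"
    by (rule sets_PiM_I_finite) (use A assms in auto)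
  have "emeasure (density (PiM I (\<lambda>_. lborel)) (\<lambda>x. \<Prod>i\<in>I. ennreal (std_normal_density (x i)))) (PiE I A)
      = (\<integral>\<^sup>+x. (\<Prod>i\<in>I. ennreal (std_normal_density (x i))) * indicator (PiE I A) x \<partial>PiM I (\<lambda>_. lborel))"
    by (rule emeasure_density) (use AE in auto)
  also have "\<dots> = (\<integral>\<^sup>+x. (\<Prod>i\<in>I. ennreal (std_normal_density (x i)) * indicator (A i) (x i)) \<partial>PiM I (\<lambda>_. lborel))"
  proof (rule nn_integral_cong)
    fix x :: "'a \<Rightarrow> real" assume "x \<in> space (PiM I (\<lambda>_. lborel))"
    then have "indicator (PiE I A) x = (\<Prod>i\<in>I. indicator (A i) (x i) :: ennreal)"
      using assms by (auto simp: space_PiM indicator_def PiE_def Pi_def prod_zero_iff)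
    then show "(\<Prod>i\<in>I. ennreal (std_normal_density (x i))) * indicator (PiE I A) x
        = (\<Prod>i\<in>I. ennreal (std_normal_density (x i)) * indicator (A i) (x i))"
      by (simp add: prod.distrib)
  qed
  also have "\<dots> = (\<Prod>i\<in>I. \<integral>\<^sup>+y. ennreal (std_normal_density y) * indicator (A i) y \<partial>lborel)"
    by (rule lborel_product.product_nn_integral_prod[OF assms]) (use A in auto)
  also have "\<dots> = (\<Prod>i\<in>I. emeasure std_normal_distribution (A i))"
    by (intro prod.cong refl emeasure_density[symmetric]) (use A in auto)
  finally show "emeasure (density (PiM I (\<lambda>_. lborel)) (\<lambda>x. \<Prod>i\<in>I. ennreal (std_normal_density (x i)))) (PiE I A)
     = (\<Prod>i\<in>I. emeasure std_normal_distribution (A i))" .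
qed

lemma prod_std_normal_density:
  assumes "finite I"
  shows "(\<Prod>i\<in>I. std_normal_density (x i)) = (1 / sqrt (2 * pi)) ^ card I * exp (- (\<Sum>i\<in>I. (x i)\<^sup>2) / 2)"
  using assms by (simp add: normal_density_def exp_sum sum_divide_distrib sum_negf[symmetric] power_divide
    prod_dividef del: sum_negf)

text \<open>The density depends on \<open>x\<close> through the sum of squares alone, so a linear
  map that preserves both this sum and Lebesgue measure preserves the Gaussian law.\<close>

lemma nn_integral_gauss:
  assumes "finite I" "F \<in> borel_measurable (PiM I (\<lambda>_. borel))"
  shows "(\<integral>\<^sup>+x. F x \<partial>gauss I) = (\<integral>\<^sup>+x. ennreal ((1 / sqrt (2 * pi)) ^ card I * exp (- (\<Sum>i\<in>I. (x i)\<^sup>2) / 2)) * F x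
     \<partial>PiM I (\<lambda>_. lborel))"
proof -
  have [measurable]: "(\<lambda>x. \<Prod>i\<in>I. ennreal (std_normal_density (x i))) \<in> borel_measurable (PiM I (\<lambda>_. lborel))"
    by measurable
  show ?thesis
    unfolding gauss_eq_density[OF assms(1)]
    by (subst nn_integral_density)
      (use assms in \<open>auto simp: prod_ennreal prod_std_normal_density measurable_PiM_lborel\<close>)
qed

text \<open>Fubini in the coordinate \<open>i\<close>: only this coordinate changes, by a unimodular affine map.\<close>
lemma nn_integral_lborel_coordinate_affine:
  fixes g :: "('i \<Rightarrow> real) \<Rightarrow> real"
  assumes I: "finite I" "i \<in> I" and c: "\<bar>c\<bar> = 1"
    and F: "F \<in> borel_measurable (PiM I (\<lambda>_. borel))"
    and g: "g \<in> borel_measurable (PiM I (\<lambda>_. borel))" "\<And>x y. g (x(i := y)) = g x"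
  shows "(\<integral>\<^sup>+x. F (x(i := g x + c * x i)) \<partial>PiM I (\<lambda>_. lborel)) = (\<integral>\<^sup>+x. F x \<partial>PiM I (\<lambda>_. lborel))"
proof -
  define J where "J = I - {i}"
  have J: "finite J" "i \<notin> J" "I = insert i J" using I by (auto simp: J_def)
  have upd: "(\<lambda>x. x(i := h x)) \<in> measurable (PiM I (\<lambda>_. borel)) (PiM I (\<lambda>_. borel))"
    if "h \<in> borel_measurable (PiM I (\<lambda>_. borel))" for h :: "_ \<Rightarrow> real"
    by (rule measurable_fun_upd[where J=I]) (use I that in auto)
  have upd2: "(\<lambda>y. x(i := y)) \<in> measurable borel (PiM I (\<lambda>_. borel))" if "x \<in> space (PiM J (\<lambda>_. lborel))" for x :: "_ \<Rightarrow> real"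
    unfolding J(3) by (rule measurable_fun_upd[where J=J]) (use that in \<open>auto simp: space_PiM intro!: measurable_const\<close>)
  have "(\<lambda>x. x(i := g x + c * x i)) \<in> measurable (PiM I (\<lambda>_. borel)) (PiM I (\<lambda>_. borel))"
    by (rule upd) (use g I in \<open>auto intro!: borel_measurable_add borel_measurable_times\<close>)
  then have M: "(\<lambda>x. F (x(i := g x + c * x i))) \<in> borel_measurable (PiM I (\<lambda>_. borel))"
    by (rule measurable_compose[OF _ F])
  have "(\<integral>\<^sup>+x. F (x(i := g x + c * x i)) \<partial>PiM I (\<lambda>_. lborel))
     = (\<integral>\<^sup>+x. \<integral>\<^sup>+y. F (x(i := g x + c * y)) \<partial>lborel \<partial>PiM J (\<lambda>_. lborel))"
    using M unfolding J(3) by (subst lborel_product.product_nn_integral_insert) (auto simp: J measurable_PiM_lborel g)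
  also have "\<dots> = (\<integral>\<^sup>+x. \<integral>\<^sup>+y. F (x(i := y)) \<partial>lborel \<partial>PiM J (\<lambda>_. lborel))"
  proof (rule nn_integral_cong)
    fix x :: "'i \<Rightarrow> real" assume x: "x \<in> space (PiM J (\<lambda>_. lborel))"
    show "(\<integral>\<^sup>+y. F (x(i := g x + c * y)) \<partial>lborel) = (\<integral>\<^sup>+y. F (x(i := y)) \<partial>lborel)"
      using c by (subst nn_integral_real_affine[where c=c and t="g x", OF measurable_compose[OF upd2[OF x] F]]) auto
  qed
  also have "\<dots> = (\<integral>\<^sup>+x. F x \<partial>PiM I (\<lambda>_. lborel))"
    using F unfolding J(3) by (subst lborel_product.product_nn_integral_insert) (auto simp: J measurable_PiM_lborel)
  finally show ?thesis .
qed

text \<open>Induction on the set of sheared coordinates: coordinate \<open>k\<close> is never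
  changed, so each step adds to one coordinate an amount that does not depend on it, and
  \<open>nn_integral_lborel_coordinate_affine\<close> applies with slope 1.\<close>

lemma nn_integral_lborel_shear:
  fixes a :: "'i \<Rightarrow> real"
  assumes I: "finite I" "k \<in> I" and K: "finite K" "K \<subseteq> I - {k}"
    and F: "F \<in> borel_measurable (PiM I (\<lambda>_. borel))"
  shows "(\<integral>\<^sup>+x. F (\<lambda>j. if j \<in> K then x j + a j * x k else x j) \<partial>PiM I (\<lambda>_. lborel)) = (\<integral>\<^sup>+x. F x \<partial>PiM I (\<lambda>_. lborel))"
  using K F
proof (induction K arbitrary: F)
  case empty
  then show ?case by simp
next
  case (insert j K)
  have j: "j \<in> I" "j \<noteq> k" "j \<notin> K" using insert by auto
  have upd: "(\<lambda>x. x(j := a j * x k + 1 * x j)) \<in> measurable (PiM I (\<lambda>_. borel)) (PiM I (\<lambda>_. borel))"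
    by (rule measurable_fun_upd[where J=I]) (use j I in \<open>auto intro!: borel_measurable_add borel_measurable_times\<close>)
  have [simp]: "k \<notin> K" using insert by auto
  have "(\<integral>\<^sup>+x. F (\<lambda>i. if i \<in> insert j K then x i + a i * x k else x i) \<partial>PiM I (\<lambda>_. lborel))
     = (\<integral>\<^sup>+x. (\<lambda>x. F (x(j := a j * x k + 1 * x j))) (\<lambda>i. if i \<in> K then x i + a i * x k else x i) \<partial>PiM I (\<lambda>_. lborel))"
    by (intro nn_integral_cong arg_cong[where f=F] ext) (use j in auto)
  also have "\<dots> = (\<integral>\<^sup>+x. F (x(j := a j * x k + 1 * x j)) \<partial>PiM I (\<lambda>_. lborel))"
    by (rule insert.IH[OF _ measurable_compose[OF upd insert.prems(2)]]) (use insert in auto)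
  also have "\<dots> = (\<integral>\<^sup>+x. F x \<partial>PiM I (\<lambda>_. lborel))"
    by (rule nn_integral_lborel_coordinate_affine) (use I j insert in auto)
  finally show ?case .
qed

text \<open>The Householder reflection along \<open>u\<close>, restricted to \<open>I\<close> so
  that values stay in the space of the product measure. When \<open>u\<close> vanishes on
  \<open>I\<close>, division by zero gives 0 and \<open>x\<close> is only restricted.\<close>

definition refl_vec :: "'i set \<Rightarrow> ('i \<Rightarrow> real) \<Rightarrow> ('i \<Rightarrow> real) \<Rightarrow> 'i \<Rightarrow> real" where
  "refl_vec I u x = (\<lambda>i\<in>I. x i - 2 * (\<Sum>j\<in>I. u j * x j) / (\<Sum>j\<in>I. (u j)\<^sup>2) * u i)"

lemma measurable_refl_vec:
  assumes "finite I"
  shows "refl_vec I u \<in> measurable (PiM I (\<lambda>_. borel)) (PiM I (\<lambda>_. borel))"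
  unfolding refl_vec_def using assms
  by (intro measurable_restrict borel_measurable_diff borel_measurable_times borel_measurable_divide
      borel_measurable_sum borel_measurable_const measurable_component_singleton) auto

lemma sum_squares_refl_vec:
  assumes "finite I"
  shows "(\<Sum>i\<in>I. (refl_vec I u x i)\<^sup>2) = (\<Sum>i\<in>I. (x i)\<^sup>2)"
proof -
  define N where "N = (\<Sum>j\<in>I. (u j)\<^sup>2)"
  define p where "p = (\<Sum>j\<in>I. u j * x j)"
  have r: "refl_vec I u x i = x i - 2 * p / N * u i" if "i \<in> I" for i
    using that by (simp add: refl_vec_def p_def N_def)
  have "(\<Sum>i\<in>I. (refl_vec I u x i)\<^sup>2) = (\<Sum>i\<in>I. (x i)\<^sup>2 - 4 * p / N * (u i * x i) + 4 * p\<^sup>2 / N\<^sup>2 * (u i)\<^sup>2)"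
    by (intro sum.cong refl) (simp add: r power2_eq_square algebra_simps)
  also have "\<dots> = (\<Sum>i\<in>I. (x i)\<^sup>2) - 4 * p / N * p + 4 * p\<^sup>2 / N\<^sup>2 * N"
    unfolding sum.distrib sum_subtractf sum_distrib_left[symmetric] p_def[symmetric] N_def[symmetric] ..
  \<comment> \<open>For \<open>N = 0\<close> both correction terms are 0 by the convention for
    division.\<close>
  also have "\<dots> = (\<Sum>i\<in>I. (x i)\<^sup>2)"
    by (simp add: power2_eq_square)
  finally show ?thesis .
qed

text \<open>With \<open>u k \<noteq> 0\<close>, the reflection is conjugate, under the shear \<open>x j \<mapsto> x j - u j / u k * x k\<close>, to a map
  that changes the coordinate \<open>k\<close> only, with slope -1.\<close>
lemma nn_integral_lborel_refl_vec:
  assumes I: "finite I" and k: "k \<in> I" "u k \<noteq> 0"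
    and F: "F \<in> borel_measurable (PiM I (\<lambda>_. borel))"
  shows "(\<integral>\<^sup>+x. F (refl_vec I u x) \<partial>PiM I (\<lambda>_. lborel)) = (\<integral>\<^sup>+x. F x \<partial>PiM I (\<lambda>_. lborel))"
proof -
  define N where "N = (\<Sum>j\<in>I. (u j)\<^sup>2)"
  define K where "K = I - {k}"
  define a where "a j = u j / u k" for j
  define sh where "sh s x = (\<lambda>j. if j \<in> K then x j + s * a j * x k else x j)" for s :: real and x
  \<comment> \<open>The reflection moves \<open>x\<close> along \<open>u\<close> and so keeps every
    \<open>x j - a j * x k\<close>. In these sheared coordinates the inner product of
    \<open>u\<close> and \<open>x\<close> is the sum over \<open>K\<close> plus
    \<open>N * x k / u k\<close>; inserting this into the coordinate \<open>k\<close> of the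
    reflection gives \<open>g - x k\<close>, of slope -1.\<close>
  define g where "g x = - 2 * u k / N * (\<Sum>j\<in>K. u j * x j)" for x :: "_ \<Rightarrow> real"
  have KI: "finite K" "K \<subseteq> I - {k}" "I = insert k K" "k \<notin> K" using I k by (auto simp: K_def)
  have N: "N = (u k)\<^sup>2 + (\<Sum>j\<in>K. (u j)\<^sup>2)" unfolding N_def KI(3) using KI by simp
  have "N > 0" using k(2) unfolding N by (simp add: add_pos_nonneg sum_nonneg)
  have gm: "g \<in> borel_measurable (PiM I (\<lambda>_. borel))"
    unfolding g_def by (intro borel_measurable_times borel_measurable_const borel_measurable_sum measurable_component_singleton)
      (use KI in auto)
  have updm: "(\<lambda>x. x(k := g x + (-1) * x k)) \<in> measurable (PiM I (\<lambda>_. borel)) (PiM I (\<lambda>_. borel))"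
    by (rule measurable_fun_upd[where J=I]) (use k gm in \<open>auto intro!: borel_measurable_add borel_measurable_times\<close>)
  have shm: "sh s \<in> measurable (PiM I (\<lambda>_. borel)) (PiM I (\<lambda>_. borel))" for s
    unfolding sh_def
  proof (rule measurable_PiM_single')
    show "(\<lambda>x j. if j \<in> K then x j + s * a j * x k else x j) \<in> space (PiM I (\<lambda>_. borel)) \<rightarrow> I \<rightarrow>\<^sub>E space borel"
      using KI by (auto simp: space_PiM PiE_def extensional_def)
    show "(\<lambda>x. if i \<in> K then x i + s * a i * x k else x i) \<in> borel_measurable (PiM I (\<lambda>_. borel))" if "i \<in> I" for i
      using that k by (cases "i \<in> K") (auto intro!: borel_measurable_add borel_measurable_times)
  qed
  have eq: "refl_vec I u x = sh 1 ((sh (-1) x)(k := g (sh (-1) x) + (-1) * sh (-1) x k))"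
    if x: "x \<in> space (PiM I (\<lambda>_. lborel))" for x
  proof
    fix i
    define p where "p = (\<Sum>j\<in>I. u j * x j)"
    define r where "r = (\<Sum>j\<in>K. u j * (x j - a j * x k))"
    have gr: "g (sh (-1) x) = - 2 * u k / N * r"
      unfolding g_def r_def sh_def by (simp add: algebra_simps cong: sum.cong)
    have "r = (\<Sum>j\<in>K. u j * x j) - (\<Sum>j\<in>K. (u j)\<^sup>2) * (x k / u k)"
      unfolding r_def a_def sum_distrib_right sum_subtractf[symmetric]
      by (intro sum.cong refl) (simp add: power2_eq_square algebra_simps)
    also have "(\<Sum>j\<in>K. u j * x j) = p - u k * x k"
      unfolding p_def KI(3) using KI by simp
    also have "(\<Sum>j\<in>K. (u j)\<^sup>2) = N - (u k)\<^sup>2" using N by simp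
    finally have r: "r = p - N * x k / u k"
      using k(2) by (simp add: field_simps power2_eq_square)
    have xk: "g (sh (-1) x) - x k = x k - 2 * p / N * u k"
      unfolding gr r using k(2) \<open>N > 0\<close> by (simp add: field_simps)
    consider "i = k" | "i \<in> K" | "i \<notin> I" using KI by auto
    then show "refl_vec I u x i = sh 1 ((sh (-1) x)(k := g (sh (-1) x) + (-1) * sh (-1) x k)) i"
    proof cases
      case 1
      then show ?thesis using xk k KI(4) by (simp add: refl_vec_def sh_def p_def[symmetric] N_def[symmetric])
    next
      case 2
      then have "i \<in> I" "i \<noteq> k" using KI by auto
      with 2 show ?thesis using xk k KI(4)
        by (simp add: refl_vec_def p_def[symmetric] N_def[symmetric]) (simp add: sh_def a_def field_simps)
    next
      case 3
      then have "i \<noteq> k" "i \<notin> K" using KI by auto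
      with 3 x show ?thesis by (auto simp: refl_vec_def sh_def space_PiM PiE_def extensional_def)
    qed
  qed
  have "(\<integral>\<^sup>+x. F (refl_vec I u x) \<partial>PiM I (\<lambda>_. lborel))
     = (\<integral>\<^sup>+x. (\<lambda>y. F (sh 1 (y(k := g y + (-1) * y k)))) (sh (-1) x) \<partial>PiM I (\<lambda>_. lborel))"
    by (intro nn_integral_cong) (simp add: eq)
  also have "\<dots> = (\<integral>\<^sup>+y. F (sh 1 (y(k := g y + (-1) * y k))) \<partial>PiM I (\<lambda>_. lborel))"
    unfolding sh_def[of "-1"]
    by (rule nn_integral_lborel_shear[OF I k(1) KI(1,2)])
      (use measurable_compose[OF measurable_compose[OF updm shm] F] in simp)
  also have "\<dots> = (\<integral>\<^sup>+y. F (sh 1 y) \<partial>PiM I (\<lambda>_. lborel))"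
    by (rule nn_integral_lborel_coordinate_affine[OF I k(1) _ measurable_compose[OF shm F] gm])
      (use KI in \<open>auto simp: g_def intro!: sum.cong\<close>)
  also have "\<dots> = (\<integral>\<^sup>+y. F y \<partial>PiM I (\<lambda>_. lborel))"
    unfolding sh_def by (rule nn_integral_lborel_shear[OF I k(1) KI(1,2) F])
  finally show ?thesis .
qed

lemma nn_integral_gauss_refl_vec:
  assumes I: "finite I" and k: "k \<in> I" "u k \<noteq> 0"
    and F: "F \<in> borel_measurable (PiM I (\<lambda>_. borel))"
  shows "(\<integral>\<^sup>+x. F (refl_vec I u x) \<partial>gauss I) = (\<integral>\<^sup>+x. F x \<partial>gauss I)"
proof -
  let ?d = "\<lambda>x. ennreal ((1 / sqrt (2 * pi)) ^ card I * exp (- (\<Sum>i\<in>I. (x i)\<^sup>2) / 2))"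
  have d: "?d \<in> borel_measurable (PiM I (\<lambda>_. borel))"
    by measurable
  show ?thesis
    unfolding nn_integral_gauss[OF I F] nn_integral_gauss[OF I measurable_compose[OF measurable_refl_vec[OF I] F]]
    using nn_integral_lborel_refl_vec[where F="\<lambda>x. ?d x * F x" and u=u and k=k, OF assms(1-3) borel_measurable_times_ennreal[OF d F]]
    by (simp add: sum_squares_refl_vec[OF I])
qed

lemma refl_vec_refl_vec:
  assumes I: "finite I" "k \<in> I" "u k \<noteq> 0" and x: "x \<in> extensional I"
  shows "refl_vec I u (refl_vec I u x) = x"
proof
  fix i
  define N where "N = (\<Sum>j\<in>I. (u j)\<^sup>2)"
  define p where "p = (\<Sum>j\<in>I. u j * x j)"
  have "0 < (u k)\<^sup>2" using I by simp
  also have "\<dots> \<le> N" unfolding N_def by (rule member_le_sum) (use I in auto)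
  finally have N: "N > 0" .
  have r: "refl_vec I u x i = x i - 2 * p / N * u i" if "i \<in> I" for i
    using that by (simp add: refl_vec_def p_def N_def)
  have "(\<Sum>j\<in>I. u j * refl_vec I u x j) = (\<Sum>j\<in>I. u j * x j - 2 * p / N * (u j)\<^sup>2)"
    by (intro sum.cong refl) (simp add: r power2_eq_square algebra_simps)
  also have "\<dots> = p - 2 * p / N * N"
    unfolding sum_subtractf sum_distrib_left[symmetric] p_def[symmetric] N_def[symmetric] ..
  also have "\<dots> = - p" using N by simp
  finally have q: "(\<Sum>j\<in>I. u j * refl_vec I u x j) = - p" .
  show "refl_vec I u (refl_vec I u x) i = x i"
  proof (cases "i \<in> I")
    case True
    have "refl_vec I u (refl_vec I u x) i = refl_vec I u x i - 2 * (- p) / N * u i"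
      using True by (subst refl_vec_def) (simp add: q N_def)
    with r[OF True] show ?thesis by simp
  next
    case False
    with x show ?thesis by (simp add: refl_vec_def extensional_def)
  qed
qed

section \<open>Orthogonal maps as compositions of reflections\<close>

definition lin_map :: "'i set \<Rightarrow> ('i \<Rightarrow> 'i \<Rightarrow> real) \<Rightarrow> ('i \<Rightarrow> real) \<Rightarrow> 'i \<Rightarrow> real" where
  "lin_map I W x = (\<lambda>i\<in>I. \<Sum>j\<in>I. W i j * x j)"

text \<open>Orthonormal columns, stated for functions on an arbitrary index set so that vectors and
  matrices indexed by pairs are covered alike.\<close>

definition orth_on :: "'i set \<Rightarrow> ('i \<Rightarrow> 'i \<Rightarrow> real) \<Rightarrow> bool" where
  "orth_on I W \<longleftrightarrow> (\<forall>j\<in>I. \<forall>k\<in>I. (\<Sum>i\<in>I. W i j * W i k) = of_bool (j = k))"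

lemma measurable_lin_map:
  assumes "finite I"
  shows "lin_map I W \<in> measurable (PiM I (\<lambda>_. borel)) (PiM I (\<lambda>_. borel))"
  unfolding lin_map_def using assms
  by (intro measurable_restrict borel_measurable_times
      borel_measurable_sum borel_measurable_const measurable_component_singleton) auto

text \<open>\<open>K\<close> contains the basis vectors that \<open>W\<close> may move. Reflecting
  along u = W e_k - e_k sends W e_k to e_k, because \<open>N = 2 * c k\<close>. A basis vector e_l
  that \<open>W\<close> fixes stays fixed, since orthonormality of the columns makes u orthogonal to
  it. The composite \<open>W'\<close> thus moves one vector less; if u vanishes, \<open>W\<close>
  itself already fixes e_k.\<close>

lemma nn_integral_gauss_lin_map_aux:
  assumes I: "finite I" and K: "finite K" "K \<subseteq> I" "orth_on I W"
    and fx: "\<And>k i. k \<in> I - K \<Longrightarrow> i \<in> I \<Longrightarrow> W i k = of_bool (i = k)"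
    and F: "F \<in> borel_measurable (PiM I (\<lambda>_. borel))"
  shows "(\<integral>\<^sup>+x. F (lin_map I W x) \<partial>gauss I) = (\<integral>\<^sup>+x. F x \<partial>gauss I)"
  using K fx F
proof (induction K arbitrary: W F)
  case empty
  have "lin_map I W x = x" if "x \<in> space (gauss I)" for x
  proof
    fix i
    show "lin_map I W x i = x i"
    proof (cases "i \<in> I")
      case True
      then have "lin_map I W x i = (\<Sum>j\<in>I. if i = j then x j else 0)"
        unfolding lin_map_def using empty.prems(3) by (auto intro!: sum.cong)
      with True I show ?thesis by simp
    next
      case False
      with that show ?thesis by (auto simp: lin_map_def space_PiM PiE_def extensional_def)
    qed
  qed
  then show ?case by (simp cong: nn_integral_cong)
next
  case (insert k K)
  have kI: "k \<in> I" using insert by auto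
  define u where "u i = W i k - of_bool (i = k)" for i
  have orth: "(\<Sum>i\<in>I. W i j * W i l) = of_bool (j = l)" if "j \<in> I" "l \<in> I" for j l
    using insert.prems(2) that by (auto simp: orth_on_def)
  show ?case
  proof (cases "\<exists>i\<in>I. u i \<noteq> 0")
    case False
    show ?thesis
    proof (rule insert.IH)
      show "W i l = of_bool (i = l)" if "l \<in> I - K" "i \<in> I" for l i
      proof (cases "l = k")
        case True
        with False that show ?thesis by (auto simp: u_def)
      next
        case False
        with that insert.prems(3) show ?thesis by auto
      qed
    qed (use insert in auto)
  next
    case True
    then obtain m where m: "m \<in> I" "u m \<noteq> 0" by auto
    define N where "N = (\<Sum>j\<in>I. (u j)\<^sup>2)"
    define c where "c j = (\<Sum>l\<in>I. u l * W l j)" for j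
    define W' where "W' i j = W i j - 2 * c j / N * u i" for i j
    have "0 < (u m)\<^sup>2" using m by simp
    also have "\<dots> \<le> N" unfolding N_def by (rule member_le_sum) (use I m in auto)
    finally have N: "N > 0" .
    have c: "c j = of_bool (k = j) - W k j" if "j \<in> I" for j
    proof -
      have "c j = (\<Sum>l\<in>I. W l k * W l j) - (\<Sum>l\<in>I. if k = l then W l j else 0)"
        unfolding c_def u_def sum_subtractf[symmetric] by (intro sum.cong refl) (auto simp: algebra_simps)
      then show ?thesis using orth[OF kI that] kI I by simp
    qed
    have "N = (\<Sum>j\<in>I. W j k * W j k) - 2 * (\<Sum>j\<in>I. if k = j then W j k else 0) + (\<Sum>j\<in>I. if k = j then 1 else 0)"
      unfolding N_def u_def sum_subtractf[symmetric] sum_distrib_left sum.distrib[symmetric]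
      by (intro sum.cong refl) (auto simp: power2_eq_square algebra_simps)
    then have Nc: "N = 2 * c k" using orth[OF kI kI] kI I c[OF kI] by simp
    have lin': "refl_vec I u (lin_map I W x) = lin_map I W' x" for x
    proof
      fix i
      show "refl_vec I u (lin_map I W x) i = lin_map I W' x i"
      proof (cases "i \<in> I")
        case True
        have "(\<Sum>j\<in>I. u j * lin_map I W x j) = (\<Sum>j\<in>I. \<Sum>l\<in>I. u j * W j l * x l)"
          by (simp add: lin_map_def sum_distrib_left mult.assoc)
        also have "\<dots> = (\<Sum>l\<in>I. c l * x l)"
          by (subst sum.swap) (simp add: c_def sum_distrib_right)
        finally have "refl_vec I u (lin_map I W x) i = (\<Sum>j\<in>I. W i j * x j) - 2 * (\<Sum>l\<in>I. c l * x l) / N * u i"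
          using True by (simp add: refl_vec_def N_def lin_map_def)
        also have "\<dots> = (\<Sum>j\<in>I. W' i j * x j)"
          unfolding W'_def sum_distrib_left sum_distrib_right sum_divide_distrib sum_subtractf[symmetric]
          by (intro sum.cong refl) (simp add: algebra_simps)
        finally show ?thesis using True by (simp add: lin_map_def)
      qed (simp add: lin_map_def refl_vec_def)
    qed
    have "lin_map I W x \<in> extensional I" for x by (simp add: lin_map_def)
    \<comment> \<open>A reflection is its own inverse, so \<open>W\<close> is the reflection applied
      after \<open>W'\<close>; the reflection is absorbed into the integrand before the induction
      hypothesis is used for \<open>W'\<close>.\<close>
    then have "(\<integral>\<^sup>+x. F (lin_map I W x) \<partial>gauss I) = (\<integral>\<^sup>+x. (\<lambda>y. F (refl_vec I u y)) (lin_map I W' x) \<partial>gauss I)"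
      by (intro nn_integral_cong) (simp add: lin'[symmetric] refl_vec_refl_vec[where u=u, OF I m])
    also have "\<dots> = (\<integral>\<^sup>+x. F (refl_vec I u x) \<partial>gauss I)"
    proof (rule insert.IH)
      show "orth_on I W'" unfolding orth_on_def
      proof (intro ballI)
        fix j l assume jl: "j \<in> I" "l \<in> I"
        have "(\<Sum>i\<in>I. W' i j * W' i l) = (\<Sum>i\<in>I. W i j * W i l - 2 * c j / N * (u i * W i l) - 2 * c l / N * (u i * W i j)
              + 4 * c j * c l / N\<^sup>2 * (u i)\<^sup>2)"
          unfolding W'_def by (intro sum.cong refl) (simp add: algebra_simps power2_eq_square)
        also have "\<dots> = of_bool (j = l) - 2 * c j / N * c l - 2 * c l / N * c j + 4 * c j * c l / N\<^sup>2 * N"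
          unfolding sum.distrib sum_subtractf sum_distrib_left[symmetric] orth[OF jl] c_def N_def ..
        also have "\<dots> = of_bool (j = l)" using N by (simp add: field_simps power2_eq_square)
        finally show "(\<Sum>i\<in>I. W' i j * W' i l) = of_bool (j = l)" .
      qed
      show "W' i l = of_bool (i = l)" if "l \<in> I - K" "i \<in> I" for l i
      proof (cases "l = k")
        case True
        have "2 * c k / N = 1" using N Nc by simp
        with True show ?thesis by (simp add: W'_def u_def)
      next
        case False
        then have "c l = 0" using that c[of l] insert.prems(3)[of l k] kI by auto
        then show ?thesis using that False insert.prems(3)[of l i] by (auto simp: W'_def)
      qed
      show "(\<lambda>y. F (refl_vec I u y)) \<in> borel_measurable (PiM I (\<lambda>_. borel))"
        by (rule measurable_compose[OF measurable_refl_vec[OF I] insert.prems(4)])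
    qed (use insert in auto)
    also have "\<dots> = (\<integral>\<^sup>+x. F x \<partial>gauss I)"
      by (rule nn_integral_gauss_refl_vec[where u=u, OF I m insert.prems(4)])
    finally show ?thesis .
  qed
qed

text \<open>Every orthogonal map is a product of reflections, by induction on the basis vectors it moves.\<close>
theorem nn_integral_gauss_lin_map:
  assumes "finite I" "orth_on I W" "F \<in> borel_measurable (PiM I (\<lambda>_. borel))"
  shows "(\<integral>\<^sup>+x. F (lin_map I W x) \<partial>gauss I) = (\<integral>\<^sup>+x. F x \<partial>gauss I)"
  using assms by (intro nn_integral_gauss_lin_map_aux[where K=I]) auto

section \<open>One-dimensional estimates and Gaussian caps\<close>

lemma pi_ge_3: "pi \<ge> 3"
  using sin_x_le_x[of "pi / 6"] by (simp add: sin_30)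

text \<open>(9/8)^8 is about 2.566. The value 2.56 serves three comparisons: 16 <= e^3, sqrt 5 <= e
  and 2.78 * 3.17 <= 4 * e.\<close>

lemma exp_1_ge: "exp (1::real) \<ge> 2.56"
  using exp_ge_one_plus_x_over_n_power_n[of 8 "1::real"] by (simp add: power_divide eval_nat_numeral)

text \<open>The Householder reflection that exchanges e_k and \<open>a\<close>; its matrix is
  symmetric, so \<open>a\<close> is also its row \<open>k\<close>. For a = e_k the reflection
  degenerates and the identity is taken.\<close>

lemma orth_on_row_exists:
  assumes I: "finite I" "k \<in> I" and a: "(\<Sum>i\<in>I. (a i)\<^sup>2) = 1"
  obtains W where "orth_on I W" "\<And>j. j \<in> I \<Longrightarrow> W k j = a j"
proof (cases "\<forall>j\<in>I. a j = of_bool (k = j)")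
  case True
  show ?thesis
  proof
    show "orth_on I (\<lambda>i j. of_bool (i = j))"
      unfolding orth_on_def
    proof (intro ballI)
      fix j l assume "j \<in> I" "l \<in> I"
      have "(\<Sum>i\<in>I. of_bool (i = j) * of_bool (i = l)) = (\<Sum>i\<in>I. if j = i then of_bool (j = l) else (0::real))"
        by (intro sum.cong) auto
      with I \<open>j \<in> I\<close> show "(\<Sum>i\<in>I. of_bool (i = j) * of_bool (i = l)) = (of_bool (j = l) :: real)" by simp
    qed
  qed (use True in auto)
next
  case False
  define u where "u i = a i - of_bool (k = i)" for i
  define N where "N = (\<Sum>i\<in>I. (u i)\<^sup>2)"
  obtain m where m: "m \<in> I" "u m \<noteq> 0" using False by (auto simp: u_def)
  have "0 < (u m)\<^sup>2" using m by simp
  also have "\<dots> \<le> N" unfolding N_def by (rule member_le_sum) (use I m in auto)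
  finally have N: "N > 0" .
  have "N = (\<Sum>i\<in>I. (a i)\<^sup>2) - 2 * (\<Sum>i\<in>I. if k = i then a i else 0) + (\<Sum>i\<in>I. if k = i then 1 else 0)"
    unfolding N_def u_def sum_subtractf[symmetric] sum_distrib_left sum.distrib[symmetric]
    by (intro sum.cong refl) (auto simp: power2_eq_square algebra_simps)
  then have Nk: "N = - 2 * u k" using I a by (simp add: u_def)
  define W where "W i j = of_bool (i = j) - 2 / N * u i * u j" for i j
  show ?thesis
  proof
    show "orth_on I W" unfolding orth_on_def
    proof (intro ballI)
      fix j l assume jl: "j \<in> I" "l \<in> I"
      have "(\<Sum>i\<in>I. W i j * W i l) = (\<Sum>i\<in>I. (if j = i then of_bool (j = l) else 0) - 2 / N * u j * (if l = i then u l else 0)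
          - 2 / N * u l * (if j = i then u j else 0) + 4 / N\<^sup>2 * u j * u l * (u i)\<^sup>2)"
        unfolding W_def by (intro sum.cong refl) (auto simp: algebra_simps power2_eq_square)
      also have "\<dots> = (\<Sum>i\<in>I. (if j = i then of_bool (j = l) else 0)) - 2 / N * u j * (\<Sum>i\<in>I. if l = i then u l else 0)
          - 2 / N * u l * (\<Sum>i\<in>I. if j = i then u j else 0) + 4 / N\<^sup>2 * u j * u l * N"
        unfolding sum.distrib sum_subtractf sum_distrib_left[symmetric] N_def ..
      also have "\<dots> = of_bool (j = l)"
        using N I jl by (simp add: field_simps power2_eq_square)
      finally show "(\<Sum>i\<in>I. W i j * W i l) = of_bool (j = l)" .
    qed
    show "W k j = a j" if "j \<in> I" for j
    proof -
      have "2 / N * u k = - 1" using N Nk by (simp add: field_simps)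
      then show ?thesis by (simp add: W_def u_def)
    qed
  qed
qed

lemma orth_on_sum_squares:
  assumes "finite I" "orth_on I W"
  shows "(\<Sum>i\<in>I. (lin_map I W x i)\<^sup>2) = (\<Sum>i\<in>I. (x i)\<^sup>2)"
proof -
  have "(\<Sum>i\<in>I. (lin_map I W x i)\<^sup>2) = (\<Sum>i\<in>I. \<Sum>j\<in>I. \<Sum>l\<in>I. W i j * W i l * (x j * x l))"
    by (intro sum.cong refl) (simp add: lin_map_def power2_eq_square sum_product algebra_simps)
  also have "\<dots> = (\<Sum>j\<in>I. \<Sum>i\<in>I. \<Sum>l\<in>I. W i j * W i l * (x j * x l))"
    by (rule sum.swap)
  also have "\<dots> = (\<Sum>j\<in>I. \<Sum>l\<in>I. \<Sum>i\<in>I. W i j * W i l * (x j * x l))"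
    by (intro sum.cong refl sum.swap)
  also have "\<dots> = (\<Sum>j\<in>I. \<Sum>l\<in>I. (\<Sum>i\<in>I. W i j * W i l) * (x j * x l))"
    by (simp add: sum_distrib_right)
  also have "\<dots> = (\<Sum>j\<in>I. \<Sum>l\<in>I. if j = l then (x j)\<^sup>2 else 0)"
    using assms(2) by (intro sum.cong refl) (auto simp: orth_on_def power2_eq_square)
  also have "\<dots> = (\<Sum>j\<in>I. (x j)\<^sup>2)" using assms(1) by simp
  finally show ?thesis .
qed

section \<open>Linear forms in a Gaussian vector\<close>

lemma nn_integral_gauss_component:
  assumes "k \<in> I" "F \<in> borel_measurable borel"
  shows "(\<integral>\<^sup>+x. F (x k) \<partial>gauss I) = (\<integral>\<^sup>+y. F y \<partial>std_normal_distribution)"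
proof -
  have "distr (gauss I) std_normal_distribution (\<lambda>x. x k) = std_normal_distribution"
    by (rule distr_PiM_component) (use assms prob_space_std_normal in auto)
  then have "(\<integral>\<^sup>+y. F y \<partial>std_normal_distribution) = (\<integral>\<^sup>+y. F y \<partial>distr (gauss I) std_normal_distribution (\<lambda>x. x k))"
    by simp
  also have "\<dots> = (\<integral>\<^sup>+x. F (x k) \<partial>gauss I)"
    by (rule nn_integral_distr) (use assms in auto)
  finally show ?thesis ..
qed

text \<open>A rotation with row \<open>k\<close> equal to a / |a| turns the linear form into |a|
  times one coordinate. If \<open>a\<close> vanishes, both sides are \<open>F 0\<close>, as both
  measures have mass 1.\<close>

lemma nn_integral_gauss_inner:
  assumes I: "finite I" and F: "F \<in> borel_measurable borel"
  shows "(\<integral>\<^sup>+x. F (\<Sum>i\<in>I. a i * x i) \<partial>gauss I) = (\<integral>\<^sup>+y. F (sqrt (\<Sum>i\<in>I. (a i)\<^sup>2) * y) \<partial>std_normal_distribution)"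
proof (cases "\<forall>i\<in>I. a i = 0")
  case True
  interpret G: prob_space "gauss I" by (rule prob_space_gauss)
  interpret S: prob_space std_normal_distribution by (rule prob_space_std_normal)
  show ?thesis using True G.emeasure_space_1 S.emeasure_space_1 by simp
next
  case False
  then obtain k where k: "k \<in> I" "a k \<noteq> 0" by auto
  define A where "A = (\<Sum>i\<in>I. (a i)\<^sup>2)"
  have "0 < (a k)\<^sup>2" using k by simp
  also have "\<dots> \<le> A" unfolding A_def by (rule member_le_sum) (use I k in auto)
  finally have A: "A > 0" .
  have "(\<Sum>i\<in>I. (a i / sqrt A)\<^sup>2) = 1"
    using A by (simp add: power_divide sum_divide_distrib[symmetric] A_def[symmetric])
  from orth_on_row_exists[OF I k(1) this] obtain W where W: "orth_on I W" "\<And>j. j \<in> I \<Longrightarrow> W k j = a j / sqrt A"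
    by blast
  have eq: "(\<Sum>i\<in>I. a i * x i) = sqrt A * lin_map I W x k" for x
    using k A by (simp add: lin_map_def W sum_distrib_left cong: sum.cong)
  have G: "(\<lambda>y. F (sqrt A * y)) \<in> borel_measurable borel"
    by (rule measurable_compose[OF _ F]) simp
  have "(\<integral>\<^sup>+x. F (\<Sum>i\<in>I. a i * x i) \<partial>gauss I) = (\<integral>\<^sup>+x. F (sqrt A * lin_map I W x k) \<partial>gauss I)"
    unfolding eq ..
  also have "\<dots> = (\<integral>\<^sup>+x. F (sqrt A * x k) \<partial>gauss I)"
    by (rule nn_integral_gauss_lin_map[where F="\<lambda>x. F (sqrt A * x k)", OF I W(1)])
      (rule measurable_compose[where f="\<lambda>x. x k" and N=borel, OF _ G], use k in auto)
  also have "\<dots> = (\<integral>\<^sup>+y. F (sqrt A * y) \<partial>std_normal_distribution)"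
    by (rule nn_integral_gauss_component[OF k(1) G])
  finally show ?thesis by (simp add: A_def)
qed

text \<open>3 <= pi < 4 puts 1 / sqrt (2 * pi) between 0.35 and 0.41. Twice the upper value is the
  0.82 of the small-ball bound.\<close>

lemma std_normal_density_bounds: "std_normal_density x \<le> 0.41" "std_normal_density x \<ge> 0.35 * exp (- x\<^sup>2 / 2)"
proof -
  have "sqrt (2 * pi) \<ge> 100 / 41" using pi_ge_3 by (intro real_le_rsqrt) (simp add: power2_eq_square)
  then have a: "1 / sqrt (2 * pi) \<le> 0.41" by (simp add: field_simps)
  have "sqrt (2 * pi) \<le> 100 / 35" using pi_less_4 by (intro real_le_lsqrt) (auto simp: power2_eq_square)
  then have b: "1 / sqrt (2 * pi) \<ge> 0.35" by (simp add: field_simps)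
  have "(1 / sqrt (2 * pi)) * exp (- x\<^sup>2 / 2) \<le> 0.41 * 1" using a by (intro mult_mono) auto
  then show "std_normal_density x \<le> 0.41" unfolding std_normal_density_def by simp
  show "std_normal_density x \<ge> 0.35 * exp (- x\<^sup>2 / 2)" unfolding std_normal_density_def
    using b by (intro mult_right_mono) auto
qed

lemma std_normal_small_ball:
  assumes "\<epsilon> \<ge> 0"
  shows "emeasure std_normal_distribution {y. \<bar>y\<bar> \<le> \<epsilon>} \<le> ennreal (0.82 * \<epsilon>)"
proof -
  have S: "{y. \<bar>y\<bar> \<le> \<epsilon>} = {-\<epsilon>..\<epsilon>}" by auto
  have "emeasure std_normal_distribution {-\<epsilon>..\<epsilon>} = (\<integral>\<^sup>+y. ennreal (std_normal_density y) * indicator {-\<epsilon>..\<epsilon>} y \<partial>lborel)"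
    by (rule emeasure_density) auto
  also have "\<dots> \<le> (\<integral>\<^sup>+y. ennreal 0.41 * indicator {-\<epsilon>..\<epsilon>} y \<partial>lborel)"
    by (intro nn_integral_mono mult_right_mono ennreal_leI std_normal_density_bounds) auto
  also have "\<dots> = ennreal 0.41 * ennreal (2 * \<epsilon>)"
    using assms by (subst nn_integral_cmult_indicator) auto
  also have "\<dots> = ennreal (0.82 * \<epsilon>)" using assms by (simp add: ennreal_mult[symmetric])
  finally show ?thesis unfolding S .
qed

text \<open>0.59 = 1 - 0.82 / 2, from the small-ball bound for the complement.\<close>

lemma std_normal_ge_half: "ennreal 0.59 \<le> emeasure std_normal_distribution {y. \<bar>y\<bar> > 1 / 2}"
proof -
  interpret prob_space std_normal_distribution by (rule prob_space_std_normal)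
  have "{y. \<bar>y\<bar> > 1 / 2} = space std_normal_distribution - {y. \<bar>y\<bar> \<le> 1 / 2}" by auto
  moreover have "prob {y. \<bar>y\<bar> \<le> 1 / 2} \<le> 0.41"
    using std_normal_small_ball[of "1 / 2"] by (simp add: emeasure_eq_measure)
  moreover have "{y::real. \<bar>y\<bar> \<le> 1 / 2} \<in> events" by simp
  ultimately have "prob {y. \<bar>y\<bar> > 1 / 2} \<ge> 0.59" by (simp only: prob_compl) (simp add: power2_eq_square)
  then show ?thesis by (simp add: emeasure_eq_measure)
qed

text \<open>The window has length at least 0.4 since sqrt 2 - 1 >= 0.4 and b >= 1. Its upper end
  keeps y^2 / 2 <= b, so the density is at least 0.35 * exp (- b) on it, and 0.35 * 0.4 > 1 /
  8.\<close>

lemma std_normal_window: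
  assumes "b \<ge> 1"
  shows "ennreal (exp (- b) / 8) \<le> emeasure std_normal_distribution {y. sqrt b \<le> y \<and> y \<le> sqrt (2 * b)}"
proof -
  have S: "{y. sqrt b \<le> y \<and> y \<le> sqrt (2 * b)} = {sqrt b..sqrt (2 * b)}" by auto
  have "sqrt 2 \<ge> 1.4" by (intro real_le_rsqrt) (simp add: power2_eq_square)
  then have "sqrt b * 0.4 \<le> sqrt b * (sqrt 2 - 1)" using assms by (intro mult_left_mono) auto
  also have "\<dots> = sqrt (2 * b) - sqrt b" by (simp add: real_sqrt_mult algebra_simps)
  finally have "sqrt b * 0.4 \<le> sqrt (2 * b) - sqrt b" .
  moreover have "sqrt b \<ge> 1" using assms by simp
  ultimately have w: "sqrt (2 * b) - sqrt b \<ge> 0.4" by linarith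
  have "ennreal (exp (- b) / 8) \<le> ennreal (0.35 * exp (- b)) * ennreal (sqrt (2 * b) - sqrt b)"
  proof (subst ennreal_mult[symmetric])
    have "exp (- b) / 8 \<le> 0.35 * exp (- b) * 0.4" by simp
    also have "\<dots> \<le> 0.35 * exp (- b) * (sqrt (2 * b) - sqrt b)" using w by (intro mult_left_mono) auto
    finally show "ennreal (exp (- b) / 8) \<le> ennreal (0.35 * exp (- b) * (sqrt (2 * b) - sqrt b))" by (rule ennreal_leI)
  qed (use w assms in auto)
  also have "\<dots> = (\<integral>\<^sup>+y. ennreal (0.35 * exp (- b)) * indicator {sqrt b..sqrt (2 * b)} y \<partial>lborel)"
    using assms by (subst nn_integral_cmult_indicator) auto
  also have "\<dots> \<le> (\<integral>\<^sup>+y. ennreal (std_normal_density y) * indicator {sqrt b..sqrt (2 * b)} y \<partial>lborel)"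
  proof (rule nn_integral_mono)
    fix y
    show "ennreal (0.35 * exp (- b)) * indicator {sqrt b..sqrt (2 * b)} y
        \<le> ennreal (std_normal_density y) * indicator {sqrt b..sqrt (2 * b)} y"
    proof (cases "y \<in> {sqrt b..sqrt (2 * b)}")
      case True
      have "0 \<le> sqrt b" using assms by simp
      then have "y\<^sup>2 \<le> (sqrt (2 * b))\<^sup>2" using True order_trans[of 0 "sqrt b" y] by (intro power_mono) auto
      then have "0.35 * exp (- b) \<le> 0.35 * exp (- y\<^sup>2 / 2)" using assms by simp
      also have "\<dots> \<le> std_normal_density y" by (rule std_normal_density_bounds)
      finally show ?thesis using True by (simp add: ennreal_leI)
    qed simp
  qed
  also have "\<dots> = emeasure std_normal_distribution {sqrt b..sqrt (2 * b)}"
    by (rule emeasure_density[symmetric]) auto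
  finally show ?thesis unfolding S .
qed

text \<open>Since 1 / 2 - 2 / 5 = 1 / 10, the weighted density is sqrt 5 times the normal density of
  variance 5.\<close>

lemma std_normal_exp_square: "(\<integral>\<^sup>+y. ennreal (exp (2 / 5 * y\<^sup>2)) \<partial>std_normal_distribution) = ennreal (sqrt 5)"
proof -
  interpret prob_space "density lborel (normal_density 0 (sqrt 5))" by (rule prob_space_normal_density) simp
  have eq: "std_normal_density y * exp (2 / 5 * y\<^sup>2) = sqrt 5 * normal_density 0 (sqrt 5) y" for y
  proof -
    have "sqrt (2 * pi * (sqrt 5)\<^sup>2) = sqrt 5 * sqrt (2 * pi)" by (simp add: real_sqrt_mult[symmetric])
    moreover have "exp (- (y\<^sup>2 / 2)) * exp (2 / 5 * y\<^sup>2) = exp (- (y\<^sup>2 / 10))"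
      by (simp add: exp_add[symmetric] field_simps)
    ultimately show ?thesis unfolding normal_density_def by (simp add: field_simps)
  qed
  have "(\<integral>\<^sup>+y. ennreal (exp (2 / 5 * y\<^sup>2)) \<partial>std_normal_distribution)
      = (\<integral>\<^sup>+y. ennreal (std_normal_density y) * ennreal (exp (2 / 5 * y\<^sup>2)) \<partial>lborel)"
    by (rule nn_integral_density) auto
  also have "\<dots> = (\<integral>\<^sup>+y. ennreal (sqrt 5) * ennreal (normal_density 0 (sqrt 5) y) \<partial>lborel)"
    by (simp only: ennreal_mult''[symmetric] exp_ge_zero normal_density_nonneg eq)
  also have "\<dots> = ennreal (sqrt 5) * (\<integral>\<^sup>+y. ennreal (normal_density 0 (sqrt 5) y) \<partial>lborel)"
    by (rule nn_integral_cmult) auto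
  also have "(\<integral>\<^sup>+y. ennreal (normal_density 0 (sqrt 5) y) \<partial>lborel) = 1"
    using emeasure_space_1 by (simp add: emeasure_density)
  finally show ?thesis by simp
qed

lemma std_normal_square: "(\<integral>\<^sup>+y. ennreal (y\<^sup>2) \<partial>std_normal_distribution) = 1"
proof -
  have "(\<integral>\<^sup>+y. ennreal (y\<^sup>2) \<partial>std_normal_distribution) = (\<integral>\<^sup>+y. ennreal (std_normal_density y) * ennreal (y\<^sup>2) \<partial>lborel)"
    by (rule nn_integral_density) auto
  also have "\<dots> = (\<integral>\<^sup>+y. ennreal (std_normal_density y * y ^ (2 * 1)) \<partial>lborel)"
    by (simp add: ennreal_mult)
  also have "\<dots> = ennreal (fact (2 * 1) / (2 ^ 1 * fact 1))"
    unfolding integral_std_normal_moment_even[of 1, symmetric]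
    by (rule nn_integral_eq_integral[OF integrable_std_normal_moment]) simp
  finally show ?thesis by simp
qed

lemma nn_integral_gauss_sum_squares:
  assumes "finite I"
  shows "(\<integral>\<^sup>+x. ennreal (\<Sum>i\<in>I. (x i)\<^sup>2) \<partial>gauss I) = ennreal (card I)"
proof -
  have "(\<integral>\<^sup>+x. ennreal (\<Sum>i\<in>I. (x i)\<^sup>2) \<partial>gauss I) = (\<integral>\<^sup>+x. (\<Sum>i\<in>I. ennreal ((x i)\<^sup>2)) \<partial>gauss I)"
    by (simp add: sum_ennreal)
  also have "\<dots> = (\<Sum>i\<in>I. \<integral>\<^sup>+x. ennreal ((x i)\<^sup>2) \<partial>gauss I)"
    by (rule nn_integral_sum) (unfold measurable_gauss, measurable)
  also have "\<dots> = (\<Sum>i\<in>I. 1)"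
    by (intro sum.cong refl, subst nn_integral_gauss_component[where F="\<lambda>y. ennreal (y\<^sup>2)"])
      (auto simp: std_normal_square)
  finally show ?thesis by (simp add: ennreal_of_nat_eq_real_of_nat)
qed

text \<open>Jensen for the square root, through its tangent at the mean: with d^2 = card I, sqrt t
  <= d / 2 + t / (2 * d), and the right side has mean d when t is the squared norm.\<close>

lemma nn_integral_gauss_norm:
  assumes "finite I"
  shows "(\<integral>\<^sup>+x. ennreal (sqrt (\<Sum>i\<in>I. (x i)\<^sup>2)) \<partial>gauss I) \<le> ennreal (sqrt (card I))"
proof (cases "I = {}")
  case True
  then show ?thesis by (simp add: gauss_product.nn_integral_empty)
next
  case False
  interpret prob_space "gauss I" by (rule prob_space_gauss)
  define d where "d = sqrt (card I)"
  have d: "d > 0" "d\<^sup>2 = card I" using False assms by (auto simp: d_def card_gt_0_iff)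
  have ineq: "sqrt t \<le> d / 2 + t / (2 * d)" if "t \<ge> 0" for t
  proof -
    have "0 \<le> (sqrt t - d)\<^sup>2" by simp
    then have "2 * d * sqrt t \<le> d\<^sup>2 + t" using that by (simp add: power2_diff algebra_simps)
    then show ?thesis using d(1) by (simp add: field_simps power2_eq_square)
  qed
  have "(\<integral>\<^sup>+x. ennreal (sqrt (\<Sum>i\<in>I. (x i)\<^sup>2)) \<partial>gauss I) \<le> (\<integral>\<^sup>+x. ennreal (d / 2) + ennreal (1 / (2 * d)) * ennreal (\<Sum>i\<in>I. (x i)\<^sup>2) \<partial>gauss I)"
    using d ineq by (intro nn_integral_mono) (simp add: ennreal_mult[symmetric] ennreal_plus[symmetric] sum_nonneg del: ennreal_plus)
  also have "\<dots> = ennreal (d / 2) + ennreal (1 / (2 * d)) * (\<integral>\<^sup>+x. ennreal (\<Sum>i\<in>I. (x i)\<^sup>2) \<partial>gauss I)"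
    by (subst nn_integral_add, simp, unfold measurable_gauss, measurable, subst nn_integral_cmult)
     (unfold measurable_gauss, measurable, simp add: emeasure_space_1)
  also have "\<dots> = ennreal d"
    unfolding nn_integral_gauss_sum_squares[OF assms] d(2)[symmetric] using d(1)
    by (simp add: ennreal_mult[symmetric] ennreal_plus[symmetric] power2_eq_square del: ennreal_plus)
  finally show ?thesis by (simp add: d_def)
qed

text \<open>A window for one coordinate, and Markov's inequality for the others.\<close>
lemma gauss_window:
  assumes I: "finite I" "k \<in> I"
  shows "ennreal (exp (- real (card I)) / 16)
    \<le> emeasure (gauss I) {x \<in> space (gauss I). sqrt (card I) \<le> x k \<and> (\<Sum>i\<in>I. (x i)\<^sup>2) \<le> 4 * card I}"
proof -
  define b where "b = real (card I)"
  define J where "J = I - {k}"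
  have J: "finite J" "k \<notin> J" "I = insert k J" using I by (auto simp: J_def)
  have b1: "b \<ge> 1" using I unfolding b_def by (metis One_nat_def Suc_leI card_gt_0_iff empty_iff of_nat_1 of_nat_le_iff)
  have cJ: "real (card J) \<le> b" unfolding b_def J(3) using J by simp
  \<comment> \<open>The budget 4 * b for the squared norm is split evenly: 2 * b for coordinate
    \<open>k\<close>, and 2 * b for the others, whose squared norm has mean
    \<open>card J \<le> b\<close> and hence exceeds 2 * b with probability at most 1 / 2.\<close>
  let ?S = "{y. sqrt b \<le> y \<and> y \<le> sqrt (2 * b)}" and ?T = "{x \<in> space (gauss J). (\<Sum>i\<in>J. (x i)\<^sup>2) \<le> 2 * b}"
  let ?E = "{x \<in> space (gauss I). sqrt b \<le> x k \<and> (\<Sum>i\<in>I. (x i)\<^sup>2) \<le> 4 * b}"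
  have Em: "?E \<in> sets (gauss I)"
    using I by measurable
  have Tm: "?T \<in> sets (gauss J)"
    by measurable
  interpret GJ: prob_space "gauss J" by (rule prob_space_gauss)
  have "emeasure (gauss J) {x \<in> space (gauss J). ennreal (2 * b) \<le> ennreal (\<Sum>i\<in>J. (x i)\<^sup>2)} \<le> ennreal (1 / 2)"
  proof -
    have m: "(\<lambda>x. ennreal (\<Sum>i\<in>J. (x i)\<^sup>2)) \<in> borel_measurable (gauss J)" by measurable
    have "emeasure (gauss J) {x \<in> space (gauss J). 1 \<le> ennreal (1 / (2 * b)) * ennreal (\<Sum>i\<in>J. (x i)\<^sup>2)}
        \<le> ennreal (1 / (2 * b)) * (\<integral>\<^sup>+x. ennreal (\<Sum>i\<in>J. (x i)\<^sup>2) * indicator (space (gauss J)) x \<partial>gauss J)"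
      by (rule nn_integral_Markov_inequality) (use m in auto)
    also have "(\<integral>\<^sup>+x. ennreal (\<Sum>i\<in>J. (x i)\<^sup>2) * indicator (space (gauss J)) x \<partial>gauss J) = ennreal (card J)"
      unfolding nn_integral_gauss_sum_squares[OF J(1), symmetric] by (intro nn_integral_cong) auto
    also have "ennreal (1 / (2 * b)) * ennreal (card J) \<le> ennreal (1 / 2)"
    proof -
      have "1 / (2 * b) * card J \<le> 1 / 2" using b1 cJ by (simp add: field_simps)
      then show ?thesis by (subst ennreal_mult''[symmetric], simp) (rule ennreal_leI)
    qed
    also have "{x \<in> space (gauss J). 1 \<le> ennreal (1 / (2 * b)) * ennreal (\<Sum>i\<in>J. (x i)\<^sup>2)}
       = {x \<in> space (gauss J). ennreal (2 * b) \<le> ennreal (\<Sum>i\<in>J. (x i)\<^sup>2)}"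
      using b1 by (intro Collect_cong conj_cong refl)
        (simp add: ennreal_mult[symmetric] sum_nonneg field_simps flip: ennreal_1)
    finally show ?thesis .
  qed
  then have half: "GJ.prob {x \<in> space (gauss J). ennreal (2 * b) \<le> ennreal (\<Sum>i\<in>J. (x i)\<^sup>2)} \<le> 1 / 2" (is "GJ.prob ?B \<le> _")
    unfolding GJ.emeasure_eq_measure by (subst (asm) ennreal_le_iff) auto
  have sub: "space (gauss J) - ?B \<subseteq> ?T"
    by (auto simp: ennreal_le_iff sum_nonneg)
  have m: "?B \<in> sets (gauss J)"
    by measurable
  have T: "ennreal (1 / 2) \<le> emeasure (gauss J) ?T"
    unfolding GJ.emeasure_eq_measure using half GJ.prob_compl[OF m] GJ.finite_measure_mono[OF sub Tm]
    by (intro ennreal_leI) linarith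
  have "ennreal (exp (- b) / 16) = ennreal (1 / 2) * ennreal (exp (- b) / 8)"
    by (subst ennreal_mult''[symmetric]) auto
  also have "\<dots> \<le> emeasure (gauss J) ?T * emeasure std_normal_distribution ?S"
    by (intro mult_mono T std_normal_window b1) auto
  also have "\<dots> = (\<integral>\<^sup>+x. \<integral>\<^sup>+y. indicator ?T x * indicator ?S y \<partial>std_normal_distribution \<partial>gauss J)"
  proof -
    have "(\<integral>\<^sup>+y. indicator ?T x * indicator ?S y \<partial>std_normal_distribution) = indicator ?T x * emeasure std_normal_distribution ?S" for x
      by (rule nn_integral_cmult_indicator) simp
    then show ?thesis using Tm by (simp add: nn_integral_multc)
  qed
  also have "\<dots> \<le> (\<integral>\<^sup>+x. \<integral>\<^sup>+y. indicator ?E (x(k := y)) \<partial>std_normal_distribution \<partial>gauss J)"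
  proof (intro nn_integral_mono)
    fix x y
    assume x: "x \<in> space (gauss J)"
    show "indicator ?T x * indicator ?S y \<le> (indicator ?E (x(k := y)) :: ennreal)"
    proof (cases "x \<in> ?T \<and> y \<in> ?S")
      case True
      have "0 \<le> sqrt b" using b1 by simp
      then have "y\<^sup>2 \<le> (sqrt (2 * b))\<^sup>2" using True order_trans[of 0 "sqrt b" y] by (intro power_mono) auto
      then have y2: "y\<^sup>2 \<le> 2 * b" using b1 by simp
      have "(\<Sum>i\<in>I. ((x(k := y)) i)\<^sup>2) = y\<^sup>2 + (\<Sum>i\<in>J. ((x(k := y)) i)\<^sup>2)" unfolding J(3) using J by simp
      also have "(\<Sum>i\<in>J. ((x(k := y)) i)\<^sup>2) = (\<Sum>i\<in>J. (x i)\<^sup>2)" using J by (intro sum.cong) auto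
      also have "\<dots> \<le> 2 * b" using True by simp
      finally have "(\<Sum>i\<in>I. ((x(k := y)) i)\<^sup>2) \<le> 4 * b" using y2 by simp
      moreover have "x(k := y) \<in> space (gauss I)" using x J by (auto simp: space_PiM PiE_def extensional_def)
      ultimately have "x(k := y) \<in> ?E" using True by simp
      then show ?thesis by (simp add: indicator_def)
    qed (auto simp: indicator_def)
  qed
  also have "\<dots> = (\<integral>\<^sup>+x. indicator ?E x \<partial>gauss (insert k J))"
    by (rule gauss_product.product_nn_integral_insert[symmetric]) (use J Em in auto)
  also have "\<dots> = emeasure (gauss I) ?E" unfolding J(3)[symmetric] using Em by simp
  finally show ?thesis by (simp add: b_def)
qed

text \<open>A rotation that takes a / |a| to coordinate \<open>k\<close> turns the cap into the
  window of \<open>gauss_window\<close> and leaves the ball unchanged. For a = 0 the first condition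
  is void. The exponentially small mass is harmless, because it enters the expected norm only
  through a logarithm.\<close>

lemma gauss_cap:
  assumes I: "finite I" "I \<noteq> {}"
  shows "ennreal (exp (- real (card I)) / 16)
    \<le> emeasure (gauss I) {x \<in> space (gauss I). sqrt (card I) * sqrt (\<Sum>i\<in>I. (a i)\<^sup>2) \<le> \<bar>\<Sum>i\<in>I. a i * x i\<bar> \<and> (\<Sum>i\<in>I. (x i)\<^sup>2) \<le> 4 * card I}"
    (is "_ \<le> emeasure _ ?E")
proof -
  have Em: "?E \<in> sets (gauss I)" by measurable
  obtain k0 where k0: "k0 \<in> I" using I by auto
  show ?thesis
  proof (cases "\<forall>i\<in>I. a i = 0")
    case True
    have "{x \<in> space (gauss I). sqrt (card I) \<le> x k0 \<and> (\<Sum>i\<in>I. (x i)\<^sup>2) \<le> 4 * card I} \<subseteq> ?E" using True by auto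
    from emeasure_mono[OF this Em] show ?thesis using gauss_window[OF I(1) k0] by (rule order_trans[rotated])
  next
    case False
    then obtain k where k: "k \<in> I" "a k \<noteq> 0" by auto
    define A where "A = (\<Sum>i\<in>I. (a i)\<^sup>2)"
    have "0 < (a k)\<^sup>2" using k by simp
    also have "\<dots> \<le> A" unfolding A_def by (rule member_le_sum) (use I k in auto)
    finally have A: "A > 0" .
    have "(\<Sum>i\<in>I. (a i / sqrt A)\<^sup>2) = 1"
      using A by (simp add: power_divide sum_divide_distrib[symmetric] A_def[symmetric])
    from orth_on_row_exists[OF I(1) k(1) this] obtain W where W: "orth_on I W" "\<And>j. j \<in> I \<Longrightarrow> W k j = a j / sqrt A"
      by blast
    have eq: "(\<Sum>i\<in>I. a i * x i) = sqrt A * lin_map I W x k" for x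
      using k A by (simp add: lin_map_def W sum_distrib_left cong: sum.cong)
    let ?D = "{x \<in> space (gauss I). sqrt (card I) \<le> x k \<and> (\<Sum>i\<in>I. (x i)\<^sup>2) \<le> 4 * card I}"
    have Dm: "?D \<in> sets (gauss I)" using k by measurable
    have "emeasure (gauss I) ?D = (\<integral>\<^sup>+x. indicator ?D (lin_map I W x) \<partial>gauss I)"
      using nn_integral_gauss_lin_map[where F="indicator ?D", OF I(1) W(1)] Dm by (simp add: sets_gauss)
    also have "\<dots> \<le> (\<integral>\<^sup>+x. indicator ?E x \<partial>gauss I)"
    proof (intro nn_integral_mono)
      fix x assume x: "x \<in> space (gauss I)"
      have "x \<in> ?E" if "lin_map I W x \<in> ?D"
      proof -
        have "sqrt (card I) * sqrt A \<le> lin_map I W x k * sqrt A" using that A by (intro mult_right_mono) auto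
        then show ?thesis using that x unfolding eq A_def[symmetric]
          by (auto simp: orth_on_sum_squares[OF I(1) W(1)] mult.commute)
      qed
      then show "indicator ?D (lin_map I W x) \<le> (indicator ?E x :: ennreal)" by (auto simp: indicator_def)
    qed
    also have "\<dots> = emeasure (gauss I) ?E" using Em by simp
    finally show ?thesis using gauss_window[OF I(1) k(1)] by (rule order_trans[rotated])
  qed
qed

section \<open>Vector and spectral norms\<close>

lemma vnorm_sum: "v \<in> carrier_vec n \<Longrightarrow> vnorm v = sqrt (\<Sum>i<n. (v $ i)\<^sup>2)"
  by (auto simp: vnorm_def scalar_prod_def power2_eq_square atLeast0LessThan)

lemma vnorm_square: "v \<in> carrier_vec n \<Longrightarrow> (vnorm v)\<^sup>2 = (\<Sum>i<n. (v $ i)\<^sup>2)"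
  by (simp add: vnorm_sum sum_nonneg)

lemma vnorm_nonneg [simp]: "0 \<le> vnorm v"
proof -
  have "v \<in> carrier_vec (dim_vec v)" by simp
  from vnorm_sum[OF this] show ?thesis by (simp add: sum_nonneg)
qed

lemma vnorm_square_scalar: "(vnorm v)\<^sup>2 = v \<bullet> v"
proof -
  have "v \<in> carrier_vec (dim_vec v)" by simp
  from vnorm_square[OF this] show ?thesis by (simp add: scalar_prod_def power2_eq_square atLeast0LessThan)
qed

lemma vnorm_zero [simp]: "vnorm (0\<^sub>v n) = 0"
  by (simp add: vnorm_def)

lemma mult_mat_vec_zero: "M \<in> carrier_mat r c \<Longrightarrow> M *\<^sub>v 0\<^sub>v c = (0\<^sub>v r :: real Matrix.vec)"
  by (auto intro!: eq_vecI)

lemma vnorm_eq_0: "v \<in> carrier_vec n \<Longrightarrow> vnorm v = 0 \<longleftrightarrow> v = 0\<^sub>v n"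
  by (auto simp: vnorm_sum sum_nonneg_eq_0_iff intro!: eq_vecI)

lemma vnorm_pos: "v \<in> carrier_vec n \<Longrightarrow> v \<noteq> 0\<^sub>v n \<Longrightarrow> vnorm v > 0"
  using vnorm_eq_0[of v n] vnorm_nonneg[of v] by linarith

lemma vnorm_smult: "vnorm (c \<cdot>\<^sub>v v) = \<bar>c\<bar> * vnorm v"
  by (simp add: vnorm_def real_sqrt_mult[symmetric] mult.assoc[symmetric] real_sqrt_mult power2_eq_square[symmetric])

lemma scalar_prod_le_vnorm:
  assumes "v \<in> carrier_vec n" "w \<in> carrier_vec n"
  shows "\<bar>v \<bullet> w\<bar> \<le> vnorm v * vnorm w"
proof -
  have "\<bar>\<Sum>i<n. v $ i * w $ i\<bar> \<le> L2_set (($) v) {..<n} * L2_set (($) w) {..<n}"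
    using L2_set_mult_ineq[of "($) v" "($) w" "{..<n}"] sum_abs[of "\<lambda>i. v $ i * w $ i" "{..<n}"]
    by (simp add: abs_mult)
  then show ?thesis using assms by (simp add: vnorm_sum L2_set_def scalar_prod_def atLeast0LessThan)
qed

lemma scalar_prod_mult_mat_vec:
  fixes M :: "real mat"
  assumes "M \<in> carrier_mat r c" "v \<in> carrier_vec r" "w \<in> carrier_vec c"
  shows "v \<bullet> (M *\<^sub>v w) = (transpose_mat M *\<^sub>v v) \<bullet> w"
  using assms by (simp add: transpose_vec_mult_scalar)

text \<open>Supplies the boundedness of the set whose supremum is \<open>spec_norm\<close>;
  \<open>Sup\<close> on the reals says nothing about unbounded sets.\<close>

lemma vnorm_mult_mat_vec_bound:
  assumes M: "M \<in> carrier_mat r c" and x: "x \<in> carrier_vec c"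
  shows "vnorm (M *\<^sub>v x) \<le> frob_norm M * vnorm x"
proof -
  have "(vnorm (M *\<^sub>v x))\<^sup>2 = (\<Sum>i<r. (row M i \<bullet> x)\<^sup>2)"
    using assms by (subst vnorm_square[where n=r]) (auto intro!: sum.cong)
  also have "\<dots> \<le> (\<Sum>i<r. (vnorm (row M i))\<^sup>2 * (vnorm x)\<^sup>2)"
  proof (intro sum_mono)
    fix i assume "i \<in> {..<r}"
    have "\<bar>row M i \<bullet> x\<bar> \<le> vnorm (row M i) * vnorm x" by (rule scalar_prod_le_vnorm) (use assms in auto)
    then have "\<bar>row M i \<bullet> x\<bar>\<^sup>2 \<le> (vnorm (row M i) * vnorm x)\<^sup>2" by (intro power_mono) auto
    then show "(row M i \<bullet> x)\<^sup>2 \<le> (vnorm (row M i))\<^sup>2 * (vnorm x)\<^sup>2" by (simp add: power_mult_distrib)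
  qed
  also have "\<dots> = (frob_norm M)\<^sup>2 * (vnorm x)\<^sup>2"
  proof -
    have "(\<Sum>i<r. (vnorm (row M i))\<^sup>2) = (\<Sum>i<r. \<Sum>j<c. (M $$ (i, j))\<^sup>2)"
    proof (intro sum.cong refl)
      fix i assume "i \<in> {..<r}"
      have "(vnorm (row M i))\<^sup>2 = (\<Sum>j<c. (row M i $ j)\<^sup>2)" by (rule vnorm_square) (use M in auto)
      then show "(vnorm (row M i))\<^sup>2 = (\<Sum>j<c. (M $$ (i, j))\<^sup>2)" using M \<open>i \<in> {..<r}\<close> by simp
    qed
    then show ?thesis using M by (simp add: sum_distrib_right[symmetric] frob_norm_def sum_nonneg)
  qed
  finally have "(vnorm (M *\<^sub>v x))\<^sup>2 \<le> (frob_norm M * vnorm x)\<^sup>2" by (simp add: power_mult_distrib)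
  then show ?thesis by (rule power2_le_imp_le) (simp add: frob_norm_def sum_nonneg)
qed

section \<open>The spectral norm as an operator norm\<close>

lemma spec_norm_le:
  assumes "M \<in> carrier_mat r c" "\<And>x. x \<in> carrier_vec c \<Longrightarrow> vnorm (M *\<^sub>v x) \<le> C * vnorm x" "C \<ge> 0"
  shows "spec_norm M \<le> C"
  unfolding spec_norm_def
proof (rule cSup_least)
  have "vnorm (M *\<^sub>v 0\<^sub>v c) \<in> {vnorm (M *\<^sub>v x) |x. x \<in> carrier_vec (dim_col M) \<and> vnorm x \<le> 1}"
    using assms(1) by (intro CollectI exI[of _ "0\<^sub>v c"]) auto
  then show "{vnorm (M *\<^sub>v x) |x. x \<in> carrier_vec (dim_col M) \<and> vnorm x \<le> 1} \<noteq> {}" by blast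
  fix y assume "y \<in> {vnorm (M *\<^sub>v x) |x. x \<in> carrier_vec (dim_col M) \<and> vnorm x \<le> 1}"
  then obtain x where x: "x \<in> carrier_vec c" "vnorm x \<le> 1" "y = vnorm (M *\<^sub>v x)" using assms(1) by auto
  have "y \<le> C * vnorm x" using assms(2) x by simp
  also have "\<dots> \<le> C" using x(2) assms(3) by (simp add: mult_left_le)
  finally show "y \<le> C" .
qed

lemma vnorm_le_spec_norm:
  assumes M: "M \<in> carrier_mat r c" and x: "x \<in> carrier_vec c"
  shows "vnorm (M *\<^sub>v x) \<le> spec_norm M * vnorm x"
proof (cases "x = 0\<^sub>v c")
  case True
  then show ?thesis using M by (simp add: mult_mat_vec_zero)
next
  case False
  then have px: "vnorm x > 0" using vnorm_pos x by blast
  define y where "y = (1 / vnorm x) \<cdot>\<^sub>v x"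
  have y: "y \<in> carrier_vec c" "vnorm y = 1" using x px by (auto simp: y_def vnorm_smult)
  have "vnorm (M *\<^sub>v y) \<le> spec_norm M"
    unfolding spec_norm_def
  proof (rule cSup_upper)
    show "vnorm (M *\<^sub>v y) \<in> {vnorm (M *\<^sub>v x) |x. x \<in> carrier_vec (dim_col M) \<and> vnorm x \<le> 1}"
      using M y by auto
    show "bdd_above {vnorm (M *\<^sub>v x) |x. x \<in> carrier_vec (dim_col M) \<and> vnorm x \<le> 1}"
    proof (rule bdd_aboveI)
      fix v assume "v \<in> {vnorm (M *\<^sub>v x) |x. x \<in> carrier_vec (dim_col M) \<and> vnorm x \<le> 1}"
      then obtain x where x: "x \<in> carrier_vec c" "vnorm x \<le> 1" "v = vnorm (M *\<^sub>v x)" using M by auto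
      have "v \<le> frob_norm M * vnorm x" using vnorm_mult_mat_vec_bound[OF M x(1)] x by simp
      also have "\<dots> \<le> frob_norm M" using x(2) by (simp add: mult_left_le frob_norm_def sum_nonneg)
      finally show "v \<le> frob_norm M" .
    qed
  qed
  moreover have "vnorm (M *\<^sub>v y) = vnorm (M *\<^sub>v x) / vnorm x"
    unfolding y_def using M x px by (simp add: mult_mat_vec vnorm_smult)
  ultimately show ?thesis using px by (simp add: field_simps)
qed

lemma spec_norm_nonneg: 
  assumes "M \<in> carrier_mat r c" "c > 0"
  shows "0 \<le> spec_norm M"
proof -
  have "unit_vec c 0 \<bullet> unit_vec c 0 = (1::real)" using assms(2) by simp
  then have "vnorm (unit_vec c 0) = 1" by (simp add: vnorm_def)
  then show ?thesis using vnorm_le_spec_norm[OF assms(1), of "unit_vec c 0"]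
    order_trans[OF vnorm_nonneg[of "M *\<^sub>v unit_vec c 0"]] by simp
qed

text \<open>An almost-maximiser \<open>x\<close> of \<open>vnorm (M x)\<close> gives \<open>a = M\<^sup>T w\<close> with \<open>w\<close> the direction of \<open>M x\<close>.\<close>
lemma spec_norm_gt_witness:
  assumes M: "M \<in> carrier_mat r c" and t: "spec_norm M > t" "t \<ge> 0"
  obtains a where "a \<in> carrier_vec c" "vnorm a > t" "\<And>g. g \<in> carrier_vec c \<Longrightarrow> \<bar>a \<bullet> g\<bar> \<le> vnorm (M *\<^sub>v g)"
proof -
  have "\<not> (\<forall>x\<in>carrier_vec c. vnorm (M *\<^sub>v x) \<le> t * vnorm x)"
    using spec_norm_le[OF M _ t(2)] t(1) by force
  then obtain x where x: "x \<in> carrier_vec c" "vnorm (M *\<^sub>v x) > t * vnorm x" by force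
  have Mx: "M *\<^sub>v x \<in> carrier_vec r" using M x by simp
  define n where "n = vnorm (M *\<^sub>v x)"
  have n: "n > 0" using x(2) t(2) vnorm_nonneg[of x] unfolding n_def by (meson mult_nonneg_nonneg le_less_trans)
  have xn: "x \<noteq> 0\<^sub>v c" using n M x unfolding n_def by (auto simp: mult_mat_vec_zero)
  then have xp: "vnorm x > 0" using x vnorm_pos by blast
  define w where "w = (1 / n) \<cdot>\<^sub>v (M *\<^sub>v x)"
  have w: "w \<in> carrier_vec r" "vnorm w = 1" using Mx n by (auto simp: w_def vnorm_smult n_def)
  define a where "a = transpose_mat M *\<^sub>v w"
  have a: "a \<in> carrier_vec c" using M w by (simp add: a_def)
  have ag: "a \<bullet> g = w \<bullet> (M *\<^sub>v g)" if "g \<in> carrier_vec c" for g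
    unfolding a_def using scalar_prod_mult_mat_vec[OF M w(1) that] by simp
  show ?thesis
  proof
    show "a \<in> carrier_vec c" by fact
    show "\<bar>a \<bullet> g\<bar> \<le> vnorm (M *\<^sub>v g)" if "g \<in> carrier_vec c" for g
      using scalar_prod_le_vnorm[OF w(1), of "M *\<^sub>v g"] M that w(2) unfolding ag[OF that] by simp
    have "a \<bullet> x = (1 / n) * ((M *\<^sub>v x) \<bullet> (M *\<^sub>v x))" unfolding ag[OF x(1)] w_def using Mx by simp
    also have "\<dots> = n" unfolding vnorm_square_scalar[symmetric] n_def[symmetric] using n by (simp add: power2_eq_square)
    finally have "n \<le> vnorm a * vnorm x" using scalar_prod_le_vnorm[OF a x(1)] n by simp
    then have "t * vnorm x < vnorm a * vnorm x" using x(2) by (simp add: n_def)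
    then show "vnorm a > t" using xp by simp
  qed
qed

text \<open>Padding the \<open>p\<close> equations with zero rows to a square system makes the
  determinant vanish. This is the dimension count behind the Courant-Fischer test vectors and behind
  the normal to all rows but one of a Gaussian matrix.\<close>

lemma underdetermined_nontrivial_solution:
  fixes f :: "nat \<Rightarrow> nat \<Rightarrow> real"
  assumes "p < c"
  obtains v where "v \<in> carrier_vec c" "v \<noteq> 0\<^sub>v c" "\<And>i. i < p \<Longrightarrow> (\<Sum>j<c. f i j * v $ j) = 0"
proof -
  define M where "M = mat c c (\<lambda>(i,j). if i < p then f i j else 0)"
  have M: "M \<in> carrier_mat c c" by (simp add: M_def)
  have "M = mat\<^sub>r c c (\<lambda>i. if i = p then 0\<^sub>v c else row M i)"
    using assms by (intro eq_matI) (auto simp: M_def)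
  moreover have "det (mat\<^sub>r c c (\<lambda>i. if i = p then 0\<^sub>v c else row M i)) = 0"
    by (rule det_row_0) (use assms M in auto)
  ultimately have "det M = 0" by simp
  then obtain v where v: "v \<in> carrier_vec c" "v \<noteq> 0\<^sub>v c" "M *\<^sub>v v = 0\<^sub>v c"
    using det_0_iff_vec_prod_zero[OF M] by auto
  show ?thesis
  proof
    fix i assume i: "i < p"
    have "(M *\<^sub>v v) $ i = (\<Sum>j<c. f i j * v $ j)"
      using i assms v(1) by (auto simp: M_def scalar_prod_def atLeast0LessThan intro!: sum.cong)
    then show "(\<Sum>j<c. f i j * v $ j) = 0" using v(3) i assms by simp
  qed fact+
qed

section \<open>Determinants and explicit inverses\<close>

lemma invertible_mat_iff_det:
  fixes M :: "real mat"
  assumes M: "M \<in> carrier_mat b b"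
  shows "invertible_mat M \<longleftrightarrow> det M \<noteq> 0"
proof
  assume "invertible_mat M"
  then obtain B where B: "M * B = 1\<^sub>m b" "B * M = 1\<^sub>m (dim_row B)"
    using M unfolding invertible_mat_def inverts_mat_def by auto
  then have "B \<in> carrier_mat b b" using M
    by (metis carrier_matD(2) carrier_matI index_mult_mat(2) index_mult_mat(3) index_one_mat(2) index_one_mat(3))
  then have "det M * det B = 1" using det_mult[OF M, of B] B(1) by simp
  then show "det M \<noteq> 0" by auto
next
  assume d: "det M \<noteq> 0"
  define B where "B = (1 / det M) \<cdot>\<^sub>m adj_mat M"
  have B: "B \<in> carrier_mat b b" using adj_mat(1)[OF M] by (simp add: B_def)
  have "M * B = 1\<^sub>m b" "B * M = 1\<^sub>m b" unfolding B_def using adj_mat[OF M] d M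
    by (auto simp: mult_smult_distrib[OF M adj_mat(1)[OF M]] mult_smult_assoc_mat[OF adj_mat(1)[OF M] M] intro!: eq_matI)
  then show "invertible_mat M" using M B unfolding invertible_mat_def inverts_mat_def by auto
qed

text \<open>The adjugate formula lets statements about the inverse be written with polynomials in
  the entries, which are measurable also where the determinant vanishes.\<close>

lemma minv:
  fixes M :: "real mat"
  assumes M: "M \<in> carrier_mat b b" and d: "det M \<noteq> 0"
  shows "minv M = (1 / det M) \<cdot>\<^sub>m adj_mat M" "minv M \<in> carrier_mat b b"
    "M * minv M = 1\<^sub>m b" "minv M * M = 1\<^sub>m b"
proof -
  define B where "B = (1 / det M) \<cdot>\<^sub>m adj_mat M"
  have B: "B \<in> carrier_mat b b" using adj_mat(1)[OF M] by (simp add: B_def)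
  have MB: "M * B = 1\<^sub>m b" "B * M = 1\<^sub>m b" unfolding B_def using adj_mat[OF M] d M
    by (auto simp: mult_smult_distrib[OF M adj_mat(1)[OF M]] mult_smult_assoc_mat[OF adj_mat(1)[OF M] M] intro!: eq_matI)
  then have "M \<in> Units (ring_mat TYPE(real) b ())"
    using M B unfolding Units_def ring_mat_def by auto
  then obtain C where C: "mat_inverse M = Some C" using mat_inverse(1)[OF M, where b="()"] by (cases "mat_inverse M") auto
  then have C': "M * C = 1\<^sub>m b" "C * M = 1\<^sub>m b" "C \<in> carrier_mat b b" using mat_inverse(2)[OF M] by auto
  have "C = C * (M * B)" using C' MB by simp
  also have "\<dots> = C * M * B" using C' M B by (intro assoc_mult_mat[symmetric]) auto
  also have "\<dots> = B" using C' B by simp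
  finally have "C = B" .
  moreover have "minv M = C" using C by (simp add: minv_def)
  ultimately show "minv M = (1 / det M) \<cdot>\<^sub>m adj_mat M" "minv M \<in> carrier_mat b b"
    "M * minv M = 1\<^sub>m b" "minv M * M = 1\<^sub>m b" using C' by (auto simp: B_def)
qed

lemma vnorm_mult_mat_vec_sum:
  assumes "M \<in> carrier_mat r c" "v \<in> carrier_vec c"
  shows "vnorm (M *\<^sub>v v) = sqrt (\<Sum>i<r. (\<Sum>j<c. M $$ (i, j) * v $ j)\<^sup>2)"
  using assms by (subst vnorm_sum[where n=r]) (auto simp: scalar_prod_def atLeast0LessThan)

section \<open>Expected norm of a Gaussian matrix\<close>

text \<open>By continuity, rational test vectors suffice, and countably many conditions give
  measurability. They are coded by the countable type \<open>rat list\<close>; on a list shorter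
  than \<open>c\<close> the entry \<open>l ! i\<close> is unspecified, but it is still some rational
  number.\<close>

lemma spec_norm_le_iff_rational:
  assumes M: "M \<in> carrier_mat r c" and a: "a \<ge> 0"
  shows "spec_norm M \<le> a \<longleftrightarrow>
    (\<forall>l::rat list. vnorm (M *\<^sub>v Matrix.vec c (\<lambda>i. of_rat (l ! i))) \<le> a * vnorm (Matrix.vec c (\<lambda>i. of_rat (l ! i))))"
proof
  assume le: "spec_norm M \<le> a"
  show "\<forall>l::rat list. vnorm (M *\<^sub>v Matrix.vec c (\<lambda>i. of_rat (l ! i))) \<le> a * vnorm (Matrix.vec c (\<lambda>i. of_rat (l ! i)))"
  proof
    fix l :: "rat list"
    let ?v = "Matrix.vec c (\<lambda>i. of_rat (l ! i)) :: real Matrix.vec"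
    have "vnorm (M *\<^sub>v ?v) \<le> spec_norm M * vnorm ?v" by (rule vnorm_le_spec_norm[OF M]) simp
    also have "\<dots> \<le> a * vnorm ?v" using le by (intro mult_right_mono) auto
    finally show "vnorm (M *\<^sub>v ?v) \<le> a * vnorm ?v" .
  qed
next
  assume rat: "\<forall>l::rat list. vnorm (M *\<^sub>v Matrix.vec c (\<lambda>i. of_rat (l ! i))) \<le> a * vnorm (Matrix.vec c (\<lambda>i. of_rat (l ! i)))"
  show "spec_norm M \<le> a"
  proof (rule spec_norm_le[OF M _ a])
    fix y :: "real Matrix.vec" assume y: "y \<in> carrier_vec c"
    have "\<exists>q::rat. \<bar>of_rat q - y $ i\<bar> < 1 / real (Suc k)" for i k
    proof -
      obtain q where "q \<in> \<rat>" "y $ i < q" "q < y $ i + 1 / real (Suc k)"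
        using Rats_dense_in_real[of "y $ i" "y $ i + 1 / real (Suc k)"] by auto
      moreover from this(1) obtain q' :: rat where "q = of_rat q'" by (elim Rats_cases)
      ultimately show ?thesis by (intro exI[of _ q']) auto
    qed
    then obtain q :: "nat \<Rightarrow> nat \<Rightarrow> rat" where q: "\<And>i k. \<bar>of_rat (q i k) - y $ i\<bar> < 1 / real (Suc k)" by metis
    have lim: "(\<lambda>k. of_rat (q i k)) \<longlonglongrightarrow> y $ i" for i
    proof (rule LIMSEQ_I)
      fix e :: real assume "e > 0"
      then obtain K where K: "1 / real (Suc K) < e" using nat_approx_posE by blast
      show "\<exists>K. \<forall>k\<ge>K. norm (of_rat (q i k) - y $ i) < e"
      proof (intro exI allI impI)
        fix k assume "k \<ge> K"
        then have "1 / real (Suc k) \<le> 1 / real (Suc K)" by (simp add: frac_le)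
        then show "norm (of_rat (q i k) - y $ i) < e" using q[of i k] K by simp
      qed
    qed
    have le: "sqrt (\<Sum>i<r. (\<Sum>j<c. M $$ (i, j) * of_rat (q j k))\<^sup>2) \<le> a * sqrt (\<Sum>j<c. (of_rat (q j k))\<^sup>2)" for k
    proof -
      define l where "l = map (\<lambda>i. q i k) [0..<c]"
      have eq: "Matrix.vec c (\<lambda>i. of_rat (l ! i)) = (Matrix.vec c (\<lambda>i. of_rat (q i k)) :: real Matrix.vec)"
        by (auto simp: l_def)
      have "vnorm (M *\<^sub>v Matrix.vec c (\<lambda>i. of_rat (q i k))) \<le> a * vnorm (Matrix.vec c (\<lambda>i. of_rat (q i k)))"
        using rat[rule_format, of l] unfolding eq .
      then show ?thesis using M by (simp add: vnorm_mult_mat_vec_sum[where r=r and c=c] vnorm_sum[where n=c])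
    qed
    have "sqrt (\<Sum>i<r. (\<Sum>j<c. M $$ (i, j) * y $ j)\<^sup>2) \<le> a * sqrt (\<Sum>j<c. (y $ j)\<^sup>2)"
      by (rule LIMSEQ_le[of "\<lambda>k. sqrt (\<Sum>i<r. (\<Sum>j<c. M $$ (i, j) * of_rat (q j k))\<^sup>2)" _ "\<lambda>k. a * sqrt (\<Sum>j<c. (of_rat (q j k))\<^sup>2)"])
        (use le in \<open>auto intro!: tendsto_intros lim\<close>)
    then show "vnorm (M *\<^sub>v y) \<le> a * vnorm y"
      using M y by (simp add: vnorm_mult_mat_vec_sum[where r=r and c=c] vnorm_sum[where n=c])
  qed
qed

lemma borel_measurable_spec_norm:
  assumes M: "\<And>x. x \<in> space N \<Longrightarrow> M x \<in> carrier_mat r c" and c: "c > 0"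
    and m: "\<And>i j. i < r \<Longrightarrow> j < c \<Longrightarrow> (\<lambda>x. M x $$ (i, j)) \<in> borel_measurable N"
  shows "(\<lambda>x. spec_norm (M x)) \<in> borel_measurable N"
  unfolding borel_measurable_iff_le
proof
  fix a :: real
  show "{x \<in> space N. spec_norm (M x) \<le> a} \<in> sets N"
  proof (cases "a \<ge> 0")
    case False
    then have "{x \<in> space N. spec_norm (M x) \<le> a} = {}" using spec_norm_nonneg[OF M c] by force
    then show ?thesis by (simp only: sets.empty_sets)
  next
    case True
    have "(\<lambda>x. vnorm (M x *\<^sub>v v)) \<in> borel_measurable N" if v: "v \<in> carrier_vec c" for v
    proof -
      have "(\<lambda>x. sqrt (\<Sum>i<r. (\<Sum>j<c. M x $$ (i, j) * v $ j)\<^sup>2)) \<in> borel_measurable N"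
        using m by (intro measurable_compose[OF _ borel_measurable_sqrt] borel_measurable_sum borel_measurable_power borel_measurable_times) auto
      then show ?thesis by (rule measurable_cong[THEN iffD2, rotated]) (rule vnorm_mult_mat_vec_sum[OF M v])
    qed
    then have "{x \<in> space N. \<forall>l::rat list. vnorm (M x *\<^sub>v Matrix.vec c (\<lambda>i. of_rat (l ! i))) \<le> a * vnorm (Matrix.vec c (\<lambda>i. of_rat (l ! i)))} \<in> sets N"
      by (intro sets.sets_Collect_countable_All borel_measurable_le) auto
    moreover have "{x \<in> space N. spec_norm (M x) \<le> a} = {x \<in> space N. \<forall>l::rat list. vnorm (M x *\<^sub>v Matrix.vec c (\<lambda>i. of_rat (l ! i))) \<le> a * vnorm (Matrix.vec c (\<lambda>i. of_rat (l ! i)))}"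
      using spec_norm_le_iff_rational[OF M True] by auto
    ultimately show ?thesis by simp
  qed
qed

lemma sum_singleton_times: "(\<Sum>p\<in>{r} \<times> B. f p) = (\<Sum>j\<in>B. f (r, j))"
  by (rule sum.reindex_bij_witness[of _ "\<lambda>j. (r, j)" snd]) auto

text \<open>The rows are independent. For fixed \<open>h\<close> the inner product of one row with
  \<open>h\<close> is |h| times a standard normal variable y, so each row contributes at most the
  mean of exp (2 / 5 * y^2), which is sqrt 5.\<close>

lemma gauss_rows_exp_moment:
  fixes h :: "nat \<Rightarrow> real" and b :: nat and R :: "'r set"
  assumes "finite R" and \<mu>: "\<mu> \<ge> 0" "\<mu> * (\<Sum>j<b. (h j)\<^sup>2) \<le> 2 / 5"
  shows "(\<integral>\<^sup>+x. ennreal (exp (\<mu> * (\<Sum>i\<in>R. (\<Sum>j<b. h j * x (i, j))\<^sup>2))) \<partial>gauss (R \<times> {0..<b})) \<le> ennreal (sqrt 5 ^ card R)"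
  using assms(1)
proof (induction R)
  case empty
  then show ?case using prob_space.emeasure_space_1[OF prob_space_gauss, of "{} :: ('r \<times> nat) set"] by simp
next
  case (insert r R)
  let ?I = "{r} \<times> {0..<b}" and ?J = "R \<times> {0..<b}"
  have IJ: "insert r R \<times> {0..<b} = ?I \<union> ?J" "?I \<inter> ?J = {}" "finite ?I" "finite ?J" using insert by auto
  have m: "(\<lambda>x. ennreal (exp (\<mu> * (\<Sum>i\<in>A. (\<Sum>j<b. h j * x (i, j))\<^sup>2)))) \<in> borel_measurable (gauss (A \<times> {0..<b}))"
    for A :: "'r set" by measurable
  let ?f = "\<lambda>x. ennreal (exp (\<mu> * (\<Sum>i\<in>insert r R. (\<Sum>j<b. h j * x (i, j))\<^sup>2)))"
  have eq: "?f (merge ?I ?J (x, y)) = ennreal (exp (\<mu> * (\<Sum>p\<in>?I. h (snd p) * x p)\<^sup>2)) * ennreal (exp (\<mu> * (\<Sum>i\<in>R. (\<Sum>j<b. h j * y (i, j))\<^sup>2)))" for x y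
  proof -
    have "(\<Sum>j<b. h j * merge ?I ?J (x, y) (r, j)) = (\<Sum>p\<in>?I. h (snd p) * x p)"
      by (auto simp: merge_def lessThan_atLeast0 sum_singleton_times intro!: sum.cong)
    moreover have "(\<Sum>i\<in>R. (\<Sum>j<b. h j * merge ?I ?J (x, y) (i, j))\<^sup>2) = (\<Sum>i\<in>R. (\<Sum>j<b. h j * y (i, j))\<^sup>2)"
      using insert by (intro sum.cong refl arg_cong[where f="\<lambda>z. z\<^sup>2"]) (auto simp: merge_def)
    ultimately show ?thesis using insert by (simp add: ennreal_mult[symmetric] exp_add[symmetric] distrib_left)
  qed
  have "(\<integral>\<^sup>+x. ?f x \<partial>gauss (insert r R \<times> {0..<b})) = (\<integral>\<^sup>+x. \<integral>\<^sup>+y. ?f (merge ?I ?J (x, y)) \<partial>gauss ?J \<partial>gauss ?I)"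
    using gauss_product.product_nn_integral_fold[OF IJ(2-4)] m[of "insert r R"] unfolding IJ(1) by blast
  also have "\<dots> = (\<integral>\<^sup>+x. ennreal (exp (\<mu> * (\<Sum>p\<in>?I. h (snd p) * x p)\<^sup>2)) \<partial>gauss ?I) * (\<integral>\<^sup>+y. ennreal (exp (\<mu> * (\<Sum>i\<in>R. (\<Sum>j<b. h j * y (i, j))\<^sup>2))) \<partial>gauss ?J)"
    unfolding eq by (subst nn_integral_cmult[OF m], subst nn_integral_multc) auto
  also have "\<dots> \<le> ennreal (sqrt 5) * ennreal (sqrt 5 ^ card R)"
  proof (intro mult_mono insert.IH)
    have S: "(\<Sum>p\<in>?I. (h (snd p))\<^sup>2) = (\<Sum>j<b. (h j)\<^sup>2)"
      by (simp add: lessThan_atLeast0 sum_singleton_times)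
    have "(\<integral>\<^sup>+x. ennreal (exp (\<mu> * (\<Sum>p\<in>?I. h (snd p) * x p)\<^sup>2)) \<partial>gauss ?I)
        = (\<integral>\<^sup>+y. ennreal (exp (\<mu> * (sqrt (\<Sum>j<b. (h j)\<^sup>2) * y)\<^sup>2)) \<partial>std_normal_distribution)"
      using nn_integral_gauss_inner[OF IJ(3), of "\<lambda>z. ennreal (exp (\<mu> * z\<^sup>2))" "\<lambda>p. h (snd p)"] unfolding S by simp
    also have "\<dots> \<le> (\<integral>\<^sup>+y. ennreal (exp (2 / 5 * y\<^sup>2)) \<partial>std_normal_distribution)"
    proof (intro nn_integral_mono ennreal_leI)
      fix y :: real
      have "\<mu> * (sqrt (\<Sum>j<b. (h j)\<^sup>2) * y)\<^sup>2 = \<mu> * (\<Sum>j<b. (h j)\<^sup>2) * y\<^sup>2"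
        by (simp add: power_mult_distrib sum_nonneg)
      also have "\<dots> \<le> 2 / 5 * y\<^sup>2" using \<mu> by (intro mult_right_mono) auto
      finally show "exp (\<mu> * (sqrt (\<Sum>j<b. (h j)\<^sup>2) * y)\<^sup>2) \<le> exp (2 / 5 * y\<^sup>2)" by simp
    qed
    finally show "(\<integral>\<^sup>+x. ennreal (exp (\<mu> * (\<Sum>p\<in>?I. h (snd p) * x p)\<^sup>2)) \<partial>gauss ?I) \<le> ennreal (sqrt 5)"
      unfolding std_normal_exp_square .
  qed auto
  also have "\<dots> = ennreal (sqrt 5 ^ card (insert r R))" using insert by (simp add: ennreal_mult[symmetric])
  finally show ?case .
qed

text \<open>On the cap around a witness \<open>a\<close> with |a| >= t, |M h| >= sqrt b * t and so
  \<mu> * |M h|^2 >= t^2 / 10. Averaging over \<open>h\<close> in the ball therefore dominates the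
  exponential of |M|^2 / 10 up to the cap mass exp (- b) / 16, whatever direction the witness has.
  After the integrals are exchanged, \<open>h\<close> is fixed while \<open>M\<close> varies, and
  \<open>gauss_rows_exp_moment\<close> applies.\<close>

lemma gauss_spec_norm_exp_moment:
  fixes b n :: nat
  assumes b: "1 \<le> b" "b \<le> n"
  defines "M \<equiv> \<lambda>x. mat (n - b) b (\<lambda>(i, j). x (i + b, j))"
  shows "(\<integral>\<^sup>+x. ennreal (exp ((spec_norm (M x))\<^sup>2 / 10)) \<partial>gauss ({b..<n} \<times> {0..<b})) \<le> ennreal (16 * exp b * sqrt 5 ^ (n - b))"
proof -
  \<comment> \<open>\<mu> * b = 1 / 10 is the exponent gained on the cap, and \<mu> * 4 * b = 2 / 5
    is the largest value that \<open>gauss_rows_exp_moment\<close> admits, reached on the boundary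
    of the ball.\<close>
  define \<mu> where "\<mu> = 1 / (10 * real b)"
  let ?I = "{b..<n} \<times> {0..<b}" and ?J = "{..<b}"
  let ?f = "\<lambda>x h. indicator {h. (\<Sum>j<b. (h j)\<^sup>2) \<le> 4 * real b} h * ennreal (exp (\<mu> * (\<Sum>i\<in>{b..<n}. (\<Sum>j<b. h j * x (i, j))\<^sup>2)))"
  have Mc: "M x \<in> carrier_mat (n - b) b" for x by (simp add: M_def)
  have Mn: "(vnorm (M x *\<^sub>v Matrix.vec b h))\<^sup>2 = (\<Sum>i\<in>{b..<n}. (\<Sum>j<b. h j * x (i, j))\<^sup>2)" for x h
  proof -
    have "(vnorm (M x *\<^sub>v Matrix.vec b h))\<^sup>2 = (\<Sum>i<n - b. (\<Sum>j<b. M x $$ (i, j) * Matrix.vec b h $ j)\<^sup>2)"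
      by (simp add: vnorm_mult_mat_vec_sum[OF Mc, of "Matrix.vec b h"] sum_nonneg)
    also have "\<dots> = (\<Sum>i<n - b. (\<Sum>j<b. h j * x (i + b, j))\<^sup>2)"
      by (intro sum.cong refl arg_cong[where f="\<lambda>z. z\<^sup>2"]) (auto simp: M_def mult.commute)
    also have "\<dots> = (\<Sum>i\<in>{b..<n}. (\<Sum>j<b. h j * x (i, j))\<^sup>2)"
      using b by (intro sum.reindex_bij_witness[of _ "\<lambda>i. i - b" "\<lambda>i. i + b"]) auto
    finally show ?thesis .
  qed
  have Nm: "(\<lambda>x. spec_norm (M x)) \<in> borel_measurable (gauss ?I)"
  proof (rule borel_measurable_spec_norm[OF Mc])
    fix i j assume "i < n - b" "j < b"
    then have "(i + b, j) \<in> ?I" by auto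
    then have "(\<lambda>x. x (i + b, j)) \<in> borel_measurable (gauss ?I)" by measurable
    then show "(\<lambda>x. M x $$ (i, j)) \<in> borel_measurable (gauss ?I)" using \<open>i < n - b\<close> \<open>j < b\<close> by (simp add: M_def)
  qed (use b in simp)
  have key: "ennreal (exp (- real b) / 16) * ennreal (exp ((spec_norm (M x))\<^sup>2 / 10)) \<le> (\<integral>\<^sup>+h. ?f x h \<partial>gauss ?J)" for x
  proof -
    have base: "ennreal (exp (- real b) / 16) * ennreal (exp (t\<^sup>2 / 10)) \<le> (\<integral>\<^sup>+h. ?f x h \<partial>gauss ?J)"
      if t: "t \<ge> 0" and a: "a \<in> carrier_vec b" "vnorm a \<ge> t" "\<And>g. g \<in> carrier_vec b \<Longrightarrow> \<bar>a \<bullet> g\<bar> \<le> vnorm (M x *\<^sub>v g)" for t a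
    proof -
      let ?E = "{h \<in> space (gauss ?J). sqrt (card ?J) * sqrt (\<Sum>i<b. (a $ i)\<^sup>2) \<le> \<bar>\<Sum>i<b. a $ i * h i\<bar> \<and> (\<Sum>i<b. (h i)\<^sup>2) \<le> 4 * card ?J}"
      have Em: "?E \<in> sets (gauss ?J)" by measurable
      have "ennreal (exp (- real b) / 16) * ennreal (exp (t\<^sup>2 / 10)) \<le> emeasure (gauss ?J) ?E * ennreal (exp (t\<^sup>2 / 10))"
        using gauss_cap[of ?J "\<lambda>i. a $ i"] b by (intro mult_right_mono) (auto simp: lessThan_empty_iff)
      also have "\<dots> = (\<integral>\<^sup>+h. ennreal (exp (t\<^sup>2 / 10)) * indicator ?E h \<partial>gauss ?J)"
        using Em by (subst nn_integral_cmult_indicator) (auto simp: mult.commute)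
      also have "\<dots> \<le> (\<integral>\<^sup>+h. ?f x h \<partial>gauss ?J)"
      proof (intro nn_integral_mono)
        fix h
        show "ennreal (exp (t\<^sup>2 / 10)) * indicator ?E h \<le> ?f x h"
        proof (cases "h \<in> ?E")
          case True
          have "a \<bullet> Matrix.vec b h = (\<Sum>i<b. a $ i * h i)" by (simp add: scalar_prod_def lessThan_atLeast0)
          then have "\<bar>\<Sum>i<b. a $ i * h i\<bar> \<le> vnorm (M x *\<^sub>v Matrix.vec b h)" using a(3)[of "Matrix.vec b h"] by simp
          moreover have "sqrt b * t \<le> sqrt b * vnorm a" using a(2) by (intro mult_left_mono) auto
          moreover have "sqrt b * vnorm a \<le> \<bar>\<Sum>i<b. a $ i * h i\<bar>" using True vnorm_sum[OF a(1)] by simp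
          ultimately have "sqrt b * t \<le> vnorm (M x *\<^sub>v Matrix.vec b h)" by linarith
          then have "(sqrt b * t)\<^sup>2 \<le> (vnorm (M x *\<^sub>v Matrix.vec b h))\<^sup>2" using t by (intro power_mono) auto
          then have "b * t\<^sup>2 \<le> (\<Sum>i\<in>{b..<n}. (\<Sum>j<b. h j * x (i, j))\<^sup>2)" by (simp add: Mn power_mult_distrib)
          then have "\<mu> * (b * t\<^sup>2) \<le> \<mu> * (\<Sum>i\<in>{b..<n}. (\<Sum>j<b. h j * x (i, j))\<^sup>2)"
            by (intro mult_left_mono) (auto simp: \<mu>_def)
          moreover have "\<mu> * (b * t\<^sup>2) = t\<^sup>2 / 10" using b by (simp add: \<mu>_def)
          ultimately have "exp (t\<^sup>2 / 10) \<le> exp (\<mu> * (\<Sum>i\<in>{b..<n}. (\<Sum>j<b. h j * x (i, j))\<^sup>2))" by simp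
          then show ?thesis using True by (simp add: ennreal_leI)
        qed simp
      qed
      finally show ?thesis .
    qed
    show ?thesis
    proof (cases "spec_norm (M x) = 0")
      case True
      show ?thesis using base[of 0 "0\<^sub>v b"] True by simp
    next
      case False
      then have pos: "spec_norm (M x) > 0" using spec_norm_nonneg[OF Mc[of x]] b by simp
      \<comment> \<open>\<open>spec_norm\<close> is a supremum and the witness lemma is strict, so
        the bound is obtained for every \<open>t\<close> below the norm and then carried over by
        letting \<open>t\<close> tend to the norm from the left.\<close>
      have step: "ennreal (exp (- real b) / 16 * exp (t\<^sup>2 / 10)) \<le> (\<integral>\<^sup>+h. ?f x h \<partial>gauss ?J)"
        if "0 < t" "t < spec_norm (M x)" for t
      proof -
        from spec_norm_gt_witness[OF Mc that(2)] that(1) obtain a where "a \<in> carrier_vec b" "vnorm a > t"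
          "\<And>g. g \<in> carrier_vec b \<Longrightarrow> \<bar>a \<bullet> g\<bar> \<le> vnorm (M x *\<^sub>v g)" by (metis less_imp_le)
        then show ?thesis using base[of t a] that by (subst ennreal_mult) auto
      qed
      show ?thesis
      proof (cases "\<integral>\<^sup>+h. ?f x h \<partial>gauss ?J")
        case (real v)
        have "((\<lambda>t. exp (- real b) / 16 * exp (t\<^sup>2 / 10)) \<longlongrightarrow> exp (- real b) / 16 * exp ((spec_norm (M x))\<^sup>2 / 10)) (at_left (spec_norm (M x)))"
          by (intro tendsto_intros) auto
        moreover have "\<forall>\<^sub>F t in at_left (spec_norm (M x)). exp (- real b) / 16 * exp (t\<^sup>2 / 10) \<le> v"
          using eventually_at_left_real[OF pos] by eventually_elim (use step real in auto)
        ultimately have "exp (- real b) / 16 * exp ((spec_norm (M x))\<^sup>2 / 10) \<le> v"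
          by (intro tendsto_upperbound) auto
        then show ?thesis unfolding real by (subst ennreal_mult[symmetric]) (auto intro: ennreal_leI)
      qed simp
    qed
  qed
  have fm: "(\<lambda>(x, h). ?f x h) \<in> borel_measurable (gauss ?I \<Otimes>\<^sub>M gauss ?J)"
  proof -
    have [measurable]: "(\<lambda>h. indicator {h. (\<Sum>j<b. (h j)\<^sup>2) \<le> 4 * real b} h :: ennreal) \<in> borel_measurable (gauss ?J)"
    proof (rule borel_measurable_indicator')
      show "{x \<in> space (gauss ?J). x \<in> {h. (\<Sum>j<b. (h j)\<^sup>2) \<le> 4 * real b}} \<in> sets (gauss ?J)" by simp measurable
    qed
    show ?thesis by measurable
  qed
  have PS: "pair_sigma_finite (gauss ?I) (gauss ?J)"
    by (simp add: pair_sigma_finite_def prob_space_imp_sigma_finite prob_space_gauss)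
  have "ennreal (exp (- real b) / 16) * (\<integral>\<^sup>+x. ennreal (exp ((spec_norm (M x))\<^sup>2 / 10)) \<partial>gauss ?I)
     = (\<integral>\<^sup>+x. ennreal (exp (- real b) / 16) * ennreal (exp ((spec_norm (M x))\<^sup>2 / 10)) \<partial>gauss ?I)"
    using measurable_compose[OF Nm, of "\<lambda>s. ennreal (exp (s\<^sup>2 / 10))" borel]
    by (intro nn_integral_cmult[symmetric]) simp
  also have "\<dots> \<le> (\<integral>\<^sup>+x. \<integral>\<^sup>+h. ?f x h \<partial>gauss ?J \<partial>gauss ?I)"
    by (intro nn_integral_mono key)
  also have "\<dots> = (\<integral>\<^sup>+h. \<integral>\<^sup>+x. ?f x h \<partial>gauss ?I \<partial>gauss ?J)"
    by (rule pair_sigma_finite.Fubini'[OF PS fm, symmetric])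
  also have "\<dots> \<le> (\<integral>\<^sup>+h. ennreal (sqrt 5 ^ (n - b)) \<partial>gauss ?J)"
  proof (intro nn_integral_mono)
    fix h
    show "(\<integral>\<^sup>+x. ?f x h \<partial>gauss ?I) \<le> ennreal (sqrt 5 ^ (n - b))"
    proof (cases "(\<Sum>j<b. (h j)\<^sup>2) \<le> 4 * real b")
      case True
      have "\<mu> * (\<Sum>j<b. (h j)\<^sup>2) \<le> \<mu> * (4 * real b)" using True by (intro mult_left_mono) (auto simp: \<mu>_def)
      also have "\<dots> = 2 / 5" using b by (simp add: \<mu>_def)
      finally have "\<mu> * (\<Sum>j<b. (h j)\<^sup>2) \<le> 2 / 5" .
      from gauss_rows_exp_moment[OF _ _ this, of "{b..<n}"] True show ?thesis by (simp add: \<mu>_def)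
    qed simp
  qed
  also have "\<dots> = ennreal (sqrt 5 ^ (n - b))"
    using prob_space.emeasure_space_1[OF prob_space_gauss, of ?J] by simp
  finally have fin: "ennreal (exp (- real b) / 16) * (\<integral>\<^sup>+x. ennreal (exp ((spec_norm (M x))\<^sup>2 / 10)) \<partial>gauss ?I) \<le> ennreal (sqrt 5 ^ (n - b))" .
  have "(\<integral>\<^sup>+x. ennreal (exp ((spec_norm (M x))\<^sup>2 / 10)) \<partial>gauss ?I)
     = ennreal (16 * exp b) * (ennreal (exp (- real b) / 16) * (\<integral>\<^sup>+x. ennreal (exp ((spec_norm (M x))\<^sup>2 / 10)) \<partial>gauss ?I))"
    by (simp add: mult.assoc[symmetric] ennreal_mult[symmetric] exp_minus)
  also have "\<dots> \<le> ennreal (16 * exp b) * ennreal (sqrt 5 ^ (n - b))"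
    by (intro mult_left_mono fin) auto
  also have "\<dots> = ennreal (16 * exp b * sqrt 5 ^ (n - b))" by (simp add: ennreal_mult[symmetric])
  finally show ?thesis .
qed

text \<open>Jensen's inequality, through the tangent of \<open>exp\<close> at \<open>L\<close> and of the square root at \<open>10 L\<close>.\<close>
lemma gauss_expected_spec_norm:
  fixes b n :: nat
  assumes b: "1 \<le> b" "b \<le> n"
  defines "M \<equiv> \<lambda>x. mat (n - b) b (\<lambda>(i, j). x (i + b, j))"
  shows "(\<integral>\<^sup>+x. ennreal (spec_norm (M x)) \<partial>gauss ({b..<n} \<times> {0..<b})) \<le> ennreal (sqrt (10 * (real n + 3)))"
proof -
  let ?I = "{b..<n} \<times> {0..<b}"
  \<comment> \<open>\<open>exp L\<close> dominates the exponential moment: 16 <= e^3 and sqrt 5 <= e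
    give 16 * exp b * sqrt 5 ^ (n - b) <= exp (n + 3).\<close>
  define L where "L = real n + 3"
  define D where "D = sqrt (10 * L)"
  have L: "L \<ge> 3" "D > 0" "D\<^sup>2 = 10 * L" by (auto simp: L_def D_def)
  have Mc: "M x \<in> carrier_mat (n - b) b" for x by (simp add: M_def)
  have Nm: "(\<lambda>x. spec_norm (M x)) \<in> borel_measurable (gauss ?I)"
  proof (rule borel_measurable_spec_norm[OF Mc])
    fix i j assume "i < n - b" "j < b"
    then have "(i + b, j) \<in> ?I" by auto
    then have "(\<lambda>x. x (i + b, j)) \<in> borel_measurable (gauss ?I)" by measurable
    then show "(\<lambda>x. M x $$ (i, j)) \<in> borel_measurable (gauss ?I)" using \<open>i < n - b\<close> \<open>j < b\<close> by (simp add: M_def)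
  qed (use b in simp)
  have e16: "16 * exp b * sqrt 5 ^ (n - b) \<le> exp L"
  proof -
    have "(2.56::real) ^ 3 \<le> exp 1 ^ 3" by (intro power_mono exp_1_ge) simp
    moreover have "exp (1::real) ^ 3 = exp 3" by (simp add: exp_of_nat_mult[symmetric])
    ultimately have "16 \<le> exp (3::real)" by (simp add: eval_nat_numeral)
    moreover have "sqrt 5 ^ (n - b) \<le> exp 1 ^ (n - b)"
    proof (intro power_mono)
      have "sqrt 5 \<le> 2.56" by (intro real_le_lsqrt) (auto simp: power2_eq_square)
      then show "sqrt 5 \<le> exp 1" using exp_1_ge by linarith
    qed simp
    ultimately have "16 * exp b * sqrt 5 ^ (n - b) \<le> exp 3 * exp b * exp 1 ^ (n - b)"
      by (intro mult_mono) auto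
    also have "\<dots> = exp L" using b by (simp add: exp_of_nat_mult[symmetric] exp_add[symmetric] L_def of_nat_diff)
    finally show ?thesis .
  qed
  have pw: "s \<le> D / 2 + 5 * (L - 1) / D + 5 / D * exp (- L) * exp (s\<^sup>2 / 10)" for s
  proof -
    have "0 \<le> (s - D)\<^sup>2" by simp
    then have 1: "s \<le> D / 2 + 5 / D * (s\<^sup>2 / 10)" using L(2) by (simp add: power2_diff field_simps power2_eq_square)
    have "exp (s\<^sup>2 / 10 - L) = exp (- L) * exp (s\<^sup>2 / 10)" by (simp add: mult_exp_exp)
    then have "s\<^sup>2 / 10 \<le> L - 1 + exp (- L) * exp (s\<^sup>2 / 10)"
      using exp_ge_add_one_self[of "s\<^sup>2 / 10 - L"] by linarith
    then have "5 / D * (s\<^sup>2 / 10) \<le> 5 / D * (L - 1 + exp (- L) * exp (s\<^sup>2 / 10))" using L(2) by (intro mult_left_mono) auto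
    also have "\<dots> = 5 * (L - 1) / D + 5 / D * exp (- L) * exp (s\<^sup>2 / 10)" using L(2) by (simp add: field_simps)
    finally show ?thesis using 1 by linarith
  qed
  have "(\<integral>\<^sup>+x. ennreal (spec_norm (M x)) \<partial>gauss ?I)
      \<le> (\<integral>\<^sup>+x. ennreal (D / 2 + 5 * (L - 1) / D) + ennreal (5 / D * exp (- L)) * ennreal (exp ((spec_norm (M x))\<^sup>2 / 10)) \<partial>gauss ?I)"
    using L pw by (intro nn_integral_mono) (simp add: ennreal_mult''[symmetric] ennreal_plus[symmetric] ennreal_leI del: ennreal_plus)
  also have "\<dots> = ennreal (D / 2 + 5 * (L - 1) / D) + ennreal (5 / D * exp (- L)) * (\<integral>\<^sup>+x. ennreal (exp ((spec_norm (M x))\<^sup>2 / 10)) \<partial>gauss ?I)"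
    using measurable_compose[OF Nm, of "\<lambda>s. ennreal (exp (s\<^sup>2 / 10))" borel] prob_space.emeasure_space_1[OF prob_space_gauss, of ?I]
    by (subst nn_integral_add, simp, simp, subst nn_integral_cmult) auto
  also have "\<dots> \<le> ennreal (D / 2 + 5 * (L - 1) / D) + ennreal (5 / D * exp (- L)) * ennreal (exp L)"
    using gauss_spec_norm_exp_moment[OF b] e16 unfolding M_def
    by (intro add_left_mono mult_left_mono) (auto intro: order_trans ennreal_leI)
  also have "\<dots> = ennreal (D / 2 + 5 * (L - 1) / D + 5 / D * (exp (- L) * exp L))"
    using L by (simp add: ennreal_mult''[symmetric] ennreal_plus[symmetric] mult.assoc del: ennreal_plus)
  \<comment> \<open>The two tangent points fit together: the sum is D / 2 + 5 * L / D, which is D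
    because D^2 = 10 * L.\<close>
  also have "D / 2 + 5 * (L - 1) / D + 5 / D * (exp (- L) * exp L) = D"
    using L(2,3) by (simp add: exp_minus field_simps power2_eq_square)
  finally show ?thesis by (simp add: D_def L_def)
qed

section \<open>Inverse of a square Gaussian matrix\<close>

lemma borel_measurable_det:
  fixes M :: "'x \<Rightarrow> real mat"
  assumes "\<And>x. x \<in> space N \<Longrightarrow> M x \<in> carrier_mat b b"
    and "\<And>i j. i < b \<Longrightarrow> j < b \<Longrightarrow> (\<lambda>x. M x $$ (i, j)) \<in> borel_measurable N"
  shows "(\<lambda>x. det (M x)) \<in> borel_measurable N"
proof -
  have "(\<lambda>x. \<Sum>p | p permutes {0..<b}. signof p * (\<Prod>i = 0..<b. M x $$ (i, p i))) \<in> borel_measurable N"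
    by (intro borel_measurable_sum borel_measurable_times borel_measurable_prod borel_measurable_const assms(2))
      (auto dest: permutes_in_image)
  then show ?thesis by (rule measurable_cong[THEN iffD2, rotated]) (rule det_def'[OF assms(1)])
qed

lemma borel_measurable_adj_mat:
  fixes M :: "'x \<Rightarrow> real mat"
  assumes M: "\<And>x. x \<in> space N \<Longrightarrow> M x \<in> carrier_mat b b"
    and m: "\<And>i j. i < b \<Longrightarrow> j < b \<Longrightarrow> (\<lambda>x. M x $$ (i, j)) \<in> borel_measurable N"
    and ij: "i < b" "j < b"
  shows "(\<lambda>x. adj_mat (M x) $$ (i, j)) \<in> borel_measurable N"
proof -
  have "(\<lambda>x. det (mat_delete (M x) j i)) \<in> borel_measurable N"
  proof (rule borel_measurable_det[where b="b - 1"])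
    show "mat_delete (M x) j i \<in> carrier_mat (b - 1) (b - 1)" if "x \<in> space N" for x
      using M[OF that] by (rule mat_delete_carrier)
    fix k l assume kl: "k < b - 1" "l < b - 1"
    have "(\<lambda>x. M x $$ (if k < j then k else Suc k, if l < i then l else Suc l)) \<in> borel_measurable N"
      by (rule m) (use kl in auto)
    then show "(\<lambda>x. mat_delete (M x) j i $$ (k, l)) \<in> borel_measurable N"
      by (rule measurable_cong[THEN iffD2, rotated]) (use M kl in \<open>fastforce simp: mat_delete_def\<close>)
  qed
  then have "(\<lambda>x. (-1) ^ (j + i) * det (mat_delete (M x) j i)) \<in> borel_measurable N" by simp
  then show ?thesis
    by (rule measurable_cong[THEN iffD2, rotated]) (use M ij in \<open>fastforce simp: adj_mat_def cofactor_def\<close>)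
qed

lemma borel_measurable_mat_entry:
  "i < b \<Longrightarrow> j < b \<Longrightarrow> {k..<k + b} \<times> {k..<k + b} \<subseteq> I \<Longrightarrow>
    (\<lambda>x. mat b b (\<lambda>(i, j). x (i + k, j + k)) $$ (i, j)) \<in> borel_measurable (PiM I (\<lambda>_. borel :: real measure))"
  by (auto intro!: measurable_component_singleton)

lemma std_normal_point: "emeasure std_normal_distribution {c} = 0"
proof -
  have "emeasure std_normal_distribution {c} = (\<integral>\<^sup>+y. ennreal (std_normal_density y) * indicator {c} y \<partial>lborel)"
    by (rule emeasure_density) auto
  also have "\<dots> = (\<integral>\<^sup>+y. ennreal (std_normal_density c) * indicator {c} y \<partial>lborel)"
    by (intro nn_integral_cong) (auto simp: indicator_def)
  also have "\<dots> = 0" by (subst nn_integral_cmult_indicator) auto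
  finally show ?thesis .
qed

text \<open>Given that the complementary minor does not vanish, the determinant is a nonconstant affine function
  of the corner entry.\<close>
lemma gauss_det_null:
  fixes I :: "(nat \<times> nat) set"
  assumes "finite I" "{k..<k + b} \<times> {k..<k + b} \<subseteq> I"
  shows "emeasure (gauss I) {x \<in> space (gauss I). det (mat b b (\<lambda>(i, j). x (i + k, j + k))) = 0} = 0"
  using assms(2)
\<comment> \<open>The offset \<open>k\<close> varies because deleting the first row and column
  leaves the block that starts at \<open>Suc k\<close>.\<close>
proof (induction b arbitrary: k)
  case 0
  then show ?case by (simp add: det_dim_zero)
next
  case (Suc b)
  let ?G = "\<lambda>x. mat (Suc b) (Suc b) (\<lambda>(i, j). x (i + k, j + k)) :: real mat"
  let ?H = "\<lambda>x. mat b b (\<lambda>(i, j). x (i + Suc k, j + Suc k)) :: real mat"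
  let ?c = "(k, k)"
  have sub: "{Suc k..<Suc k + b} \<times> {Suc k..<Suc k + b} \<subseteq> I" using Suc.prems by auto
  have cI: "?c \<in> I" using Suc.prems by auto
  have Gm: "(\<lambda>x. det (?G x)) \<in> borel_measurable (gauss I)"
    unfolding measurable_gauss by (rule borel_measurable_det[where b="Suc b"], simp) (rule borel_measurable_mat_entry, use Suc.prems in auto)
  have Hm: "(\<lambda>x. det (?H x)) \<in> borel_measurable (gauss I)"
    unfolding measurable_gauss by (rule borel_measurable_det[where b=b], simp) (rule borel_measurable_mat_entry, use sub in auto)
  let ?Z = "{x \<in> space (gauss I). det (?G x) = 0}" and ?Y = "{x \<in> space (gauss I). det (?H x) = 0}"
    and ?X = "{x \<in> space (gauss I). det (?H x) \<noteq> 0 \<and> det (?G x) = 0}"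
  have m: "?Z \<in> sets (gauss I)" "?Y \<in> sets (gauss I)" "?X \<in> sets (gauss I)" using Gm Hm by measurable
  define J where "J = I - {?c}"
  have J: "finite J" "?c \<notin> J" "I = insert ?c J" using assms(1) cI by (auto simp: J_def)
  \<comment> \<open>Laplace expansion along the first row: none of its cofactors contains the corner
    entry, and the cofactor of the corner is \<open>det (?H x)\<close>.\<close>
  have aff: "det (?G (x(?c := y))) = det (?G (x(?c := 0))) + y * det (?H x)" for x y
  proof -
    have cof: "cofactor (?G (x(?c := y))) 0 j = cofactor (?G (x(?c := 0))) 0 j" for j y
      unfolding cofactor_def by (intro arg_cong2[where f="(*)"] refl arg_cong[where f=det] eq_matI) (auto simp: mat_delete_def)
    have c0: "cofactor (?G (x(?c := y))) 0 0 = det (?H x)" for y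
      unfolding cofactor_def by (simp, intro arg_cong[where f=det] eq_matI) (auto simp: mat_delete_def)
    have lap: "det (?G (x(?c := y))) = y * det (?H x) + (\<Sum>j<b. x (k, Suc j + k) * cofactor (?G (x(?c := 0))) 0 (Suc j))" for y
    proof -
      have "det (?G (x(?c := y))) = (\<Sum>j<Suc b. ?G (x(?c := y)) $$ (0, j) * cofactor (?G (x(?c := y))) 0 j)"
        by (rule laplace_expansion_row) auto
      also have "\<dots> = ?G (x(?c := y)) $$ (0, 0) * cofactor (?G (x(?c := y))) 0 0
          + (\<Sum>j<b. ?G (x(?c := y)) $$ (0, Suc j) * cofactor (?G (x(?c := y))) 0 (Suc j))"
        by (rule sum.lessThan_Suc_shift)
      also have "\<dots> = y * det (?H x) + (\<Sum>j<b. x (k, Suc j + k) * cofactor (?G (x(?c := 0))) 0 (Suc j))"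
        unfolding c0 unfolding cof[where y=y] by simp
      finally show ?thesis .
    qed
    show ?thesis unfolding lap[of y] lap[of 0] by simp
  qed
  have "emeasure (gauss I) ?X = (\<integral>\<^sup>+x. indicator ?X x \<partial>gauss I)" using m by simp
  also have "\<dots> = (\<integral>\<^sup>+x. \<integral>\<^sup>+y. indicator ?X (x(?c := y)) \<partial>std_normal_distribution \<partial>gauss J)"
    using m(3) unfolding J(3) by (intro gauss_product.product_nn_integral_insert) (use J in auto)
  also have "\<dots> \<le> (\<integral>\<^sup>+x. 0 \<partial>gauss J)"
  proof (rule nn_integral_mono)
    fix x
    show "(\<integral>\<^sup>+y. indicator ?X (x(?c := y)) \<partial>std_normal_distribution) \<le> 0"
    proof -
      let ?p = "- det (?G (x(?c := 0))) / det (?H x)"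
      have H: "?H (x(?c := y)) = ?H x" for y by (intro eq_matI) auto
      have "(\<integral>\<^sup>+y. indicator ?X (x(?c := y)) \<partial>std_normal_distribution) \<le> (\<integral>\<^sup>+y. indicator {?p} y \<partial>std_normal_distribution)"
      proof (rule nn_integral_mono)
        fix y
        have "y = ?p" if "det (?H x) \<noteq> 0" "det (?G (x(?c := y))) = 0"
          using that unfolding aff[of x y] by (simp add: field_simps)
        then show "indicator ?X (x(?c := y)) \<le> (indicator {?p} y :: ennreal)"
          unfolding indicator_def H by (auto simp: H)
      qed
      also have "\<dots> = 0" using std_normal_point by simp
      finally show ?thesis .
    qed
  qed
  finally have X: "emeasure (gauss I) ?X = 0" by simp
  have "emeasure (gauss I) ?Z \<le> emeasure (gauss I) (?X \<union> ?Y)" by (rule emeasure_mono) (use m in auto)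
  also have "\<dots> \<le> emeasure (gauss I) ?X + emeasure (gauss I) ?Y" by (rule emeasure_subadditive) (use m in auto)
  also have "\<dots> = 0" using X Suc.IH[OF sub] by simp
  finally show ?case by simp
qed

section \<open>Tail of the inverse along a fixed vector\<close>

lemma smult_mat_mult_vec:
  fixes M :: "real mat"
  assumes "M \<in> carrier_mat r c" "v \<in> carrier_vec c"
  shows "(a \<cdot>\<^sub>m M) *\<^sub>v v = a \<cdot>\<^sub>v (M *\<^sub>v v)"
  using assms by (auto intro!: eq_vecI simp: scalar_prod_def sum_distrib_left mult.assoc)

text \<open>Both sides say that G is nonsingular and |G^-1 v| > s. The adjugate form is measurable;
  the form with a solution \<open>z\<close> is the one that transforms well when \<open>G\<close>
  and \<open>v\<close> are multiplied by the same orthogonal matrix.\<close>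

lemma adj_mat_vec_gt_iff:
  fixes G :: "real mat"
  assumes G: "G \<in> carrier_mat b b" and v: "v \<in> carrier_vec b"
  shows "det G \<noteq> 0 \<and> s * \<bar>det G\<bar> < vnorm (adj_mat G *\<^sub>v v) \<longleftrightarrow>
    det G \<noteq> 0 \<and> (\<exists>z\<in>carrier_vec b. G *\<^sub>v z = v \<and> s < vnorm z)"
proof (cases "det G = 0")
  case False
  define z0 where "z0 = minv G *\<^sub>v v"
  note mi = minv[OF G False]
  have z0: "z0 \<in> carrier_vec b" using mi v by (simp add: z0_def)
  have Gz0: "G *\<^sub>v z0 = v" unfolding z0_def using assoc_mult_mat_vec[OF G mi(2) v] mi(3) v by simp
  have uniq: "z = z0" if "z \<in> carrier_vec b" "G *\<^sub>v z = v" for z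
  proof -
    have "z = (minv G * G) *\<^sub>v z" using that mi by simp
    also have "\<dots> = minv G *\<^sub>v (G *\<^sub>v z)" using assoc_mult_mat_vec[OF mi(2) G that(1)] .
    finally show ?thesis using that by (simp add: z0_def)
  qed
  have "vnorm z0 = vnorm (adj_mat G *\<^sub>v v) / \<bar>det G\<bar>"
    unfolding z0_def mi(1) using smult_mat_mult_vec[OF adj_mat(1)[OF G] v] by (simp add: vnorm_smult)
  then have "s * \<bar>det G\<bar> < vnorm (adj_mat G *\<^sub>v v) \<longleftrightarrow> s < vnorm z0" using False by (simp add: pos_less_divide_eq)
  then show ?thesis using uniq z0 Gz0 False by blast
qed simp

lemma borel_measurable_mat: "i < r \<Longrightarrow> j < c \<Longrightarrow> {0..<r} \<times> {0..<c} \<subseteq> I \<Longrightarrow>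
    (\<lambda>x. mat r c x $$ (i, j)) \<in> borel_measurable (PiM I (\<lambda>_. borel :: real measure))"
  by (auto intro!: measurable_component_singleton)

lemma gauss_adj_mat_sets:
  assumes v: "v \<in> carrier_vec b"
  shows "{x \<in> space (gauss ({0..<b} \<times> {0..<b})). det (mat b b x) \<noteq> 0 \<and> s * \<bar>det (mat b b x)\<bar> < vnorm (adj_mat (mat b b x) *\<^sub>v v)}
    \<in> sets (gauss ({0..<b} \<times> {0..<b}))"
proof -
  let ?G = "gauss ({0..<b} \<times> {0..<b})"
  have 1: "(\<lambda>x. det (mat b b x)) \<in> borel_measurable ?G"
    unfolding measurable_gauss by (rule borel_measurable_det[where b=b], simp) (rule borel_measurable_mat, auto)
  have c: "adj_mat (mat b b x) \<in> carrier_mat b b" for x :: "nat \<times> nat \<Rightarrow> real" by (rule adj_mat) simp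
  have e: "(\<lambda>x. adj_mat (mat b b x) $$ (i, j)) \<in> borel_measurable ?G" if "i < b" "j < b" for i j
    unfolding measurable_gauss
    by (rule borel_measurable_adj_mat[where b=b], simp) (rule borel_measurable_mat, use that in auto)
  have 2: "(\<lambda>x. vnorm (adj_mat (mat b b x) *\<^sub>v v)) \<in> borel_measurable ?G"
    unfolding vnorm_mult_mat_vec_sum[OF c v]
    by (intro measurable_compose[OF _ borel_measurable_sqrt] borel_measurable_sum borel_measurable_power borel_measurable_times e) auto
  show ?thesis using 1 2 by measurable
qed

text \<open>If \<open>w\<close> is a unit vector orthogonal to the rows other than the first, then the solution of
  \<open>G z = \<alpha> e\<^sub>0\<close> is a multiple of \<open>w\<close>, so that its norm is \<open>\<alpha> / |\<langle>row 0, w\<rangle>|\<close>.\<close>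
lemma gauss_inverse_unit_vec:
  fixes b :: nat
  assumes b: "1 \<le> b" and s: "s > 0" and \<alpha>: "\<alpha> > 0"
  shows "emeasure (gauss ({0..<b} \<times> {0..<b})) {x \<in> space (gauss ({0..<b} \<times> {0..<b})).
      det (mat b b x) \<noteq> 0 \<and> s * \<bar>det (mat b b x)\<bar> < vnorm (adj_mat (mat b b x) *\<^sub>v (\<alpha> \<cdot>\<^sub>v unit_vec b 0))} \<le> ennreal (0.82 * \<alpha> / s)"
proof -
  let ?I = "{0..<b} \<times> {0..<b}" and ?J = "{1..<b} \<times> {0..<b}" and ?K = "{0::nat} \<times> {0..<b}"
  let ?e = "\<alpha> \<cdot>\<^sub>v unit_vec b 0"
  let ?S = "{x \<in> space (gauss ?I). det (mat b b x) \<noteq> 0 \<and> s * \<bar>det (mat b b x)\<bar> < vnorm (adj_mat (mat b b x) *\<^sub>v ?e)}"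
  have Sm: "?S \<in> sets (gauss ?I)" by (rule gauss_adj_mat_sets) simp
  have I: "?I = ?J \<union> ?K" "?J \<inter> ?K = {}" "finite ?J" "finite ?K" using b by force+
  have "emeasure (gauss ?I) ?S = (\<integral>\<^sup>+x. indicator ?S x \<partial>gauss ?I)" using Sm by simp
  also have "\<dots> = (\<integral>\<^sup>+y. \<integral>\<^sup>+x. indicator ?S (merge ?J ?K (y, x)) \<partial>gauss ?K \<partial>gauss ?J)"
    using Sm unfolding I(1) by (intro gauss_product.product_nn_integral_fold[OF I(2-4)]) auto
  also have "\<dots> \<le> (\<integral>\<^sup>+y. ennreal (0.82 * \<alpha> / s) \<partial>gauss ?J)"
  proof (rule nn_integral_mono)
    fix y :: "nat \<times> nat \<Rightarrow> real"
    \<comment> \<open>Only the rows \<open>y\<close> enter the choice of the normal, so it stays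
      fixed while row 0 is integrated.\<close>
    obtain w0 where w0: "w0 \<in> carrier_vec b" "w0 \<noteq> 0\<^sub>v b" "\<And>i. i < b - 1 \<Longrightarrow> (\<Sum>j<b. y (i + 1, j) * w0 $ j) = 0"
      using underdetermined_nontrivial_solution[of "b - 1" b "\<lambda>i j. y (i + 1, j)"] b by auto
    define w where "w = (1 / vnorm w0) \<cdot>\<^sub>v w0"
    have w0p: "vnorm w0 > 0" using vnorm_pos[OF w0(1,2)] .
    have w: "w \<in> carrier_vec b" "vnorm w = 1" using w0 w0p by (auto simp: w_def vnorm_smult)
    have wo: "(\<Sum>j<b. y (i, j) * w $ j) = 0" if "1 \<le> i" "i < b" for i
    proof -
      have "(\<Sum>j<b. y (i, j) * w $ j) = (\<Sum>j<b. y (i - 1 + 1, j) * w0 $ j) / vnorm w0"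
        using that w0(1) by (simp add: w_def sum_divide_distrib)
      also have "\<dots> = 0" using w0(3)[of "i - 1"] that by simp
      finally show ?thesis .
    qed
    have ind: "indicator ?S (merge ?J ?K (y, x)) \<le> (indicator {t. \<bar>t\<bar> \<le> \<alpha> / s} (\<Sum>p\<in>?K. w $ snd p * x p) :: ennreal)" for x
    proof (cases "merge ?J ?K (y, x) \<in> ?S")
      case True
      define G where "G = mat b b (merge ?J ?K (y, x))"
      have G: "G \<in> carrier_mat b b" by (simp add: G_def)
      define \<beta> where "\<beta> = (\<Sum>p\<in>?K. w $ snd p * x p)"
      have "det G \<noteq> 0 \<and> s * \<bar>det G\<bar> < vnorm (adj_mat G *\<^sub>v ?e)" using True by (simp add: G_def)
      then have d: "det G \<noteq> 0" and "\<exists>z\<in>carrier_vec b. G *\<^sub>v z = ?e \<and> s < vnorm z"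
        using adj_mat_vec_gt_iff[OF G, of ?e s] by auto
      then obtain z where z: "z \<in> carrier_vec b" "G *\<^sub>v z = ?e" "s < vnorm z" by auto
      have Gw: "G *\<^sub>v w = \<beta> \<cdot>\<^sub>v unit_vec b 0"
      proof (rule eq_vecI)
        fix i assume "i < dim_vec (\<beta> \<cdot>\<^sub>v unit_vec b 0)"
        then have i: "i < b" by simp
        have "(G *\<^sub>v w) $ i = (\<Sum>j<b. merge ?J ?K (y, x) (i, j) * w $ j)"
          using i w by (simp add: G_def scalar_prod_def lessThan_atLeast0)
        also have "\<dots> = (\<beta> \<cdot>\<^sub>v unit_vec b 0) $ i"
        proof (cases "i = 0")
          case True
          have "(\<Sum>j<b. merge ?J ?K (y, x) (0, j) * w $ j) = \<beta>"
            unfolding \<beta>_def sum_singleton_times by (auto simp: merge_def lessThan_atLeast0 intro!: sum.cong)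
          then show ?thesis using True i by simp
        next
          case False
          have "(\<Sum>j<b. merge ?J ?K (y, x) (i, j) * w $ j) = (\<Sum>j<b. y (i, j) * w $ j)"
            using False i by (intro sum.cong) (auto simp: merge_def)
          then show ?thesis using wo[of i] False i by simp
        qed
        finally show "(G *\<^sub>v w) $ i = (\<beta> \<cdot>\<^sub>v unit_vec b 0) $ i" .
      qed (use G in simp)
      \<comment> \<open>Both \<alpha> w and \<beta> z are sent to \<alpha> \<beta> e_0. Injectivity
        of \<open>G\<close> identifies them, whence \<alpha> = |\<beta>| |z| >= |\<beta>| s.\<close>
      have "G *\<^sub>v (\<alpha> \<cdot>\<^sub>v w) = \<alpha> \<cdot>\<^sub>v (\<beta> \<cdot>\<^sub>v unit_vec b 0)" using mult_mat_vec[OF G w(1)] Gw by simp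
      also have "\<dots> = \<beta> \<cdot>\<^sub>v (G *\<^sub>v z)" unfolding z(2) by (simp add: smult_smult_assoc mult.commute)
      also have "\<dots> = G *\<^sub>v (\<beta> \<cdot>\<^sub>v z)" using mult_mat_vec[OF G z(1)] by simp
      finally have eq: "G *\<^sub>v (\<alpha> \<cdot>\<^sub>v w) = G *\<^sub>v (\<beta> \<cdot>\<^sub>v z)" .
      have "\<alpha> \<cdot>\<^sub>v w = minv G *\<^sub>v (G *\<^sub>v (\<alpha> \<cdot>\<^sub>v w))"
        using assoc_mult_mat_vec[OF minv(2)[OF G d] G, of "\<alpha> \<cdot>\<^sub>v w"] minv(4)[OF G d] w by simp
      also have "\<dots> = \<beta> \<cdot>\<^sub>v z" unfolding eq
        using assoc_mult_mat_vec[OF minv(2)[OF G d] G, of "\<beta> \<cdot>\<^sub>v z"] minv(4)[OF G d] z by simp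
      finally have "vnorm (\<alpha> \<cdot>\<^sub>v w) = vnorm (\<beta> \<cdot>\<^sub>v z)" by simp
      then have "\<alpha> = \<bar>\<beta>\<bar> * vnorm z" using \<alpha> w(2) by (simp add: vnorm_smult)
      moreover have "\<bar>\<beta>\<bar> * s \<le> \<bar>\<beta>\<bar> * vnorm z" using z(3) by (intro mult_left_mono) auto
      ultimately have "\<bar>\<beta>\<bar> \<le> \<alpha> / s" using s by (simp add: field_simps)
      then show ?thesis by (simp add: \<beta>_def indicator_def)
    qed simp
    have "(\<integral>\<^sup>+x. indicator ?S (merge ?J ?K (y, x)) \<partial>gauss ?K)
        \<le> (\<integral>\<^sup>+x. indicator {t. \<bar>t\<bar> \<le> \<alpha> / s} (\<Sum>p\<in>?K. w $ snd p * x p) \<partial>gauss ?K)"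
      by (intro nn_integral_mono ind)
    also have "\<dots> = (\<integral>\<^sup>+t. indicator {t. \<bar>t\<bar> \<le> \<alpha> / s} (sqrt (\<Sum>p\<in>?K. (w $ snd p)\<^sup>2) * t) \<partial>std_normal_distribution)"
      by (rule nn_integral_gauss_inner) auto
    also have "sqrt (\<Sum>p\<in>?K. (w $ snd p)\<^sup>2) = 1"
      using w vnorm_sum[OF w(1)] by (simp add: sum_singleton_times lessThan_atLeast0)
    also have "(\<integral>\<^sup>+t. indicator {t. \<bar>t\<bar> \<le> \<alpha> / s} (1 * t) \<partial>std_normal_distribution) = emeasure std_normal_distribution {t. \<bar>t\<bar> \<le> \<alpha> / s}"
      by simp
    also have "\<dots> \<le> ennreal (0.82 * (\<alpha> / s))" by (rule std_normal_small_ball) (use s \<alpha> in simp)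
    finally show "(\<integral>\<^sup>+x. indicator ?S (merge ?J ?K (y, x)) \<partial>gauss ?K) \<le> ennreal (0.82 * \<alpha> / s)" by simp
  qed
  also have "\<dots> = ennreal (0.82 * \<alpha> / s)"
    using prob_space.emeasure_space_1[OF prob_space_gauss, of ?J] by simp
  finally show ?thesis .
qed

text \<open>Left multiplication of a matrix by \<open>W\<close> acts on each column separately, that
  is, as the tensor product of \<open>W\<close> with the identity on index pairs.\<close>

lemma orth_on_columnwise:
  assumes "finite A" "finite B" "orth_on A W"
  shows "orth_on (A \<times> B) (\<lambda>p q. W (fst p) (fst q) * of_bool (snd p = snd q))"
  unfolding orth_on_def
proof (intro ballI)
  fix p q assume pq: "p \<in> A \<times> B" "q \<in> A \<times> B"
  have "(\<Sum>r\<in>A \<times> B. W (fst r) (fst p) * of_bool (snd r = snd p) * (W (fst r) (fst q) * of_bool (snd r = snd q)))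
     = (\<Sum>i\<in>A. \<Sum>j\<in>B. W i (fst p) * W i (fst q) * (if snd p = j then of_bool (snd p = snd q) else 0))"
    unfolding sum.cartesian_product by (intro sum.cong) auto
  also have "\<dots> = (\<Sum>i\<in>A. W i (fst p) * W i (fst q)) * of_bool (snd p = snd q)"
    using assms pq by (simp add: sum_distrib_left[symmetric] sum_distrib_right mem_Times_iff)
  also have "\<dots> = of_bool (p = q)" using assms(3) pq unfolding orth_on_def by (auto simp: prod_eq_iff)
  finally show "(\<Sum>r\<in>A \<times> B. W (fst r) (fst p) * of_bool (snd r = snd p) * (W (fst r) (fst q) * of_bool (snd r = snd q))) = of_bool (p = q)" .
qed

lemma mat_lin_map_columnwise:
  "mat n b (lin_map ({0..<n} \<times> {0..<b}) (\<lambda>p q. W (fst p) (fst q) * of_bool (snd p = snd q)) x)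
     = mat n n (\<lambda>(i, j). W i j) * mat n b x"
proof (rule eq_matI)
  fix i j assume "i < dim_row (mat n n (\<lambda>(i, j). W i j) * mat n b x)" "j < dim_col (mat n n (\<lambda>(i, j). W i j) * mat n b x)"
  then have ij: "i < n" "j < b" by auto
  have "lin_map ({0..<n} \<times> {0..<b}) (\<lambda>p q. W (fst p) (fst q) * of_bool (snd p = snd q)) x (i, j)
     = (\<Sum>k\<in>{0..<n}. \<Sum>l\<in>{0..<b}. W i k * (if j = l then x (k, l) else 0))"
    using ij unfolding lin_map_def by (simp add: sum.cartesian_product) (intro sum.cong, auto)
  also have "\<dots> = (\<Sum>k\<in>{0..<n}. W i k * x (k, j))" using ij by (simp add: sum_distrib_left[symmetric])
  finally show "mat n b (lin_map ({0..<n} \<times> {0..<b}) (\<lambda>p q. W (fst p) (fst q) * of_bool (snd p = snd q)) x) $$ (i, j)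
     = (mat n n (\<lambda>(i, j). W i j) * mat n b x) $$ (i, j)"
    using ij by (simp add: scalar_prod_def)
qed auto

text \<open>For orthogonal \<open>H\<close> with H v = |v| e_0, the systems G z = v and (H G) z =
  |v| e_0 have the same solution, and H G has the law of G. This reduces the claim to
  \<open>gauss_inverse_unit_vec\<close>.\<close>

lemma gauss_inverse_vec:
  fixes b :: nat
  assumes b: "1 \<le> b" and s: "s > 0" and v: "v \<in> carrier_vec b"
  shows "emeasure (gauss ({0..<b} \<times> {0..<b})) {x \<in> space (gauss ({0..<b} \<times> {0..<b})).
      det (mat b b x) \<noteq> 0 \<and> s * \<bar>det (mat b b x)\<bar> < vnorm (adj_mat (mat b b x) *\<^sub>v v)} \<le> ennreal (0.82 * vnorm v / s)"
    (is "emeasure (gauss ?I) (?S v) \<le> _")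
proof (cases "v = 0\<^sub>v b")
  case True
  have "adj_mat (mat b b x) *\<^sub>v 0\<^sub>v b = 0\<^sub>v b" for x :: "nat \<times> nat \<Rightarrow> real"
    by (rule mult_mat_vec_zero[OF adj_mat(1)]) simp
  then have "?S v = {}" using True s by (auto simp: mult_less_0_iff)
  then show ?thesis by (simp only: emeasure_empty zero_le)
next
  case False
  define \<alpha> where "\<alpha> = vnorm v"
  have \<alpha>: "\<alpha> > 0" using vnorm_pos[OF v False] by (simp add: \<alpha>_def)
  have \<alpha>2: "\<alpha>\<^sup>2 = (\<Sum>i\<in>{0..<b}. (v $ i)\<^sup>2)" unfolding \<alpha>_def using vnorm_square[OF v] by (simp add: lessThan_atLeast0)
  have "(\<Sum>i\<in>{0..<b}. (v $ i / \<alpha>)\<^sup>2) = 1"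
    using \<alpha> by (simp add: power_divide sum_divide_distrib[symmetric] \<alpha>2[symmetric])
  from orth_on_row_exists[OF _ _ this, of 0] b
  obtain W where W: "orth_on {0..<b} W" "\<And>j. j \<in> {0..<b} \<Longrightarrow> W 0 j = v $ j / \<alpha>" by auto
  define H where "H = mat b b (\<lambda>(i, j). W i j)"
  have H: "H \<in> carrier_mat b b" by (simp add: H_def)
  have HH: "transpose_mat H * H = 1\<^sub>m b"
    using W(1) by (intro eq_matI) (auto simp: H_def orth_on_def scalar_prod_def)
  then have "det (transpose_mat H) * det H = 1" using H det_mult[of "transpose_mat H" b H] by simp
  then have dH: "det H \<noteq> 0" by auto
  \<comment> \<open>Row 0 of \<open>H\<close> is v / \<alpha>, so coordinate 0 of H v is already the
    full norm \<alpha>; since \<open>H\<close> preserves the norm, the other coordinates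
    vanish.\<close>
  have Hv: "H *\<^sub>v v = \<alpha> \<cdot>\<^sub>v unit_vec b 0"
  proof -
    let ?l = "lin_map {0..<b} W (($) v)"
    have Hl: "(H *\<^sub>v v) $ i = ?l i" if "i < b" for i
      using that v by (simp add: H_def lin_map_def scalar_prod_def)
    have l0: "?l 0 = \<alpha>"
    proof -
      have "?l 0 = (\<Sum>j\<in>{0..<b}. (v $ j)\<^sup>2) / \<alpha>"
        using b W(2) by (simp add: lin_map_def power2_eq_square sum_divide_distrib)
      then show ?thesis unfolding \<alpha>2[symmetric] using \<alpha> by (simp add: power2_eq_square)
    qed
    have "(\<Sum>i\<in>{0..<b}. (?l i)\<^sup>2) = \<alpha>\<^sup>2" using orth_on_sum_squares[OF _ W(1)] \<alpha>2 by simp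
    moreover have "(\<Sum>i\<in>{0..<b}. (?l i)\<^sup>2) = (?l 0)\<^sup>2 + (\<Sum>i\<in>{0..<b} - {0}. (?l i)\<^sup>2)"
      by (rule sum.remove) (use b in auto)
    ultimately have "(\<Sum>i\<in>{0..<b} - {0}. (?l i)\<^sup>2) = 0" using l0 by simp
    then have li: "?l i = 0" if "i < b" "i \<noteq> 0" for i
      using that by (subst (asm) sum_nonneg_eq_0_iff) auto
    show ?thesis
    proof (rule eq_vecI)
      fix i assume "i < dim_vec (\<alpha> \<cdot>\<^sub>v unit_vec b 0)"
      then have i: "i < b" by simp
      show "(H *\<^sub>v v) $ i = (\<alpha> \<cdot>\<^sub>v unit_vec b 0) $ i"
        using Hl[OF i] l0 li[OF i] i by (cases "i = 0") auto
    qed (use H in simp)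
  qed
  define T where "T = lin_map ?I (\<lambda>p q. W (fst p) (fst q) * of_bool (snd p = snd q))"
  have iff: "T x \<in> ?S (\<alpha> \<cdot>\<^sub>v unit_vec b 0) \<longleftrightarrow> x \<in> ?S v" if x: "x \<in> space (gauss ?I)" for x
  proof -
    define G where "G = mat b b x"
    have G: "G \<in> carrier_mat b b" by (simp add: G_def)
    have HG: "mat b b (T x) = H * G" unfolding T_def H_def G_def by (rule mat_lin_map_columnwise)
    have Tx: "T x \<in> space (gauss ?I)" by (auto simp: T_def lin_map_def space_PiM)
    have HGc: "H * G \<in> carrier_mat b b" using H G by simp
    have dets: "det (H * G) \<noteq> 0 \<longleftrightarrow> det G \<noteq> 0" using det_mult[OF H G] dH by simp
    have sol: "(H * G) *\<^sub>v z = \<alpha> \<cdot>\<^sub>v unit_vec b 0 \<longleftrightarrow> G *\<^sub>v z = v" if z: "z \<in> carrier_vec b" for z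
    proof
      assume "(H * G) *\<^sub>v z = \<alpha> \<cdot>\<^sub>v unit_vec b 0"
      then have e: "H *\<^sub>v (G *\<^sub>v z) = H *\<^sub>v v" using Hv assoc_mult_mat_vec[OF H G z] by simp
      have Gz: "G *\<^sub>v z \<in> carrier_vec b" using G z by simp
      have "G *\<^sub>v z = transpose_mat H *\<^sub>v (H *\<^sub>v (G *\<^sub>v z))"
        using assoc_mult_mat_vec[OF _ H Gz, of "transpose_mat H" b] H HH Gz by simp
      also have "\<dots> = v" unfolding e using assoc_mult_mat_vec[OF _ H v, of "transpose_mat H" b] H HH v by simp
      finally show "G *\<^sub>v z = v" .
    next
      assume "G *\<^sub>v z = v"
      then show "(H * G) *\<^sub>v z = \<alpha> \<cdot>\<^sub>v unit_vec b 0" using Hv assoc_mult_mat_vec[OF H G z] by simp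
    qed
    have "T x \<in> ?S (\<alpha> \<cdot>\<^sub>v unit_vec b 0) \<longleftrightarrow> det (H * G) \<noteq> 0 \<and> (\<exists>z\<in>carrier_vec b. (H * G) *\<^sub>v z = \<alpha> \<cdot>\<^sub>v unit_vec b 0 \<and> s < vnorm z)"
      using Tx adj_mat_vec_gt_iff[OF HGc, of "\<alpha> \<cdot>\<^sub>v unit_vec b 0" s] by (simp add: HG)
    also have "\<dots> \<longleftrightarrow> det G \<noteq> 0 \<and> (\<exists>z\<in>carrier_vec b. G *\<^sub>v z = v \<and> s < vnorm z)"
      using dets sol by auto
    also have "\<dots> \<longleftrightarrow> x \<in> ?S v" using x adj_mat_vec_gt_iff[OF G v, of s] by (simp add: G_def)
    finally show ?thesis .
  qed
  have Sm: "?S v \<in> sets (gauss ?I)" "?S (\<alpha> \<cdot>\<^sub>v unit_vec b 0) \<in> sets (gauss ?I)"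
    by (rule gauss_adj_mat_sets, use v in simp)+
  have "emeasure (gauss ?I) (?S v) = (\<integral>\<^sup>+x. indicator (?S v) x \<partial>gauss ?I)" using Sm by simp
  also have "\<dots> = (\<integral>\<^sup>+x. indicator (?S (\<alpha> \<cdot>\<^sub>v unit_vec b 0)) (T x) \<partial>gauss ?I)"
    by (intro nn_integral_cong) (unfold indicator_def, simp only: iff)
  also have "\<dots> = (\<integral>\<^sup>+x. indicator (?S (\<alpha> \<cdot>\<^sub>v unit_vec b 0)) x \<partial>gauss ?I)"
    unfolding T_def by (rule nn_integral_gauss_lin_map) (use Sm(2) in \<open>auto intro!: orth_on_columnwise W simp: sets_gauss[symmetric]\<close>)
  also have "\<dots> = emeasure (gauss ?I) (?S (\<alpha> \<cdot>\<^sub>v unit_vec b 0))" using Sm by simp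
  also have "\<dots> \<le> ennreal (0.82 * \<alpha> / s)" by (rule gauss_inverse_unit_vec[OF b s \<alpha>])
  finally show ?thesis by (simp add: \<alpha>_def)
qed

text \<open>A Gaussian test vector \<open>g\<close> detects the norm: \<open>|G\<^sup>-\<^sup>1 g| \<ge> |\<langle>a, g\<rangle>|\<close> with \<open>|a| > t\<close> as soon as the
  norm of \<open>G\<^sup>-\<^sup>1\<close> exceeds \<open>t\<close>.\<close>
lemma gauss_inverse_norm:
  fixes b :: nat
  assumes b: "1 \<le> b" and t: "t > 0"
  shows "emeasure (gauss ({0..<b} \<times> {0..<b})) {x \<in> space (gauss ({0..<b} \<times> {0..<b})).
      det (mat b b x) \<noteq> 0 \<and> t * \<bar>det (mat b b x)\<bar> < spec_norm (adj_mat (mat b b x))} \<le> ennreal (2.78 * sqrt b / t)"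
    (is "emeasure (gauss ?I) ?B \<le> _")
proof -
  let ?J = "{..<b}"
  let ?f = "\<lambda>x g. if det (mat b b x) \<noteq> 0 \<and> t / 2 * \<bar>det (mat b b x)\<bar> < vnorm (adj_mat (mat b b x) *\<^sub>v Matrix.vec b g) then 1 else (0::ennreal)"
  have c: "adj_mat (mat b b x) \<in> carrier_mat b b" for x :: "nat \<times> nat \<Rightarrow> real" by (rule adj_mat) simp
  have dm: "(\<lambda>x. det (mat b b x)) \<in> borel_measurable (gauss ?I)"
    unfolding measurable_gauss by (rule borel_measurable_det[where b=b], simp) (rule borel_measurable_mat, auto)
  have e: "(\<lambda>x. adj_mat (mat b b x) $$ (i, j)) \<in> borel_measurable (gauss ?I)" if "i < b" "j < b" for i j
    unfolding measurable_gauss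
    by (rule borel_measurable_adj_mat[where b=b], simp) (rule borel_measurable_mat, use that in auto)
  have nm: "(\<lambda>x. spec_norm (adj_mat (mat b b x))) \<in> borel_measurable (gauss ?I)"
    by (rule borel_measurable_spec_norm[OF c _ e]) (use b in auto)
  have Bm: "?B \<in> sets (gauss ?I)" using dm nm by measurable
  have fm: "(\<lambda>(x, g). ?f x g) \<in> borel_measurable (gauss ?I \<Otimes>\<^sub>M gauss ?J)"
  proof -
    have v: "vnorm (adj_mat (mat b b x) *\<^sub>v Matrix.vec b g) = sqrt (\<Sum>i<b. (\<Sum>j<b. adj_mat (mat b b x) $$ (i, j) * g j)\<^sup>2)"
      for x :: "nat \<times> nat \<Rightarrow> real" and g :: "nat \<Rightarrow> real"
      using vnorm_mult_mat_vec_sum[OF c[of x], of "Matrix.vec b g"] by simp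
    have [measurable]: "(\<lambda>z. det (mat b b (fst z))) \<in> borel_measurable (gauss ?I \<Otimes>\<^sub>M gauss ?J)"
      by (rule measurable_compose[OF measurable_fst dm])
    have [measurable]: "(\<lambda>z. vnorm (adj_mat (mat b b (fst z)) *\<^sub>v Matrix.vec b (snd z))) \<in> borel_measurable (gauss ?I \<Otimes>\<^sub>M gauss ?J)"
      unfolding v
      by (intro measurable_compose[OF _ borel_measurable_sqrt] borel_measurable_sum borel_measurable_power borel_measurable_times
        measurable_compose[OF measurable_fst e]) (auto, measurable)
    have "(\<lambda>z. ?f (fst z) (snd z)) \<in> borel_measurable (gauss ?I \<Otimes>\<^sub>M gauss ?J)" by measurable
    then show ?thesis by (simp add: case_prod_beta')
  qed
  have PS: "pair_sigma_finite (gauss ?I) (gauss ?J)"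
    by (simp add: pair_sigma_finite_def prob_space_imp_sigma_finite prob_space_gauss)
  \<comment> \<open>For the witness \<open>a\<close>, the inner product with \<open>g\<close> is |a|
    times a standard normal variable and exceeds |a| / 2 in absolute value with probability at least
    0.59. Since |a| > t * |det|, the threshold only drops from t to t / 2.\<close>
  have key: "ennreal 0.59 * indicator ?B x \<le> (\<integral>\<^sup>+g. ?f x g \<partial>gauss ?J)" for x
  proof (cases "x \<in> ?B")
    case True
    then have d: "det (mat b b x) \<noteq> 0" "t * \<bar>det (mat b b x)\<bar> < spec_norm (adj_mat (mat b b x))" by auto
    have "0 \<le> t * \<bar>det (mat b b x)\<bar>" using t by simp
    from spec_norm_gt_witness[OF c d(2) this] obtain a where a: "a \<in> carrier_vec b" "t * \<bar>det (mat b b x)\<bar> < vnorm a"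
      "\<And>g. g \<in> carrier_vec b \<Longrightarrow> \<bar>a \<bullet> g\<bar> \<le> vnorm (adj_mat (mat b b x) *\<^sub>v g)" by metis
    have va: "vnorm a > 0" using a(2) t d(1) \<open>0 \<le> t * \<bar>det (mat b b x)\<bar>\<close> by linarith
    have sa: "sqrt (\<Sum>i<b. (a $ i)\<^sup>2) = vnorm a" using vnorm_sum[OF a(1)] by simp
    have "ennreal 0.59 \<le> emeasure std_normal_distribution {y. \<bar>y\<bar> > 1 / 2}" by (rule std_normal_ge_half)
    also have "\<dots> = (\<integral>\<^sup>+y. indicator {y. \<bar>y\<bar> > 1 / 2} y \<partial>std_normal_distribution)" by simp
    also have "\<dots> = (\<integral>\<^sup>+y. indicator {y. \<bar>y\<bar> > vnorm a / 2} (sqrt (\<Sum>i<b. (a $ i)\<^sup>2) * y) \<partial>std_normal_distribution)"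
      unfolding sa using va by (intro nn_integral_cong) (auto simp: indicator_def abs_mult)
    also have "\<dots> = (\<integral>\<^sup>+g. indicator {y. \<bar>y\<bar> > vnorm a / 2} (\<Sum>i<b. a $ i * g i) \<partial>gauss ?J)"
      by (rule nn_integral_gauss_inner[symmetric]) auto
    also have "\<dots> \<le> (\<integral>\<^sup>+g. ?f x g \<partial>gauss ?J)"
    proof (rule nn_integral_mono)
      fix g :: "nat \<Rightarrow> real"
      have "a \<bullet> Matrix.vec b g = (\<Sum>i<b. a $ i * g i)" by (simp add: scalar_prod_def lessThan_atLeast0)
      then have "\<bar>\<Sum>i<b. a $ i * g i\<bar> \<le> vnorm (adj_mat (mat b b x) *\<^sub>v Matrix.vec b g)" using a(3)[of "Matrix.vec b g"] by simp
      then have "t / 2 * \<bar>det (mat b b x)\<bar> < vnorm (adj_mat (mat b b x) *\<^sub>v Matrix.vec b g)"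
        if "\<bar>\<Sum>i<b. a $ i * g i\<bar> > vnorm a / 2" using that a(2) by linarith
      then show "indicator {y. \<bar>y\<bar> > vnorm a / 2} (\<Sum>i<b. a $ i * g i) \<le> ?f x g"
        using d(1) by (auto simp: indicator_def)
    qed
    finally show ?thesis using True by simp
  qed simp
  have "ennreal 0.59 * emeasure (gauss ?I) ?B = (\<integral>\<^sup>+x. ennreal 0.59 * indicator ?B x \<partial>gauss ?I)"
    using Bm by (simp add: nn_integral_cmult_indicator)
  also have "\<dots> \<le> (\<integral>\<^sup>+x. \<integral>\<^sup>+g. ?f x g \<partial>gauss ?J \<partial>gauss ?I)" by (intro nn_integral_mono key)
  also have "\<dots> = (\<integral>\<^sup>+g. \<integral>\<^sup>+x. ?f x g \<partial>gauss ?I \<partial>gauss ?J)"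
    by (rule pair_sigma_finite.Fubini'[OF PS fm, symmetric])
  also have "\<dots> \<le> (\<integral>\<^sup>+g. ennreal (1.64 / t) * ennreal (sqrt (\<Sum>i\<in>?J. (g i)\<^sup>2)) \<partial>gauss ?J)"
  proof (rule nn_integral_mono)
    fix g :: "nat \<Rightarrow> real"
    let ?S = "{x \<in> space (gauss ?I). det (mat b b x) \<noteq> 0 \<and> t / 2 * \<bar>det (mat b b x)\<bar> < vnorm (adj_mat (mat b b x) *\<^sub>v Matrix.vec b g)}"
    have "(\<integral>\<^sup>+x. ?f x g \<partial>gauss ?I) = (\<integral>\<^sup>+x. indicator ?S x \<partial>gauss ?I)"
      by (intro nn_integral_cong) (auto simp: indicator_def)
    also have "\<dots> = emeasure (gauss ?I) ?S" by (rule nn_integral_indicator, rule gauss_adj_mat_sets) simp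
    also have "\<dots> \<le> ennreal (0.82 * vnorm (Matrix.vec b g) / (t / 2))" by (rule gauss_inverse_vec[OF b]) (use t in auto)
    also have "0.82 * vnorm (Matrix.vec b g) / (t / 2) = 1.64 / t * sqrt (\<Sum>i\<in>?J. (g i)\<^sup>2)"
      by (simp add: vnorm_sum[where n=b])
    finally show "(\<integral>\<^sup>+x. ?f x g \<partial>gauss ?I) \<le> ennreal (1.64 / t) * ennreal (sqrt (\<Sum>i\<in>?J. (g i)\<^sup>2))"
      using t by (subst ennreal_mult[symmetric]) (auto simp: sum_nonneg)
  qed
  also have "\<dots> = ennreal (1.64 / t) * (\<integral>\<^sup>+g. ennreal (sqrt (\<Sum>i\<in>?J. (g i)\<^sup>2)) \<partial>gauss ?J)"
    by (rule nn_integral_cmult) measurable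
  also have "\<dots> \<le> ennreal (1.64 / t) * ennreal (sqrt b)"
    using nn_integral_gauss_norm[of ?J] by (intro mult_left_mono) auto
  also have "\<dots> = ennreal (1.64 / t * sqrt b)" using t by (subst ennreal_mult) auto
  finally have fin: "ennreal 0.59 * emeasure (gauss ?I) ?B \<le> ennreal (1.64 / t * sqrt b)" .
  interpret prob_space "gauss ?I" by (rule prob_space_gauss)
  have "0.59 * prob ?B \<le> 1.64 / t * sqrt b"
    using fin t unfolding emeasure_eq_measure by (subst (asm) ennreal_mult[symmetric], simp, simp, subst (asm) ennreal_le_iff) auto
  moreover have "0 \<le> sqrt b / t" using t by simp
  \<comment> \<open>1.64 / 0.59 < 2.78, where 1.64 = 2 * 0.82 reflects the halved threshold.\<close>
  ultimately have "prob ?B \<le> 2.78 * (sqrt b / t)" by (simp add: field_simps)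
  then show ?thesis unfolding emeasure_eq_measure by (intro ennreal_leI) simp
qed

section \<open>Norm product of the two blocks\<close>

lemma spec_norm_smult:
  assumes M: "M \<in> carrier_mat r c" and c: "c > 0" and a: "a \<noteq> 0"
  shows "spec_norm (a \<cdot>\<^sub>m M) = \<bar>a\<bar> * spec_norm M"
proof (rule antisym)
  have aM: "a \<cdot>\<^sub>m M \<in> carrier_mat r c" using M by simp
  show "spec_norm (a \<cdot>\<^sub>m M) \<le> \<bar>a\<bar> * spec_norm M"
  proof (rule spec_norm_le[OF aM])
    fix x :: "real Matrix.vec" assume x: "x \<in> carrier_vec c"
    have "\<bar>a\<bar> * vnorm (M *\<^sub>v x) \<le> \<bar>a\<bar> * (spec_norm M * vnorm x)"
      by (intro mult_left_mono vnorm_le_spec_norm[OF M x]) simp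
    then show "vnorm ((a \<cdot>\<^sub>m M) *\<^sub>v x) \<le> \<bar>a\<bar> * spec_norm M * vnorm x"
      unfolding smult_mat_mult_vec[OF M x] by (simp add: vnorm_smult mult.assoc)
  qed (use spec_norm_nonneg[OF M c] in simp)
  have "spec_norm M \<le> spec_norm (a \<cdot>\<^sub>m M) / \<bar>a\<bar>"
  proof (rule spec_norm_le[OF M])
    fix x :: "real Matrix.vec" assume x: "x \<in> carrier_vec c"
    have "\<bar>a\<bar> * vnorm (M *\<^sub>v x) \<le> spec_norm (a \<cdot>\<^sub>m M) * vnorm x"
      using vnorm_le_spec_norm[OF aM x] unfolding smult_mat_mult_vec[OF M x] by (simp add: vnorm_smult)
    then show "vnorm (M *\<^sub>v x) \<le> spec_norm (a \<cdot>\<^sub>m M) / \<bar>a\<bar> * vnorm x"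
      using a by (simp add: field_simps)
  qed (use spec_norm_nonneg[OF aM c] in simp)
  then show "\<bar>a\<bar> * spec_norm M \<le> spec_norm (a \<cdot>\<^sub>m M)" using a by (simp add: field_simps)
qed

text \<open>The constant is 4 * e * sqrt b * D / \<delta>. In D^2 the squares contribute n + l with
  l = 2 * ln (2 / \<delta>) >= 1, and the cross term 2 * sqrt b * sqrt l adds at least 2, so D^2 >=
  n + 3 matches the expected norm of the lower block. What remains is 2.78 * 3.17 <= 4 * e, with
  3.17 >= sqrt 10.\<close>

lemma C_const_bound:
  fixes b n :: nat
  assumes b: "1 \<le> b" "b \<le> n" and \<delta>: "0 < \<delta>" "\<delta> < 1"
  shows "C_const \<delta> n b b > 0" "2.78 * sqrt b / C_const \<delta> n b b * sqrt (10 * (real n + 3)) \<le> \<delta>"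
proof -
  define l where "l = 2 * ln (2 / \<delta>)"
  define D where "D = sqrt (real n - real b) + sqrt b + sqrt l"
  have C: "C_const \<delta> n b b = 2 * exp 1 * sqrt b * (2 / \<delta>) * D"
    using \<delta> by (simp add: C_const_def D_def l_def)
  have "ln 2 \<le> ln (2 / \<delta>)" using \<delta> by (subst ln_le_cancel_iff) (auto simp: field_simps)
  then have l: "l \<ge> 1" using ln2_ge_two_thirds by (simp add: l_def)
  have b1: "sqrt b \<ge> 1" "sqrt l \<ge> 1" using b l by auto
  then have D: "D > 0" using b by (simp add: D_def add_nonneg_pos)
  then show "C_const \<delta> n b b > 0" unfolding C using b \<delta> by simp
  have "1 * 1 \<le> sqrt b * sqrt l" using b1 by (intro mult_mono) auto
  moreover have "0 \<le> sqrt (real n - real b) * (sqrt b + sqrt l)" using b b1 by simp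
  moreover have "D\<^sup>2 = (real n - real b) + b + l + 2 * (sqrt b * sqrt l) + 2 * (sqrt (real n - real b) * (sqrt b + sqrt l))"
    using b l by (simp add: D_def power2_eq_square algebra_simps)
  ultimately have "real n + 3 \<le> D\<^sup>2" using l by linarith
  then have "sqrt (10 * (real n + 3)) \<le> sqrt (10 * D\<^sup>2)" by simp
  also have "\<dots> = sqrt 10 * D" using D by (simp add: real_sqrt_mult)
  also have "\<dots> \<le> 3.17 * D"
    using D by (intro mult_right_mono real_le_lsqrt) (auto simp: power2_eq_square)
  finally have "2.78 * sqrt b / C_const \<delta> n b b * sqrt (10 * (real n + 3)) \<le> 2.78 * sqrt b / C_const \<delta> n b b * (3.17 * D)"
    using \<open>C_const \<delta> n b b > 0\<close> by (intro mult_left_mono) auto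
  also have "\<dots> = 2.78 * 3.17 * \<delta> / (4 * exp 1)"
    unfolding C using D b1 \<delta> by (simp add: field_simps)
  also have "\<dots> \<le> \<delta>" using exp_1_ge \<delta> by (simp add: field_simps)
  finally show "2.78 * sqrt b / C_const \<delta> n b b * sqrt (10 * (real n + 3)) \<le> \<delta>" .
qed

text \<open>For a fixed lower block \<open>y\<close> the event says that the inverse of the upper
  block has norm above C / |M y|, which has probability at most 2.78 * sqrt b * |M y| / C. This is
  linear in |M y|, so the outer integral is governed by the mean of the norm. The determinant is
  multiplied out to keep the event free of division.\<close>

lemma gauss_norm_product_tail:
  fixes b n :: nat
  assumes b: "1 \<le> b" "b \<le> n" and C: "C > 0"
  defines "M \<equiv> \<lambda>x. mat (n - b) b (\<lambda>(i, j). x (i + b, j))"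
  shows "emeasure (gauss ({0..<n} \<times> {0..<b})) {x \<in> space (gauss ({0..<n} \<times> {0..<b})).
     det (mat b b x) \<noteq> 0 \<and> C * \<bar>det (mat b b x)\<bar> < spec_norm (M x) * spec_norm (adj_mat (mat b b x))}
     \<le> ennreal (2.78 * sqrt b / C * sqrt (10 * (real n + 3)))"
    and "{x \<in> space (gauss ({0..<n} \<times> {0..<b})).
     det (mat b b x) \<noteq> 0 \<and> C * \<bar>det (mat b b x)\<bar> < spec_norm (M x) * spec_norm (adj_mat (mat b b x))} \<in> sets (gauss ({0..<n} \<times> {0..<b}))"
    and "{x \<in> space (gauss ({0..<n} \<times> {0..<b})). det (mat b b x) = 0} \<in> sets (gauss ({0..<n} \<times> {0..<b}))"
proof -
  let ?I = "{0..<n} \<times> {0..<b}" and ?I1 = "{0..<b} \<times> {0..<b}" and ?I2 = "{b..<n} \<times> {0..<b}"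
  let ?B = "{x \<in> space (gauss ?I). det (mat b b x) \<noteq> 0 \<and> C * \<bar>det (mat b b x)\<bar> < spec_norm (M x) * spec_norm (adj_mat (mat b b x))}"
  have I: "?I = ?I2 \<union> ?I1" "?I2 \<inter> ?I1 = {}" "finite ?I2" "finite ?I1" using b by force+
  have c: "adj_mat (mat b b x) \<in> carrier_mat b b" for x :: "nat \<times> nat \<Rightarrow> real" by (rule adj_mat) simp
  have sub: "?I1 \<subseteq> ?I" using b by auto
  have Mc: "M x \<in> carrier_mat (n - b) b" for x by (simp add: M_def)
  have dm: "(\<lambda>x. det (mat b b x)) \<in> borel_measurable (gauss ?I)"
    unfolding measurable_gauss by (rule borel_measurable_det[where b=b], simp) (rule borel_measurable_mat, use sub in auto)
  have am: "(\<lambda>x. spec_norm (adj_mat (mat b b x))) \<in> borel_measurable (gauss ?I)"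
    unfolding measurable_gauss
    by (rule borel_measurable_spec_norm[OF c], use b in simp, rule borel_measurable_adj_mat[where b=b], simp)
      (rule borel_measurable_mat, use sub in auto)
  have Mm: "(\<lambda>x. spec_norm (M x)) \<in> borel_measurable (gauss A)" if "?I2 \<subseteq> A" for A
  proof (rule borel_measurable_spec_norm[OF Mc])
    fix i j assume "i < n - b" "j < b"
    then have "(i + b, j) \<in> A" using that by auto
    then have "(\<lambda>x. x (i + b, j)) \<in> borel_measurable (gauss A)" by measurable
    then show "(\<lambda>x. M x $$ (i, j)) \<in> borel_measurable (gauss A)" using \<open>i < n - b\<close> \<open>j < b\<close> by (simp add: M_def)
  qed (use b in simp)
  have "?I2 \<subseteq> ?I" by auto
  from Mm[OF this] dm am show Bm: "?B \<in> sets (gauss ?I)" by measurable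
  show "{x \<in> space (gauss ?I). det (mat b b x) = 0} \<in> sets (gauss ?I)" using dm by measurable
  have merge1: "mat b b (merge ?I2 ?I1 (y, x)) = mat b b x" for x y :: "nat \<times> nat \<Rightarrow> real"
    by (intro eq_matI) (auto simp: merge_def)
  have merge2: "M (merge ?I2 ?I1 (y, x)) = M y" for x y
    unfolding M_def by (intro eq_matI) (auto simp: merge_def)
  have "emeasure (gauss ?I) ?B = (\<integral>\<^sup>+x. indicator ?B x \<partial>gauss ?I)" using Bm by simp
  also have "\<dots> = (\<integral>\<^sup>+y. \<integral>\<^sup>+x. indicator ?B (merge ?I2 ?I1 (y, x)) \<partial>gauss ?I1 \<partial>gauss ?I2)"
    using Bm unfolding I(1) by (intro gauss_product.product_nn_integral_fold[OF I(2-4)]) auto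
  also have "\<dots> \<le> (\<integral>\<^sup>+y. ennreal (2.78 * sqrt b / C) * ennreal (spec_norm (M y)) \<partial>gauss ?I2)"
  proof (rule nn_integral_mono)
    fix y :: "nat \<times> nat \<Rightarrow> real"
    show "(\<integral>\<^sup>+x. indicator ?B (merge ?I2 ?I1 (y, x)) \<partial>gauss ?I1) \<le> ennreal (2.78 * sqrt b / C) * ennreal (spec_norm (M y))"
    \<comment> \<open>The threshold C / |M y| makes no sense at norm 0; the event is then empty,
      because C * |det| < 0 is impossible.\<close>
    proof (cases "spec_norm (M y) = 0")
      case True
      have "indicator ?B (merge ?I2 ?I1 (y, x)) = (0::ennreal)" for x
        using True C by (auto simp: indicator_def merge1 merge2 mult_less_0_iff)
      then show ?thesis by simp
    next
      case False
      then have N: "spec_norm (M y) > 0" using spec_norm_nonneg[OF Mc[of y]] b by simp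
      let ?t = "C / spec_norm (M y)"
      let ?S = "{x \<in> space (gauss ?I1). det (mat b b x) \<noteq> 0 \<and> ?t * \<bar>det (mat b b x)\<bar> < spec_norm (adj_mat (mat b b x))}"
      have "(\<integral>\<^sup>+x. indicator ?B (merge ?I2 ?I1 (y, x)) \<partial>gauss ?I1) \<le> (\<integral>\<^sup>+x. indicator ?S x \<partial>gauss ?I1)"
      proof (rule nn_integral_mono)
        fix x :: "nat \<times> nat \<Rightarrow> real" assume x: "x \<in> space (gauss ?I1)"
        have "x \<in> ?S" if "merge ?I2 ?I1 (y, x) \<in> ?B"
          using that x N by (auto simp: merge1 merge2 field_simps)
        then show "indicator ?B (merge ?I2 ?I1 (y, x)) \<le> (indicator ?S x :: ennreal)"
          by (metis (no_types, lifting) indicator_simps(1) indicator_simps(2) order_refl zero_le)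
      qed
      also have "\<dots> = emeasure (gauss ?I1) ?S"
      proof (rule nn_integral_indicator)
        have 1: "(\<lambda>x. det (mat b b x)) \<in> borel_measurable (gauss ?I1)"
          unfolding measurable_gauss by (rule borel_measurable_det[where b=b], simp) (rule borel_measurable_mat, auto)
        have 2: "(\<lambda>x. spec_norm (adj_mat (mat b b x))) \<in> borel_measurable (gauss ?I1)"
          unfolding measurable_gauss
          by (rule borel_measurable_spec_norm[OF c], use b in simp, rule borel_measurable_adj_mat[where b=b], simp)
            (rule borel_measurable_mat, auto)
        show "?S \<in> sets (gauss ?I1)" using 1 2 by measurable
      qed
      also have "\<dots> \<le> ennreal (2.78 * sqrt b / ?t)" by (rule gauss_inverse_norm[OF b(1)]) (use N C in simp)
      also have "2.78 * sqrt b / ?t = 2.78 * sqrt b / C * spec_norm (M y)" by simp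
      also have "ennreal \<dots> = ennreal (2.78 * sqrt b / C) * ennreal (spec_norm (M y))" using N C by (intro ennreal_mult) auto
      finally show ?thesis .
    qed
  qed
  also have "\<dots> = ennreal (2.78 * sqrt b / C) * (\<integral>\<^sup>+y. ennreal (spec_norm (M y)) \<partial>gauss ?I2)"
    using Mm[OF order_refl] by (intro nn_integral_cmult) simp
  also have "\<dots> \<le> ennreal (2.78 * sqrt b / C) * ennreal (sqrt (10 * (real n + 3)))"
    unfolding M_def by (intro mult_left_mono gauss_expected_spec_norm b) simp
  also have "\<dots> = ennreal (2.78 * sqrt b / C * sqrt (10 * (real n + 3)))" using C by (intro ennreal_mult[symmetric]) auto
  finally show "emeasure (gauss ?I) ?B \<le> ennreal (2.78 * sqrt b / C * sqrt (10 * (real n + 3)))" .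
qed

text \<open>Left multiplication by V^T preserves the Gaussian law, so the event is the preimage of
  \<open>?G\<close> under the rotation \<open>T\<close>. \<open>?G\<close> omits only the tail event
  \<open>?B\<close> and the null set \<open>?Z\<close> of vanishing determinants, so singularity
  costs no probability.\<close>

lemma gauss_norm_product_prob:
  fixes b n :: nat
  assumes b: "1 \<le> b" "b \<le> n" and V: "V \<in> carrier_mat n n" "transpose_mat V * V = 1\<^sub>m n" and \<delta>: "0 < \<delta>" "\<delta> < 1"
  shows "measure (gauss_entries n b)
         {f \<in> space (gauss_entries n b).
            let Om' = transpose_mat V * mat n b f
            in invertible_mat (sub_mat Om' 0 b 0 b)
             \<and> spec_norm (sub_mat Om' b n 0 b) * spec_norm (minv (sub_mat Om' 0 b 0 b))
                 \<le> C_const \<delta> n b b} \<ge> 1 - \<delta>"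
    (is "measure _ ?E \<ge> _")
proof -
  let ?I = "{0..<n} \<times> {0..<b}"
  define C where "C = C_const \<delta> n b b"
  have C: "C > 0" "2.78 * sqrt b / C * sqrt (10 * (real n + 3)) \<le> \<delta>"
    unfolding C_def using C_const_bound[OF b \<delta>] by auto
  define M where "M x = mat (n - b) b (\<lambda>(i, j). x (i + b, j))" for x :: "nat \<times> nat \<Rightarrow> real"
  let ?B = "{x \<in> space (gauss ?I). det (mat b b x) \<noteq> 0 \<and> C * \<bar>det (mat b b x)\<bar> < spec_norm (M x) * spec_norm (adj_mat (mat b b x))}"
    and ?Z = "{x \<in> space (gauss ?I). det (mat b b x) = 0}"
    and ?G = "{x \<in> space (gauss ?I). det (mat b b x) \<noteq> 0 \<and> spec_norm (M x) * spec_norm (adj_mat (mat b b x)) \<le> C * \<bar>det (mat b b x)\<bar>}"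
  have m: "?B \<in> sets (gauss ?I)" "?Z \<in> sets (gauss ?I)"
    unfolding M_def by (rule gauss_norm_product_tail[OF b C(1)])+
  have B: "emeasure (gauss ?I) ?B \<le> ennreal \<delta>"
    unfolding M_def by (rule order_trans[OF gauss_norm_product_tail(1)[OF b C(1)]]) (rule ennreal_leI[OF C(2)])
  have "{0..<b} \<times> {0..<b} \<subseteq> ?I" using b by auto
  then have Z: "emeasure (gauss ?I) ?Z = 0"
    using gauss_det_null[of ?I 0 b] by (simp add: case_prod_beta')
  interpret prob_space "gauss ?I" by (rule prob_space_gauss)
  have "prob (?B \<union> ?Z) \<le> prob ?B + prob ?Z" using m by (intro measure_Un_le) auto
  also have "\<dots> \<le> \<delta>" using B Z \<delta> unfolding emeasure_eq_measure by simp
  finally have "prob (space (gauss ?I) - (?B \<union> ?Z)) \<ge> 1 - \<delta>" using m by (subst prob_compl) auto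
  moreover have Geq: "?G = space (gauss ?I) - (?B \<union> ?Z)" by auto
  ultimately have G: "prob ?G \<ge> 1 - \<delta>" by simp
  have Gm: "?G \<in> sets (gauss ?I)" unfolding Geq using m by auto
  define W where "W i j = V $$ (j, i)" for i j
  define T where "T = lin_map ?I (\<lambda>p q. W (fst p) (fst q) * of_bool (snd p = snd q))"
  have VV: "V * transpose_mat V = 1\<^sub>m n"
    by (rule mat_mult_left_right_inverse[OF _ V(1) V(2)]) (use V in simp)
  have "orth_on {0..<n} W" unfolding orth_on_def
  proof (intro ballI)
    fix j k assume jk: "j \<in> {0..<n}" "k \<in> {0..<n}"
    have "(V * transpose_mat V) $$ (j, k) = (\<Sum>i\<in>{0..<n}. W i j * W i k)"
      using jk V(1) by (simp add: scalar_prod_def W_def)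
    then show "(\<Sum>i\<in>{0..<n}. W i j * W i k) = of_bool (j = k)" using VV jk by (cases "j = k") auto
  qed
  then have orth: "orth_on ?I (\<lambda>p q. W (fst p) (fst q) * of_bool (snd p = snd q))"
    by (intro orth_on_columnwise) auto
  have VW: "transpose_mat V = mat n n (\<lambda>(i, j). W i j)" using V(1) by (intro eq_matI) (auto simp: W_def)
  have Tm: "mat n b (T x) = transpose_mat V * mat n b x" for x
    unfolding T_def VW by (rule mat_lin_map_columnwise)
  have Ts: "T x \<in> space (gauss ?I)" for x by (auto simp: T_def lin_map_def space_PiM)
  have Esub: "?E = {f \<in> space (gauss ?I). T f \<in> ?G}"
  proof -
    have "(let Om' = transpose_mat V * mat n b f
            in invertible_mat (sub_mat Om' 0 b 0 b)
             \<and> spec_norm (sub_mat Om' b n 0 b) * spec_norm (minv (sub_mat Om' 0 b 0 b)) \<le> C)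
          \<longleftrightarrow> T f \<in> ?G" for f
    proof -
      have 1: "sub_mat (mat n b (T f)) 0 b 0 b = mat b b (T f)" using b by (auto simp: sub_mat_def intro!: eq_matI)
      have 2: "sub_mat (mat n b (T f)) b n 0 b = M (T f)" using b by (auto simp: sub_mat_def M_def intro!: eq_matI)
      have G: "mat b b (T f) \<in> carrier_mat b b" by simp
      have "spec_norm (minv (mat b b (T f))) = spec_norm (adj_mat (mat b b (T f))) / \<bar>det (mat b b (T f))\<bar>"
        if "det (mat b b (T f)) \<noteq> 0"
        unfolding minv(1)[OF G that] using that b by (subst spec_norm_smult[OF adj_mat(1)[OF G]]) auto
      then show ?thesis
        unfolding Tm[symmetric] 1 2 Let_def invertible_mat_iff_det[OF G] using Ts[of f]
        by (auto simp: pos_divide_le_eq)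
    qed
    then show ?thesis unfolding C_def[symmetric] gauss_entries_def by auto
  qed
  have TM: "T \<in> measurable (gauss ?I) (gauss ?I)"
    unfolding T_def using measurable_lin_map[of ?I] by (simp add: measurable_gauss measurable_cong_sets[OF refl sets_gauss])
  \<comment> \<open>\<open>measure\<close> is 0 on sets outside the sigma-algebra, so measurability
    of the event is part of the claim.\<close>
  have Em: "?E \<in> sets (gauss ?I)" unfolding Esub using measurable_sets[OF TM Gm] by (simp add: vimage_def Int_def conj_commute)
  have "emeasure (gauss ?I) ?E = (\<integral>\<^sup>+x. indicator ?E x \<partial>gauss ?I)" using Em by simp
  also have "\<dots> = (\<integral>\<^sup>+x. indicator ?G (T x) \<partial>gauss ?I)"
    unfolding Esub by (intro nn_integral_cong) (simp add: indicator_def)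
  also have "\<dots> = (\<integral>\<^sup>+x. indicator ?G x \<partial>gauss ?I)"
    unfolding T_def by (rule nn_integral_gauss_lin_map[OF _ orth]) (use Gm in \<open>auto simp: sets_gauss[symmetric]\<close>)
  also have "\<dots> = emeasure (gauss ?I) ?G" using Gm by simp
  finally have "prob ?E = prob ?G" by (simp add: emeasure_eq_measure)
  then show ?thesis using G by (simp add: gauss_entries_def)
qed

section \<open>Singular values through characteristic polynomials\<close>

text \<open>Sylvester's identity, from two eliminations of one block matrix with rows (X, P^T) and
  (P, 1): \<open>L1\<close> on the right leaves the diagonal blocks X - P^T P and 1,
  \<open>L2\<close> on the left leaves X and X - P P^T. The powers of X stay on both sides, so that
  no polynomial is divided.\<close>

lemma det_block_char_poly:
  fixes B :: "real mat"
  assumes B: "B \<in> carrier_mat b n"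
  shows "[:0, 1:] ^ b * char_poly (transpose_mat B * B) = [:0, 1:] ^ n * char_poly (B * transpose_mat B)"
proof -
  define X where "X = [:0, 1 :: real:]"
  define P where "P = map_mat (\<lambda>a. [:a:]) B"
  have P: "P \<in> carrier_mat b n" "transpose_mat P \<in> carrier_mat n b" using B by (auto simp: P_def)
  have cm: "map_mat (\<lambda>a. [:a:]) (M * N) = map_mat (\<lambda>a. [:a:]) M * map_mat (\<lambda>a. [:a:]) N"
    if "M \<in> carrier_mat r c" "N \<in> carrier_mat c d" for M N :: "real mat" and r c d
  proof (rule eq_matI)
    have sm: "[:\<Sum>k\<in>S. f k:] = (\<Sum>k\<in>S. [:f k:])" for S :: "nat set" and f :: "nat \<Rightarrow> real"
      by (rule poly_eqI) (auto simp: coeff_sum coeff_pCons split: nat.splits)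
    fix i j assume "i < dim_row (map_mat (\<lambda>a. [:a:]) M * map_mat (\<lambda>a. [:a:]) N)" "j < dim_col (map_mat (\<lambda>a. [:a:]) M * map_mat (\<lambda>a. [:a:]) N)"
    with that show "map_mat (\<lambda>a. [:a:]) (M * N) $$ (i, j) = (map_mat (\<lambda>a. [:a:]) M * map_mat (\<lambda>a. [:a:]) N) $$ (i, j)"
      by (simp add: scalar_prod_def sm mult.commute)
  qed (use that in auto)
  have tP: "map_mat (\<lambda>a. [:a:]) (transpose_mat B) = transpose_mat P" by (auto simp: P_def)
  have cp1: "char_poly (transpose_mat B * B) = det (X \<cdot>\<^sub>m 1\<^sub>m n - transpose_mat P * P)"
  proof -
    have "char_poly_matrix (transpose_mat B * B) = X \<cdot>\<^sub>m 1\<^sub>m n - map_mat (\<lambda>a. [:a:]) (transpose_mat B * B)"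
      using B by (intro eq_matI) (auto simp: char_poly_matrix_def X_def)
    then show ?thesis using cm[of "transpose_mat B" n b B n] B by (simp add: char_poly_def tP P_def)
  qed
  have cp2: "char_poly (B * transpose_mat B) = det (X \<cdot>\<^sub>m 1\<^sub>m b - P * transpose_mat P)"
  proof -
    have "char_poly_matrix (B * transpose_mat B) = X \<cdot>\<^sub>m 1\<^sub>m b - map_mat (\<lambda>a. [:a:]) (B * transpose_mat B)"
      using B by (intro eq_matI) (auto simp: char_poly_matrix_def X_def)
    then show ?thesis using cm[of B b n "transpose_mat B" b] B by (simp add: char_poly_def tP P_def)
  qed
  define Q where "Q = four_block_mat (X \<cdot>\<^sub>m 1\<^sub>m n) (transpose_mat P) P (1\<^sub>m b)"
  define L1 where "L1 = four_block_mat (1\<^sub>m n) (0\<^sub>m n b) (- P) (1\<^sub>m b)"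
  \<comment> \<open>The lower right block X replaces a division by X in the elimination of
    \<open>P\<close>, at the price of the factor X^b.\<close>
  define L2 where "L2 = four_block_mat (1\<^sub>m n) (0\<^sub>m n b) (- P) (X \<cdot>\<^sub>m 1\<^sub>m b)"
  have Q: "Q \<in> carrier_mat (n + b) (n + b)" "L1 \<in> carrier_mat (n + b) (n + b)" "L2 \<in> carrier_mat (n + b) (n + b)"
    using P by (auto simp: Q_def L1_def L2_def)
  have dX: "det (X \<cdot>\<^sub>m 1\<^sub>m k) = X ^ k" for k by (simp add: det_smult)
  have "det L1 = det (1\<^sub>m n) * det (1\<^sub>m b)"
    unfolding L1_def by (rule det_four_block_mat_upper_right_zero) (use P in auto)
  then have dL1: "det L1 = 1" by simp
  have "det L2 = det (1\<^sub>m n) * det (X \<cdot>\<^sub>m 1\<^sub>m b)"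
    unfolding L2_def by (rule det_four_block_mat_upper_right_zero) (use P in auto)
  then have dL2: "det L2 = X ^ b" by (simp add: dX)
  have "Q * L1 = four_block_mat (X \<cdot>\<^sub>m 1\<^sub>m n - transpose_mat P * P) (transpose_mat P) (0\<^sub>m b n) (1\<^sub>m b)"
  proof -
    have "Q * L1 = four_block_mat (X \<cdot>\<^sub>m 1\<^sub>m n * 1\<^sub>m n + transpose_mat P * - P) (X \<cdot>\<^sub>m 1\<^sub>m n * 0\<^sub>m n b + transpose_mat P * 1\<^sub>m b)
        (P * 1\<^sub>m n + 1\<^sub>m b * - P) (P * 0\<^sub>m n b + 1\<^sub>m b * 1\<^sub>m b)"
      unfolding Q_def L1_def by (rule mult_four_block_mat) (use P in auto)
    also have "X \<cdot>\<^sub>m 1\<^sub>m n * 1\<^sub>m n + transpose_mat P * - P = X \<cdot>\<^sub>m 1\<^sub>m n - transpose_mat P * P"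
      using P by (intro eq_matI) (auto simp: scalar_prod_def sum_negf)
    also have "X \<cdot>\<^sub>m 1\<^sub>m n * 0\<^sub>m n b + transpose_mat P * 1\<^sub>m b = transpose_mat P"
      using P by simp
    also have "P * 1\<^sub>m n + 1\<^sub>m b * - P = 0\<^sub>m b n" using P by (intro eq_matI) auto
    also have "P * 0\<^sub>m n b + 1\<^sub>m b * 1\<^sub>m b = 1\<^sub>m b" using P by simp
    finally show ?thesis .
  qed
  then have "det (Q * L1) = det (X \<cdot>\<^sub>m 1\<^sub>m n - transpose_mat P * P) * det (1\<^sub>m b)"
    by (simp only:, intro det_four_block_mat_lower_left_zero) (use P in auto)
  then have d1: "det Q = det (X \<cdot>\<^sub>m 1\<^sub>m n - transpose_mat P * P)" using det_mult[OF Q(1,2)] dL1 by simp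
  have "L2 * Q = four_block_mat (X \<cdot>\<^sub>m 1\<^sub>m n) (transpose_mat P) (0\<^sub>m b n) (X \<cdot>\<^sub>m 1\<^sub>m b - P * transpose_mat P)"
  proof -
    have smult: "(X \<cdot>\<^sub>m 1\<^sub>m b) * M = X \<cdot>\<^sub>m M" if "M \<in> carrier_mat b c" for M and c :: nat
      using that by (simp add: mult_smult_assoc_mat[of _ b b _ c])
    have smult': "P * (X \<cdot>\<^sub>m 1\<^sub>m n) = X \<cdot>\<^sub>m P"
      using P by (simp add: mult_smult_distrib[of _ b n _ n])
    have "L2 * Q = four_block_mat (1\<^sub>m n * (X \<cdot>\<^sub>m 1\<^sub>m n) + 0\<^sub>m n b * P) (1\<^sub>m n * transpose_mat P + 0\<^sub>m n b * 1\<^sub>m b)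
        (- P * (X \<cdot>\<^sub>m 1\<^sub>m n) + (X \<cdot>\<^sub>m 1\<^sub>m b) * P) (- P * transpose_mat P + (X \<cdot>\<^sub>m 1\<^sub>m b) * 1\<^sub>m b)"
      unfolding Q_def L2_def by (rule mult_four_block_mat) (use P in auto)
    also have "1\<^sub>m n * (X \<cdot>\<^sub>m 1\<^sub>m n) + 0\<^sub>m n b * P = X \<cdot>\<^sub>m 1\<^sub>m n" using P by simp
    also have "1\<^sub>m n * transpose_mat P + 0\<^sub>m n b * 1\<^sub>m b = transpose_mat P" using P by simp
    also have "- P * (X \<cdot>\<^sub>m 1\<^sub>m n) + (X \<cdot>\<^sub>m 1\<^sub>m b) * P = 0\<^sub>m b n"
      using P smult' smult[OF P(1)] by simp
    also have "- P * transpose_mat P + (X \<cdot>\<^sub>m 1\<^sub>m b) * 1\<^sub>m b = X \<cdot>\<^sub>m 1\<^sub>m b - P * transpose_mat P"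
      using P smult[of "1\<^sub>m b" b] by (intro eq_matI) (auto simp: scalar_prod_def sum_negf)
    finally show ?thesis .
  qed
  then have "det (L2 * Q) = det (X \<cdot>\<^sub>m 1\<^sub>m n) * det (X \<cdot>\<^sub>m 1\<^sub>m b - P * transpose_mat P)"
    by (simp only:, intro det_four_block_mat_lower_left_zero) (use P in auto)
  then have "X ^ b * det Q = X ^ n * det (X \<cdot>\<^sub>m 1\<^sub>m b - P * transpose_mat P)" using det_mult[OF Q(3,1)] dL2 by (simp add: dX)
  then show ?thesis unfolding cp1 cp2 d1 X_def by simp
qed

text \<open>\<open>sing_val\<close> reads the \<open>n\<close> eigenvalues of B^T B. By the
  determinant identity they are the \<open>b\<close> values \<open>ev\<close> together with
  \<open>n - b\<close> zeros. As \<open>ev\<close> is nonnegative and decreasing, the zeros come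
  last in the sorted list and position \<open>j - 1\<close> holds \<open>ev (j - 1)\<close>.\<close>

lemma sing_val_diag:
  fixes B :: "real mat" and ev :: "nat \<Rightarrow> real"
  assumes B: "B \<in> carrier_mat b n" and bn: "b \<le> n"
    and diag: "B * transpose_mat B = mat b b (\<lambda>(i, j). if i = j then ev i else 0)"
    and mono: "\<And>i j. i \<le> j \<Longrightarrow> j < b \<Longrightarrow> ev j \<le> ev i" and nonneg: "\<And>i. i < b \<Longrightarrow> 0 \<le> ev i"
    and j: "1 \<le> j" "j \<le> b"
  shows "sing_val B j = sqrt (ev (j - 1))"
proof -
  define L where "L = map ev [0..<b] @ replicate (n - b) 0"
  have "char_poly (B * transpose_mat B) = (\<Prod>a\<leftarrow>diag_mat (B * transpose_mat B). [:- a, 1:])"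
    by (rule char_poly_upper_triangular[of _ b]) (use B in \<open>auto simp: diag\<close>)
  also have "diag_mat (B * transpose_mat B) = map ev [0..<b]"
    unfolding diag by (auto simp: diag_mat_def)
  finally have cp: "char_poly (B * transpose_mat B) = (\<Prod>a\<leftarrow>map ev [0..<b]. [:- a, 1:])" .
  have pl: "proots (\<Prod>a\<leftarrow>as. [:- a, 1:]) = mset as" for as :: "real list"
  proof (induction as)
    case (Cons a as)
    have "(\<Prod>a\<leftarrow>as. [:- a, 1:]) \<noteq> 0" by (auto simp: prod_list_zero_iff)
    then show ?case using Cons by (simp add: proots_mult del: mult_pCons_left)
  qed simp
  have nz: "char_poly (transpose_mat B * B) \<noteq> 0" "char_poly (B * transpose_mat B) \<noteq> 0"
    using degree_monic_char_poly[of "transpose_mat B * B" n] degree_monic_char_poly[of "B * transpose_mat B" b] B by auto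
  have X: "proots ([:0, 1::real:] ^ k) = replicate_mset k 0" for k
    by (simp add: proots_power)
  have "proots ([:0, 1:] ^ b * char_poly (transpose_mat B * B)) = proots ([:0, 1:] ^ n * char_poly (B * transpose_mat B))"
    unfolding det_block_char_poly[OF B] ..
  then have "replicate_mset b 0 + proots (char_poly (transpose_mat B * B)) = replicate_mset n 0 + proots (char_poly (B * transpose_mat B))"
    using nz by (simp add: proots_mult X)
  moreover have "replicate_mset n (0::real) = replicate_mset b 0 + replicate_mset (n - b) 0"
    using bn by (intro multiset_eqI) simp
  ultimately have pr: "proots (char_poly (transpose_mat B * B)) = mset L"
    unfolding cp pl L_def by (simp add: add.assoc ac_simps)
  have so: "sort L = rev L"
  proof (rule properties_for_sort)
    show "sorted (rev L)" unfolding sorted_wrt_rev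
      using mono nonneg by (auto simp: L_def sorted_wrt_iff_nth_less nth_append)
  qed simp
  have "sing_val B j = sqrt (rev (sort L) ! (j - 1))"
    unfolding sing_val_def pr sorted_list_of_multiset_mset ..
  also have "j - 1 < b" using j by simp
  then have "sqrt (rev (sort L) ! (j - 1)) = sqrt (ev (j - 1))" unfolding so by (simp add: L_def nth_append)
  finally show ?thesis .
qed

section \<open>The range of the sketch as a graph\<close>

lemma vnorm_isometry:
  assumes X: "X \<in> carrier_mat r c" "transpose_mat X * X = 1\<^sub>m c" and v: "v \<in> carrier_vec c"
  shows "vnorm (X *\<^sub>v v) = vnorm v"
proof -
  have "(X *\<^sub>v v) \<bullet> (X *\<^sub>v v) = (transpose_mat X *\<^sub>v (X *\<^sub>v v)) \<bullet> v"
    by (rule scalar_prod_mult_mat_vec) (use X v in auto)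
  also have "transpose_mat X *\<^sub>v (X *\<^sub>v v) = v"
    using assoc_mult_mat_vec[of "transpose_mat X" c r X c v] X v by simp
  finally show ?thesis by (simp add: vnorm_def)
qed

lemma mult_mat_vec_index:
  fixes M :: "real mat"
  assumes "M \<in> carrier_mat r c" "z \<in> carrier_vec c" "i < r"
  shows "(M *\<^sub>v z) $ i = (\<Sum>k<c. M $$ (i, k) * z $ k)"
  using assms by (simp add: scalar_prod_def lessThan_atLeast0)

lemma transpose_mult_isometry:
  assumes X: "X \<in> carrier_mat r c" "transpose_mat X * X = 1\<^sub>m c" and v: "v \<in> carrier_vec c"
  shows "transpose_mat X *\<^sub>v (X *\<^sub>v v) = (v :: real Matrix.vec)"
  using assoc_mult_mat_vec[of "transpose_mat X" c r X c v] X v by simp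

lemma orthogonal_transpose:
  fixes X :: "real mat"
  assumes X: "X \<in> carrier_mat r r" "transpose_mat X * X = 1\<^sub>m r"
  shows "X * transpose_mat X = 1\<^sub>m r"
  by (rule mat_mult_left_right_inverse[OF _ X]) (use X in simp)

lemma vnorm_minus_proj:
  assumes Q: "Q \<in> carrier_mat r c" "transpose_mat Q * Q = 1\<^sub>m c" and w: "w \<in> carrier_vec r"
  shows "vnorm (w - Q *\<^sub>v (transpose_mat Q *\<^sub>v w)) \<le> vnorm w" "vnorm (Q *\<^sub>v (transpose_mat Q *\<^sub>v w)) \<le> vnorm w"
proof -
  define z where "z = transpose_mat Q *\<^sub>v w"
  have z: "z \<in> carrier_vec c" using Q w by (simp add: z_def)
  have Qz: "Q *\<^sub>v z \<in> carrier_vec r" using Q z by simp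
  have 1: "w \<bullet> (Q *\<^sub>v z) = z \<bullet> z" using scalar_prod_mult_mat_vec[OF Q(1) w z] by (simp add: z_def)
  have 2: "(Q *\<^sub>v z) \<bullet> (Q *\<^sub>v z) = z \<bullet> z"
    using vnorm_isometry[OF Q z] by (metis vnorm_square_scalar)
  have "(w - Q *\<^sub>v z) \<bullet> (w - Q *\<^sub>v z) = w \<bullet> w - 2 * (w \<bullet> (Q *\<^sub>v z)) + (Q *\<^sub>v z) \<bullet> (Q *\<^sub>v z)"
    using w Qz by (simp add: scalar_prod_minus_distrib[of _ r] minus_scalar_prod_distrib[of _ r] comm_scalar_prod[of "Q *\<^sub>v z" r w])
  then have eq: "(vnorm (w - Q *\<^sub>v z))\<^sup>2 = (vnorm w)\<^sup>2 - (vnorm (Q *\<^sub>v z))\<^sup>2"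
    unfolding vnorm_square_scalar using 1 2 by simp
  have "0 \<le> (vnorm (Q *\<^sub>v z))\<^sup>2" "0 \<le> (vnorm (w - Q *\<^sub>v z))\<^sup>2" by auto
  then have "(vnorm (w - Q *\<^sub>v z))\<^sup>2 \<le> (vnorm w)\<^sup>2" "(vnorm (Q *\<^sub>v z))\<^sup>2 \<le> (vnorm w)\<^sup>2" using eq by linarith+
  then show "vnorm (w - Q *\<^sub>v (transpose_mat Q *\<^sub>v w)) \<le> vnorm w" "vnorm (Q *\<^sub>v (transpose_mat Q *\<^sub>v w)) \<le> vnorm w"
    unfolding z_def by (auto intro: power2_le_imp_le)
qed

lemma sum_split_lessThan:
  fixes f :: "nat \<Rightarrow> real"
  assumes "b \<le> n"
  shows "(\<Sum>i<n. f i) = (\<Sum>i<b. f i) + (\<Sum>i\<in>{b..<n}. f i)"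
  using assms by (simp add: sum.atLeastLessThan_concat lessThan_atLeast0)

lemma rect_diag_mult_vec:
  fixes f :: "nat \<Rightarrow> real"
  assumes "z \<in> carrier_vec n"
  shows "mat m n (\<lambda>(i,j). if i = j then f i else 0) *\<^sub>v z = Matrix.vec m (\<lambda>i. if i < n then f i * z $ i else 0)"
proof (rule eq_vecI)
  fix i assume "i < dim_vec (Matrix.vec m (\<lambda>i. if i < n then f i * z $ i else 0))"
  then have i: "i < m" by simp
  have "(mat m n (\<lambda>(i,j). if i = j then f i else 0) *\<^sub>v z) $ i = (\<Sum>j\<in>{0..<n}. (if i = j then f i else 0) * z $ j)"
    using i assms by (simp add: scalar_prod_def)
  also have "\<dots> = (\<Sum>j\<in>{0..<n}. if i = j then f i * z $ j else 0)"
    by (intro sum.cong) auto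
  finally show "(mat m n (\<lambda>(i,j). if i = j then f i else 0) *\<^sub>v z) $ i = Matrix.vec m (\<lambda>i. if i < n then f i * z $ i else 0) $ i"
    using i by simp
qed simp

section \<open>Coordinates of the sketch in the singular bases\<close>

locale range_finder =
  fixes m n b q :: nat and \<sigma> :: "nat \<Rightarrow> real" and A U V Q F :: "real mat"
  assumes mn: "n \<le> m" and bn: "1 \<le> b" "b < n"
    and U: "U \<in> carrier_mat m m" "transpose_mat U * U = 1\<^sub>m m"
    and V: "V \<in> carrier_mat n n" "transpose_mat V * V = 1\<^sub>m n"
    and A: "A = U * mat m n (\<lambda>(i,j). if i = j then \<sigma> (i+1) else 0) * transpose_mat V"
    and mono: "\<And>i j. 1 \<le> i \<Longrightarrow> i \<le> j \<Longrightarrow> j \<le> n \<Longrightarrow> \<sigma> j \<le> \<sigma> i"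
    and nonneg: "\<And>i. 1 \<le> i \<Longrightarrow> i \<le> n \<Longrightarrow> 0 \<le> \<sigma> i"
    and pos: "\<sigma> b > 0"
    and F: "F \<in> carrier_mat (n - b) b"
    and Q: "Q \<in> carrier_mat m b" "transpose_mat Q * Q = 1\<^sub>m b"
begin

text \<open>Zero-based indexing, to match vector coordinates: \<open>s b\<close> is \<sigma> (b+1),
  the first singular value left out, and \<open>s (b - 1)\<close> is \<sigma> b.\<close>

abbreviation s :: "nat \<Rightarrow> real" where "s i \<equiv> \<sigma> (i + 1)"

abbreviation p :: nat where "p \<equiv> 2 * q + 1"

text \<open>The vector \<Sigma>_1^-p x, with \<Sigma>_1 the leading diagonal block; the divisors are
  positive for j < b.\<close>

definition scaled :: "real Matrix.vec \<Rightarrow> nat \<Rightarrow> real" where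
  "scaled x j = x $ j / s j ^ p"

text \<open>F u, indexed by the ambient coordinate \<open>i\<close> from \<open>b\<close> to
  \<open>n - 1\<close>; hence the shift to row \<open>i - b\<close>.\<close>

definition tail :: "(nat \<Rightarrow> real) \<Rightarrow> nat \<Rightarrow> real" where
  "tail u i = (\<Sum>j<b. F $$ (i - b, j) * u j)"

text \<open>In the basis \<open>U\<close>, the range of the sketched matrix is the graph of
  \<open>\<Sigma>\<^sub>2\<^sup>p F \<Sigma>\<^sub>1\<^sup>-\<^sup>p\<close> over the first \<open>b\<close> coordinates.\<close>
definition graph_vec :: "real Matrix.vec \<Rightarrow> real Matrix.vec" where
  "graph_vec x = Matrix.vec m (\<lambda>i. if i < b then x $ i else if i < n then s i ^ p * tail (scaled x) i else 0)"

lemma s_mono: "i \<le> j \<Longrightarrow> j < n \<Longrightarrow> s j \<le> s i"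
  using mono[of "i + 1" "j + 1"] by simp

lemma s_nonneg: "i < n \<Longrightarrow> 0 \<le> s i"
  using nonneg[of "i + 1"] by simp

lemma s_pos: "i < b \<Longrightarrow> 0 < s i"
  using mono[of "i + 1" b] bn pos by simp

lemma A_carrier: "A \<in> carrier_mat m n"
  unfolding A by (intro mult_carrier_mat[of _ m n _ n] mult_carrier_mat[of U m m]) (use U V in auto)

lemma A_mult: 
  assumes "y \<in> carrier_vec n"
  shows "A *\<^sub>v y = U *\<^sub>v Matrix.vec m (\<lambda>i. if i < n then s i * (transpose_mat V *\<^sub>v y) $ i else 0)"
proof -
  let ?S = "mat m n (\<lambda>(i,j). if i = j then s i else 0)"
  have z: "transpose_mat V *\<^sub>v y \<in> carrier_vec n" using V assms by simp
  have "A *\<^sub>v y = U *\<^sub>v (?S *\<^sub>v (transpose_mat V *\<^sub>v y))"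
    unfolding A using U V assms assoc_mult_mat_vec[of "U * ?S" m n "transpose_mat V" n y]
      assoc_mult_mat_vec[of U m m ?S n "transpose_mat V *\<^sub>v y"] by simp
  also have "?S *\<^sub>v (transpose_mat V *\<^sub>v y) = Matrix.vec m (\<lambda>i. if i < n then s i * (transpose_mat V *\<^sub>v y) $ i else 0)"
    by (rule rect_diag_mult_vec[OF z])
  finally show ?thesis .
qed

lemma transpose_A_mult_vec:
  assumes c: "c \<in> carrier_vec m"
  shows "transpose_mat A *\<^sub>v (U *\<^sub>v c) = V *\<^sub>v Matrix.vec n (\<lambda>i. s i * c $ i)"
proof -
  let ?S = "mat m n (\<lambda>(i,j). if i = j then s i else 0)"
  have SU: "transpose_mat ?S * transpose_mat U \<in> carrier_mat n m" by (rule mult_carrier_mat[of _ n m]) (use U in auto)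
  have Uc: "U *\<^sub>v c \<in> carrier_vec m" using U c by simp
  have US: "U * ?S \<in> carrier_mat m n" by (rule mult_carrier_mat[of _ m m]) (use U in auto)
  have "transpose_mat A = transpose_mat (transpose_mat V) * transpose_mat (U * ?S)"
    unfolding A by (rule transpose_mult[OF US]) (use V in simp)
  also have "transpose_mat (U * ?S) = transpose_mat ?S * transpose_mat U" by (rule transpose_mult[of U m m]) (use U in auto)
  finally have "transpose_mat A = V * (transpose_mat ?S * transpose_mat U)" by simp
  then have "transpose_mat A *\<^sub>v (U *\<^sub>v c) = V *\<^sub>v ((transpose_mat ?S * transpose_mat U) *\<^sub>v (U *\<^sub>v c))"
    using assoc_mult_mat_vec[OF V(1) SU Uc] by simp
  also have "(transpose_mat ?S * transpose_mat U) *\<^sub>v (U *\<^sub>v c) = transpose_mat ?S *\<^sub>v (transpose_mat U *\<^sub>v (U *\<^sub>v c))"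
    by (rule assoc_mult_mat_vec[of _ n m _ m]) (use U Uc in auto)
  also have "transpose_mat U *\<^sub>v (U *\<^sub>v c) = c" by (rule transpose_mult_isometry[OF U c])
  also have "transpose_mat ?S = mat n m (\<lambda>(i,j). if i = j then s i else 0)" by (intro eq_matI) auto
  also have "\<dots> *\<^sub>v c = Matrix.vec n (\<lambda>i. if i < m then s i * c $ i else 0)" by (rule rect_diag_mult_vec[OF c])
  also have "\<dots> = Matrix.vec n (\<lambda>i. s i * c $ i)" using mn by (intro eq_vecI) auto
  finally show ?thesis .
qed

lemma transpose_A_mult:
  assumes c: "c \<in> carrier_vec m"
  shows "(vnorm (transpose_mat A *\<^sub>v (U *\<^sub>v c)))\<^sup>2 = (\<Sum>i<n. (s i * c $ i)\<^sup>2)"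
  unfolding transpose_A_mult_vec[OF c]
  using vnorm_isometry[OF V, of "Matrix.vec n (\<lambda>i. s i * c $ i)"] vnorm_square[of "Matrix.vec n (\<lambda>i. s i * c $ i)" n] by simp

text \<open>\<open>f\<close> is generalised in the induction, because one factor A A^T replaces f i
  by (s i)^2 * f i.\<close>

lemma power_mult_vec:
  "((A * transpose_mat A) ^\<^sub>m k) *\<^sub>v (U *\<^sub>v Matrix.vec m (\<lambda>i. if i < n then f i else 0))
    = U *\<^sub>v Matrix.vec m (\<lambda>i. if i < n then s i ^ (2 * k) * f i else 0)"
proof (induction k arbitrary: f)
  case 0
  show ?case using U A_carrier by (simp cong: if_cong)
next
  case (Suc k)
  let ?f = "Matrix.vec m (\<lambda>i. if i < n then f i else 0)"
  let ?g = "Matrix.vec n (\<lambda>i. s i * f i)"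
  have Uf: "U *\<^sub>v ?f \<in> carrier_vec m" using U by (simp add: mult_mat_vec_carrier[of _ m m])
  have AA: "A * transpose_mat A \<in> carrier_mat m m" using A_carrier by simp
  have "((A * transpose_mat A) ^\<^sub>m Suc k) *\<^sub>v (U *\<^sub>v ?f) = ((A * transpose_mat A) ^\<^sub>m k) *\<^sub>v ((A * transpose_mat A) *\<^sub>v (U *\<^sub>v ?f))"
    using assoc_mult_mat_vec[OF pow_carrier_mat[OF AA] AA Uf] by simp
  also have "(A * transpose_mat A) *\<^sub>v (U *\<^sub>v ?f) = A *\<^sub>v (transpose_mat A *\<^sub>v (U *\<^sub>v ?f))"
    by (rule assoc_mult_mat_vec[of _ m n _ m]) (use A_carrier Uf in auto)
  also have "transpose_mat A *\<^sub>v (U *\<^sub>v ?f) = V *\<^sub>v Matrix.vec n (\<lambda>i. s i * ?f $ i)" by (rule transpose_A_mult_vec) simp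
  also have "Matrix.vec n (\<lambda>i. s i * ?f $ i) = ?g" using mn by (intro eq_vecI) auto
  also have "A *\<^sub>v (V *\<^sub>v ?g) = U *\<^sub>v Matrix.vec m (\<lambda>i. if i < n then s i * (transpose_mat V *\<^sub>v (V *\<^sub>v ?g)) $ i else 0)"
    by (rule A_mult) (use V in \<open>simp add: mult_mat_vec_carrier[of _ n n]\<close>)
  also have "transpose_mat V *\<^sub>v (V *\<^sub>v ?g) = ?g" by (rule transpose_mult_isometry[OF V]) simp
  also have "Matrix.vec m (\<lambda>i. if i < n then s i * ?g $ i else 0) = Matrix.vec m (\<lambda>i. if i < n then (s i)\<^sup>2 * f i else 0)"
    by (intro eq_vecI) (auto simp: power2_eq_square)
  also have "((A * transpose_mat A) ^\<^sub>m k) *\<^sub>v (U *\<^sub>v Matrix.vec m (\<lambda>i. if i < n then (s i)\<^sup>2 * f i else 0))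
     = U *\<^sub>v Matrix.vec m (\<lambda>i. if i < n then s i ^ (2 * k) * ((s i)\<^sup>2 * f i) else 0)" by (rule Suc.IH)
  also have "Matrix.vec m (\<lambda>i. if i < n then s i ^ (2 * k) * ((s i)\<^sup>2 * f i) else 0) = Matrix.vec m (\<lambda>i. if i < n then s i ^ (2 * Suc k) * f i else 0)"
    by (intro eq_vecI) (auto simp: power_add[symmetric] mult.assoc[symmetric])
  finally show ?case .
qed

text \<open>The exponent \<open>p\<close> collects 2 * q factors from the power and one from
  \<open>A\<close>. \<open>F_eq\<close> is the property of vectors w in the range of the Gaussian
  matrix that the lower coordinates of V^T w are F applied to the upper ones.\<close>

lemma sketch_mult_vec:
  assumes w: "w \<in> carrier_vec n"
    and F_eq: "\<And>i. i \<in> {b..<n} \<Longrightarrow> (transpose_mat V *\<^sub>v w) $ i = tail (($) (transpose_mat V *\<^sub>v w)) i"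
  shows "((A * transpose_mat A) ^\<^sub>m q) *\<^sub>v (A *\<^sub>v w) = U *\<^sub>v graph_vec (Matrix.vec b (\<lambda>i. s i ^ p * (transpose_mat V *\<^sub>v w) $ i))"
proof -
  define \<omega> where "\<omega> = transpose_mat V *\<^sub>v w"
  let ?x = "Matrix.vec b (\<lambda>i. s i ^ p * \<omega> $ i)"
  have "((A * transpose_mat A) ^\<^sub>m q) *\<^sub>v (A *\<^sub>v w) = U *\<^sub>v Matrix.vec m (\<lambda>i. if i < n then s i ^ (2 * q) * (s i * \<omega> $ i) else 0)"
    unfolding A_mult[OF w] \<omega>_def[symmetric] by (rule power_mult_vec)
  also have "Matrix.vec m (\<lambda>i. if i < n then s i ^ (2 * q) * (s i * \<omega> $ i) else 0) = graph_vec ?x"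
  proof (rule eq_vecI)
    fix i assume "i < dim_vec (graph_vec ?x)"
    then have i: "i < m" by (simp add: graph_vec_def)
    have "tail (scaled ?x) i = tail (($) \<omega>) i"
      unfolding tail_def
    proof (intro sum.cong refl)
      fix j assume j: "j \<in> {..<b}"
      then have "s j \<noteq> 0" using s_pos[of j] by simp
      then have "scaled ?x j = \<omega> $ j" using j by (simp add: scaled_def)
      then show "F $$ (i - b, j) * scaled ?x j = F $$ (i - b, j) * \<omega> $ j" by simp
    qed
    then show "Matrix.vec m (\<lambda>i. if i < n then s i ^ (2 * q) * (s i * \<omega> $ i) else 0) $ i = graph_vec ?x $ i"
      using i F_eq[of i] bn by (auto simp: graph_vec_def \<omega>_def[symmetric])
  qed (simp add: graph_vec_def)
  finally show ?thesis by (simp add: \<omega>_def)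
qed

section \<open>Norm estimates on the graph\<close>

abbreviation E :: real where "E \<equiv> spec_norm F"

lemma E_nonneg: "0 \<le> E"
  using spec_norm_nonneg[OF F] bn by simp

lemma tail_bound: "(\<Sum>i\<in>{b..<n}. (tail u i)\<^sup>2) \<le> E\<^sup>2 * (\<Sum>j<b. (u j)\<^sup>2)"
proof -
  let ?u = "Matrix.vec b u"
  have "(vnorm (F *\<^sub>v ?u))\<^sup>2 = (\<Sum>i<n - b. (\<Sum>j<b. F $$ (i, j) * u j)\<^sup>2)"
    using vnorm_mult_mat_vec_sum[OF F, of ?u] by (simp add: sum_nonneg)
  also have "\<dots> = (\<Sum>i\<in>{b..<n}. (tail u i)\<^sup>2)"
    unfolding tail_def by (rule sum.reindex_bij_witness[of _ "\<lambda>i. i - b" "\<lambda>i. i + b"]) auto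
  finally have "(\<Sum>i\<in>{b..<n}. (tail u i)\<^sup>2) = (vnorm (F *\<^sub>v ?u))\<^sup>2" ..
  also have "\<dots> \<le> (E * vnorm ?u)\<^sup>2" by (intro power_mono vnorm_le_spec_norm[OF F]) auto
  also have "\<dots> = E\<^sup>2 * (\<Sum>j<b. (u j)\<^sup>2)" using vnorm_square[of ?u b] by (simp add: power_mult_distrib)
  finally show ?thesis .
qed

lemma vnorm_graph_vec:
  assumes "x \<in> carrier_vec b"
  shows "(vnorm (U *\<^sub>v graph_vec x))\<^sup>2 = (\<Sum>i<b. (x $ i)\<^sup>2) + (\<Sum>i\<in>{b..<n}. (s i ^ p * tail (scaled x) i)\<^sup>2)"
proof -
  have g: "graph_vec x \<in> carrier_vec m" by (simp add: graph_vec_def)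
  have "(vnorm (U *\<^sub>v graph_vec x))\<^sup>2 = (\<Sum>i<m. (graph_vec x $ i)\<^sup>2)"
    using vnorm_isometry[OF U g] vnorm_square[OF g] by simp
  also have "\<dots> = (\<Sum>i<b. (graph_vec x $ i)\<^sup>2) + ((\<Sum>i\<in>{b..<n}. (graph_vec x $ i)\<^sup>2) + (\<Sum>i\<in>{n..<m}. (graph_vec x $ i)\<^sup>2))"
    using bn mn by (simp add: sum_split_lessThan[of b m] sum.atLeastLessThan_concat)
  also have "(\<Sum>i<b. (graph_vec x $ i)\<^sup>2) = (\<Sum>i<b. (x $ i)\<^sup>2)" using bn mn by (intro sum.cong) (auto simp: graph_vec_def)
  also have "(\<Sum>i\<in>{b..<n}. (graph_vec x $ i)\<^sup>2) = (\<Sum>i\<in>{b..<n}. (s i ^ p * tail (scaled x) i)\<^sup>2)"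
    using bn mn by (intro sum.cong) (auto simp: graph_vec_def)
  also have "(\<Sum>i\<in>{n..<m}. (graph_vec x $ i)\<^sup>2) = 0" using bn by (intro sum.neutral) (auto simp: graph_vec_def)
  finally show ?thesis by simp
qed

text \<open>The weights decrease, so the first one, \<open>s t\<close>, can be pulled out. The
  residual and the singular values use t = b, the deviation a general t.\<close>

lemma tail_weighted:
  assumes "b \<le> t" "t < n"
  shows "(\<Sum>i\<in>{t..<n}. (s i ^ k * tail u i)\<^sup>2) \<le> (s t ^ k)\<^sup>2 * (E\<^sup>2 * (\<Sum>j<b. (u j)\<^sup>2))"
proof -
  have "(\<Sum>i\<in>{t..<n}. (s i ^ k * tail u i)\<^sup>2) \<le> (\<Sum>i\<in>{t..<n}. (s t ^ k)\<^sup>2 * (tail u i)\<^sup>2)"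
  proof (intro sum_mono)
    fix i assume i: "i \<in> {t..<n}"
    have "s i ^ k \<le> s t ^ k" using i s_mono[of t i] s_nonneg[of i] by (intro power_mono) auto
    then have "(s i ^ k)\<^sup>2 \<le> (s t ^ k)\<^sup>2" by (rule power_mono) (use i s_nonneg[of i] in auto)
    then show "(s i ^ k * tail u i)\<^sup>2 \<le> (s t ^ k)\<^sup>2 * (tail u i)\<^sup>2"
      unfolding power_mult_distrib by (intro mult_right_mono) auto
  qed
  also have "\<dots> = (s t ^ k)\<^sup>2 * (\<Sum>i\<in>{t..<n}. (tail u i)\<^sup>2)" by (simp add: sum_distrib_left)
  also have "\<dots> \<le> (s t ^ k)\<^sup>2 * (\<Sum>i\<in>{b..<n}. (tail u i)\<^sup>2)"
    using assms by (intro mult_left_mono sum_mono2) auto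
  also have "\<dots> \<le> (s t ^ k)\<^sup>2 * (E\<^sup>2 * (\<Sum>j<b. (u j)\<^sup>2))" by (intro mult_left_mono tail_bound) auto
  finally show ?thesis .
qed

lemma scaled_sum_le:
  assumes "l < b" "\<And>j. l < j \<Longrightarrow> j < b \<Longrightarrow> u j = 0"
  shows "(\<Sum>j<b. (u j / s j ^ k)\<^sup>2) \<le> (\<Sum>j<b. (u j)\<^sup>2) / (s l ^ k)\<^sup>2"
  unfolding sum_divide_distrib
proof (intro sum_mono)
  fix j assume j: "j \<in> {..<b}"
  show "(u j / s j ^ k)\<^sup>2 \<le> (u j)\<^sup>2 / (s l ^ k)\<^sup>2"
  proof (cases "j \<le> l")
    case True
    have "s l ^ k \<le> s j ^ k" using True s_mono[of j l] s_pos[of l] assms bn by (intro power_mono) auto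
    moreover have "0 < s l ^ k" using s_pos[of l] assms by simp
    ultimately have "(s l ^ k)\<^sup>2 \<le> (s j ^ k)\<^sup>2" "0 < (s l ^ k)\<^sup>2"
      using power_mono[of "s l ^ k" "s j ^ k" 2] zero_less_power[of "s l ^ k" 2] by auto
    moreover have "0 < (s j ^ k)\<^sup>2" using s_pos[of j] j by simp
    ultimately show ?thesis unfolding power_divide by (intro divide_left_mono mult_pos_pos zero_le_power2)
  next
    case False
    then show ?thesis using assms(2)[of j] j by simp
  qed
qed

end

text \<open>Kept apart from \<open>range_finder\<close> because \<open>Q\<close> and
  \<open>F\<close> are linked through \<open>graph_vec\<close>, which the first locale has to
  define. The inclusion of the graph in the range serves the residual and the lower singular value
  bounds, the converse one the deviation.\<close>

locale range_finder_graph = range_finder +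
  assumes graph_in_range: "\<And>x. x \<in> carrier_vec b \<Longrightarrow> \<exists>z\<in>carrier_vec b. U *\<^sub>v graph_vec x = Q *\<^sub>v z"
    and range_in_graph: "\<And>z. z \<in> carrier_vec b \<Longrightarrow> \<exists>x\<in>carrier_vec b. Q *\<^sub>v z = U *\<^sub>v graph_vec x"
begin

definition R :: "real mat" where "R = (1\<^sub>m m - Q * transpose_mat Q) * A"

lemma R_carrier: "R \<in> carrier_mat m n"
  unfolding R_def by (rule mult_carrier_mat[of _ m m]) (use Q A_carrier in auto)

lemma graph_vec_carrier: "graph_vec x \<in> carrier_vec m"
  by (simp add: graph_vec_def)

lemma proj_mult_vec:
  fixes X :: "real mat"
  assumes "X \<in> carrier_mat m c" "w \<in> carrier_vec m"
  shows "(1\<^sub>m m - X * transpose_mat X) *\<^sub>v w = w - X *\<^sub>v (transpose_mat X *\<^sub>v w)"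
proof -
  have "(1\<^sub>m m - X * transpose_mat X) *\<^sub>v w = 1\<^sub>m m *\<^sub>v w - (X * transpose_mat X) *\<^sub>v w"
    by (rule minus_mult_distrib_mat_vec[of _ m m]) (use assms in auto)
  also have "(X * transpose_mat X) *\<^sub>v w = X *\<^sub>v (transpose_mat X *\<^sub>v w)"
    by (rule assoc_mult_mat_vec[of _ m c _ m]) (use assms in auto)
  finally show ?thesis using assms by simp
qed

lemma R_mult: 
  assumes y: "y \<in> carrier_vec n"
  shows "R *\<^sub>v y = A *\<^sub>v y - Q *\<^sub>v (transpose_mat Q *\<^sub>v (A *\<^sub>v y))"
proof -
  have "R *\<^sub>v y = (1\<^sub>m m - Q * transpose_mat Q) *\<^sub>v (A *\<^sub>v y)"
    unfolding R_def by (rule assoc_mult_mat_vec[of _ m m _ n]) (use Q A_carrier y in auto)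
  then show ?thesis using proj_mult_vec[OF Q(1), of "A *\<^sub>v y"] A_carrier y by simp
qed

text \<open>The graph vector lies in the range of \<open>Q\<close>, so subtracting it from A y does
  not change the residual, and the complementary projection does not increase the norm of the
  difference.\<close>

lemma residual_le:
  assumes y: "y \<in> carrier_vec n" and x: "x \<in> carrier_vec b"
  shows "vnorm (R *\<^sub>v y) \<le> vnorm (A *\<^sub>v y - U *\<^sub>v graph_vec x)"
proof -
  define w where "w = A *\<^sub>v y"
  have w: "w \<in> carrier_vec m" using A_carrier y by (simp add: w_def)
  obtain z where z: "z \<in> carrier_vec b" "U *\<^sub>v graph_vec x = Q *\<^sub>v z" using graph_in_range[OF x] by auto
  define g where "g = Q *\<^sub>v z"
  have g: "g \<in> carrier_vec m" using Q z by (simp add: g_def)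
  have Qg: "transpose_mat Q *\<^sub>v g = z" unfolding g_def by (rule transpose_mult_isometry[OF Q z(1)])
  have QT: "transpose_mat Q \<in> carrier_mat b m" using Q by simp
  have "transpose_mat Q *\<^sub>v (w - g) = transpose_mat Q *\<^sub>v w - z"
    using mult_minus_distrib_mat_vec[OF QT w g] Qg by simp
  then have "Q *\<^sub>v (transpose_mat Q *\<^sub>v (w - g)) = Q *\<^sub>v (transpose_mat Q *\<^sub>v w) - g"
    using mult_minus_distrib_mat_vec[OF Q(1), of "transpose_mat Q *\<^sub>v w" z] QT w z by (simp add: g_def)
  then have "(w - g) - Q *\<^sub>v (transpose_mat Q *\<^sub>v (w - g)) = w - Q *\<^sub>v (transpose_mat Q *\<^sub>v w)"
    using w g Q by (intro eq_vecI) auto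
  then have "R *\<^sub>v y = (w - g) - Q *\<^sub>v (transpose_mat Q *\<^sub>v (w - g))"
    using R_mult[OF y] by (simp add: w_def)
  then show ?thesis using vnorm_minus_proj(1)[OF Q, of "w - g"] w g z(2) by (simp add: w_def g_def)
qed

text \<open>The comparison vector is the graph vector that agrees with U^T A V z in the first
  \<open>b\<close> coordinates, so only coordinates \<open>b\<close> to \<open>n - 1\<close> remain.
  Its parameter x j = s j * z j cancels one factor, which lowers the divisor from s j ^ p to s j ^
  (2 * q).\<close>

lemma residual_coords:
  assumes z: "z \<in> carrier_vec n"
  shows "(vnorm (R *\<^sub>v (V *\<^sub>v z)))\<^sup>2 \<le> (\<Sum>i\<in>{b..<n}. (s i * z $ i - s i ^ p * tail (\<lambda>j. z $ j / s j ^ (2 * q)) i)\<^sup>2)"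
proof -
  have y: "V *\<^sub>v z \<in> carrier_vec n" using V z by simp
  have Vz: "transpose_mat V *\<^sub>v (V *\<^sub>v z) = z" by (rule transpose_mult_isometry[OF V z])
  define x where "x = Matrix.vec b (\<lambda>j. s j * z $ j)"
  have x: "x \<in> carrier_vec b" by (simp add: x_def)
  define c where "c = Matrix.vec m (\<lambda>i. if i < n then s i * z $ i else 0)"
  have c: "c \<in> carrier_vec m" by (simp add: c_def)
  have "A *\<^sub>v (V *\<^sub>v z) - U *\<^sub>v graph_vec x = U *\<^sub>v (c - graph_vec x)"
    using A_mult[OF y] mult_minus_distrib_mat_vec[OF U(1) c graph_vec_carrier] unfolding Vz c_def by simp
  moreover have cg: "c - graph_vec x \<in> carrier_vec m" using c graph_vec_carrier by simp
  ultimately have "(vnorm (A *\<^sub>v (V *\<^sub>v z) - U *\<^sub>v graph_vec x))\<^sup>2 = (\<Sum>i<m. ((c - graph_vec x) $ i)\<^sup>2)"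
    using vnorm_isometry[OF U cg] vnorm_square[OF cg] by simp
  also have "\<dots> = (\<Sum>i<b. ((c - graph_vec x) $ i)\<^sup>2) + ((\<Sum>i\<in>{b..<n}. ((c - graph_vec x) $ i)\<^sup>2) + (\<Sum>i\<in>{n..<m}. ((c - graph_vec x) $ i)\<^sup>2))"
    using bn mn by (simp add: sum_split_lessThan[of b m] sum.atLeastLessThan_concat)
  also have "(\<Sum>i<b. ((c - graph_vec x) $ i)\<^sup>2) = 0"
    using bn mn by (intro sum.neutral) (auto simp: c_def graph_vec_def x_def)
  also have "(\<Sum>i\<in>{n..<m}. ((c - graph_vec x) $ i)\<^sup>2) = 0"
    using bn by (intro sum.neutral) (auto simp: graph_vec_def c_def)
  also have "(\<Sum>i\<in>{b..<n}. ((c - graph_vec x) $ i)\<^sup>2) = (\<Sum>i\<in>{b..<n}. (s i * z $ i - s i ^ p * tail (\<lambda>j. z $ j / s j ^ (2 * q)) i)\<^sup>2)"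
  proof (intro sum.cong refl)
    fix i assume i: "i \<in> {b..<n}"
    have "tail (scaled x) i = tail (\<lambda>j. z $ j / s j ^ (2 * q)) i"
      unfolding tail_def
    proof (intro sum.cong refl)
      fix j assume j: "j \<in> {..<b}"
      then have "s j \<noteq> 0" using s_pos[of j] by simp
      then have "scaled x j = z $ j / s j ^ (2 * q)" using j by (simp add: scaled_def x_def)
      then show "F $$ (i - b, j) * scaled x j = F $$ (i - b, j) * (z $ j / s j ^ (2 * q))" by simp
    qed
    then show "((c - graph_vec x) $ i)\<^sup>2 = (s i * z $ i - s i ^ p * tail (\<lambda>j. z $ j / s j ^ (2 * q)) i)\<^sup>2"
      using i mn by (simp add: c_def graph_vec_def)
  qed
  finally show ?thesis using power_mono[OF residual_le[OF y x], of 2] by simp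
qed

text \<open>With \<beta> and \<alpha> the norms of \<open>z\<close> on the first \<open>b\<close>
  and on the remaining coordinates, the triangle inequality gives s b * (\<alpha> + \<kappa> *
  \<beta>), and Cauchy-Schwarz bounds the bracket by sqrt (1 + \<kappa>^2) * |y|. The exponent 4 * q
  is twice the 2 * q in \<kappa>.\<close>

lemma spec_norm_residual:
  "spec_norm R \<le> sqrt (1 + (\<sigma> (b+1) / \<sigma> b) ^ (4*q) * E\<^sup>2) * \<sigma> (b+1)"
proof (rule spec_norm_le[OF R_carrier])
  have sb: "0 \<le> s b" using s_nonneg bn by simp
  then show "0 \<le> sqrt (1 + (\<sigma> (b+1) / \<sigma> b) ^ (4*q) * E\<^sup>2) * \<sigma> (b+1)" using pos by simp
  fix y :: "real Matrix.vec" assume y: "y \<in> carrier_vec n"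
  define z where "z = transpose_mat V *\<^sub>v y"
  have z: "z \<in> carrier_vec n" using V y by (simp add: z_def)
  have Vz: "V *\<^sub>v z = y"
    unfolding z_def using assoc_mult_mat_vec[of V n n "transpose_mat V" n y] orthogonal_transpose[OF V] V y by simp
  define u where "u j = z $ j / s j ^ (2 * q)" for j
  define \<kappa> where "\<kappa> = (\<sigma> (b+1) / \<sigma> b) ^ (2 * q) * E"
  define \<alpha> where "\<alpha> = L2_set (($) z) {b..<n}"
  define \<beta> where "\<beta> = L2_set (($) z) {..<b}"
  have ab: "0 \<le> \<alpha>" "0 \<le> \<beta>" by (auto simp: \<alpha>_def \<beta>_def L2_set_nonneg)
  have \<kappa>: "0 \<le> \<kappa>" using sb pos E_nonneg by (simp add: \<kappa>_def)
  have n2: "(vnorm y)\<^sup>2 = \<beta>\<^sup>2 + \<alpha>\<^sup>2"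
    using vnorm_isometry[OF V z] vnorm_square[OF z] bn
    by (simp add: Vz \<alpha>_def \<beta>_def L2_set_def sum_nonneg sum_split_lessThan[of b n])
  have 1: "L2_set (\<lambda>i. s i * z $ i) {b..<n} \<le> s b * \<alpha>"
  proof -
    have "L2_set (\<lambda>i. s i * z $ i) {b..<n} = L2_set (\<lambda>i. \<bar>s i * z $ i\<bar>) {b..<n}" by (simp add: L2_set_def)
    also have "\<dots> \<le> L2_set (\<lambda>i. s b * \<bar>z $ i\<bar>) {b..<n}"
      by (rule L2_set_mono) (use s_mono[of b] s_nonneg in \<open>auto simp: abs_mult intro!: mult_right_mono\<close>)
    also have "\<dots> = s b * L2_set (\<lambda>i. \<bar>z $ i\<bar>) {b..<n}" using sb by (simp add: L2_set_right_distrib)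
    finally show ?thesis by (simp add: \<alpha>_def L2_set_def)
  qed
  have 2: "L2_set (\<lambda>i. s i ^ p * tail u i) {b..<n} \<le> s b * (\<kappa> * \<beta>)"
  proof -
    have "(\<Sum>i\<in>{b..<n}. (s i ^ p * tail u i)\<^sup>2) \<le> (s b ^ p)\<^sup>2 * (E\<^sup>2 * (\<Sum>j<b. (u j)\<^sup>2))"
      by (rule tail_weighted) (use bn in auto)
    also have "(\<Sum>j<b. (u j)\<^sup>2) \<le> (\<Sum>j<b. (z $ j)\<^sup>2) / (s (b - 1) ^ (2 * q))\<^sup>2"
      unfolding u_def by (rule scaled_sum_le) (use bn in auto)
    then have "(s b ^ p)\<^sup>2 * (E\<^sup>2 * (\<Sum>j<b. (u j)\<^sup>2)) \<le> (s b ^ p)\<^sup>2 * (E\<^sup>2 * ((\<Sum>j<b. (z $ j)\<^sup>2) / (s (b - 1) ^ (2 * q))\<^sup>2))"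
      by (intro mult_left_mono) auto
    also have "\<dots> = (s b * (\<kappa> * \<beta>))\<^sup>2"
      using bn by (simp add: \<kappa>_def \<beta>_def L2_set_def sum_nonneg power_mult_distrib power_divide)
    finally have "L2_set (\<lambda>i. s i ^ p * tail u i) {b..<n} \<le> sqrt ((s b * (\<kappa> * \<beta>))\<^sup>2)" unfolding L2_set_def by (rule real_sqrt_le_mono)
    then show ?thesis using sb \<kappa> ab by simp
  qed
  have "(vnorm (R *\<^sub>v y))\<^sup>2 \<le> (L2_set (\<lambda>i. s i * z $ i + - (s i ^ p * tail u i)) {b..<n})\<^sup>2"
    using residual_coords[OF z] unfolding Vz u_def[abs_def] by (simp add: L2_set_def sum_nonneg)
  then have "vnorm (R *\<^sub>v y) \<le> L2_set (\<lambda>i. s i * z $ i + - (s i ^ p * tail u i)) {b..<n}"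
    by (rule power2_le_imp_le) (rule L2_set_nonneg)
  also have "\<dots> \<le> L2_set (\<lambda>i. s i * z $ i) {b..<n} + L2_set (\<lambda>i. - (s i ^ p * tail u i)) {b..<n}"
    by (rule L2_set_triangle_ineq)
  also have "L2_set (\<lambda>i. - (s i ^ p * tail u i)) {b..<n} = L2_set (\<lambda>i. s i ^ p * tail u i) {b..<n}" by (simp add: L2_set_def)
  finally have "vnorm (R *\<^sub>v y) \<le> s b * (\<alpha> + \<kappa> * \<beta>)" using 1 2 by (simp add: distrib_left)
  also have "\<alpha> + \<kappa> * \<beta> \<le> sqrt (1 + \<kappa>\<^sup>2) * vnorm y"
  proof (rule power2_le_imp_le)
    \<comment> \<open>The Lagrange remainder in Cauchy-Schwarz for (1, \<kappa>) and (\<alpha>,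
      \<beta>).\<close>
    have "0 \<le> (\<beta> - \<kappa> * \<alpha>)\<^sup>2" by simp
    then have "(\<alpha> + \<kappa> * \<beta>)\<^sup>2 \<le> (1 + \<kappa>\<^sup>2) * (\<beta>\<^sup>2 + \<alpha>\<^sup>2)" by (simp add: power2_eq_square algebra_simps)
    then show "(\<alpha> + \<kappa> * \<beta>)\<^sup>2 \<le> (sqrt (1 + \<kappa>\<^sup>2) * vnorm y)\<^sup>2" by (simp add: power_mult_distrib n2)
  qed simp
  then have "s b * (\<alpha> + \<kappa> * \<beta>) \<le> s b * (sqrt (1 + \<kappa>\<^sup>2) * vnorm y)" using sb by (intro mult_left_mono)
  finally show "vnorm (R *\<^sub>v y) \<le> sqrt (1 + (\<sigma> (b+1) / \<sigma> b) ^ (4*q) * E\<^sup>2) * \<sigma> (b+1) * vnorm y"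
    by (simp add: \<kappa>_def power_mult_distrib power_mult[symmetric] mult.commute mult.left_commute)
qed

text \<open>\<open>F\<close> is tested on its own row r: coordinate \<open>i\<close> of F r is
  |r|^2, so |r|^4 <= E^2 |r|^2.\<close>

lemma F_row_le:
  assumes i: "i < n - b"
  shows "(\<Sum>j<b. (F $$ (i, j))\<^sup>2) \<le> E\<^sup>2"
proof -
  define r where "r = Matrix.row F i"
  have r: "r \<in> carrier_vec b" using F by (auto simp: r_def intro: carrier_vecI)
  have rs: "(vnorm r)\<^sup>2 = (\<Sum>j<b. (F $$ (i, j))\<^sup>2)" using vnorm_square[OF r] F i by (simp add: r_def)
  have Fr: "F *\<^sub>v r \<in> carrier_vec (n - b)" using F r by simp
  have "(F *\<^sub>v r) $ i = r \<bullet> r" using F i by (simp add: r_def)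
  then have "((vnorm r)\<^sup>2)\<^sup>2 = ((F *\<^sub>v r) $ i)\<^sup>2" by (simp add: vnorm_square_scalar)
  also have "\<dots> \<le> (\<Sum>i<n - b. ((F *\<^sub>v r) $ i)\<^sup>2)" using i by (intro member_le_sum) auto
  also have "\<dots> = (vnorm (F *\<^sub>v r))\<^sup>2" using vnorm_square[OF Fr] by simp
  also have "\<dots> \<le> (E * vnorm r)\<^sup>2" by (intro power_mono vnorm_le_spec_norm[OF F r]) simp
  finally have le: "(vnorm r)\<^sup>2 * (vnorm r)\<^sup>2 \<le> E\<^sup>2 * (vnorm r)\<^sup>2" by (simp add: power2_eq_square algebra_simps)
  have "(vnorm r)\<^sup>2 \<le> E\<^sup>2"
  proof (cases "vnorm r = 0")
    case False
    then have "0 < (vnorm r)\<^sup>2" by simp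
    from mult_right_le_imp_le[OF le this] show ?thesis .
  qed simp
  then show ?thesis unfolding rs .
qed

text \<open>The Frobenius norm is invariant under right multiplication by \<open>V\<close>. It can
  thus be summed over the right singular vectors of \<open>A\<close>, where
  \<open>residual_coords\<close> is explicit.\<close>

lemma frob_norm_square_columns:
  fixes M :: "real mat"
  assumes M: "M \<in> carrier_mat k n"
  shows "(frob_norm M)\<^sup>2 = (\<Sum>j<n. (vnorm (M *\<^sub>v (V *\<^sub>v unit_vec n j)))\<^sup>2)"
proof -
  have VT: "transpose_mat V \<in> carrier_mat n n" "transpose_mat (transpose_mat V) * transpose_mat V = 1\<^sub>m n"
    using V orthogonal_transpose[OF V] by auto
  have rowc: "Matrix.row M i \<in> carrier_vec n" for i using M by (auto intro: carrier_vecI)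
  have col: "V *\<^sub>v unit_vec n j = col V j" if "j < n" for j
    using V that by (intro eq_vecI) auto
  have "(frob_norm M)\<^sup>2 = (\<Sum>i<k. \<Sum>j<n. (M $$ (i, j))\<^sup>2)" using M by (simp add: frob_norm_def sum_nonneg)
  also have "\<dots> = (\<Sum>i<k. (vnorm (Matrix.row M i))\<^sup>2)"
    using M by (intro sum.cong refl) (simp add: vnorm_square[OF rowc])
  also have "\<dots> = (\<Sum>i<k. (vnorm (transpose_mat V *\<^sub>v Matrix.row M i))\<^sup>2)"
    using vnorm_isometry[OF VT rowc] by simp
  also have "\<dots> = (\<Sum>i<k. \<Sum>j<n. ((M *\<^sub>v col V j) $ i)\<^sup>2)"
  proof (intro sum.cong refl)
    fix i assume i: "i \<in> {..<k}"
    have c: "transpose_mat V *\<^sub>v Matrix.row M i \<in> carrier_vec n" using VT(1) rowc[of i] by simp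
    have "(transpose_mat V *\<^sub>v Matrix.row M i) $ j = (M *\<^sub>v col V j) $ i" if "j < n" for j
    proof -
      have "col V j \<bullet> Matrix.row M i = Matrix.row M i \<bullet> col V j"
        by (rule comm_scalar_prod[of _ n]) (use V rowc in auto)
      then show ?thesis using V M i that by simp
    qed
    then show "(vnorm (transpose_mat V *\<^sub>v Matrix.row M i))\<^sup>2 = (\<Sum>j<n. ((M *\<^sub>v col V j) $ i)\<^sup>2)"
      unfolding vnorm_square[OF c] by (intro sum.cong) auto
  qed
  also have "\<dots> = (\<Sum>j<n. \<Sum>i<k. ((M *\<^sub>v col V j) $ i)\<^sup>2)" by (rule sum.swap)
  also have "\<dots> = (\<Sum>j<n. (vnorm (M *\<^sub>v (V *\<^sub>v unit_vec n j)))\<^sup>2)"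
  proof (intro sum.cong refl)
    fix j assume j: "j \<in> {..<n}"
    have "M *\<^sub>v col V j \<in> carrier_vec k" by (rule mult_mat_vec_carrier[OF M]) (use V in \<open>auto intro: carrier_vecI\<close>)
    then show "(\<Sum>i<k. ((M *\<^sub>v col V j) $ i)\<^sup>2) = (vnorm (M *\<^sub>v (V *\<^sub>v unit_vec n j)))\<^sup>2"
      using j by (simp add: col vnorm_square[where n=k])
  qed
  finally show ?thesis .
qed

text \<open>A right singular vector with index j < b contributes at most \<kappa> (s i)^2 F_ij^2 in
  each coordinate i >= b; summing over j by \<open>F_row_le\<close> gives \<kappa> E^2 (s i)^2. An
  index j >= b contributes at most (s j)^2. Summing over rows of \<open>F\<close> first keeps its
  spectral norm in the result, where its Frobenius norm might be expected.\<close>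

lemma frob_norm_residual:
  "frob_norm R \<le> sqrt (1 + (\<sigma> (b+1) / \<sigma> b) ^ (4*q) * E\<^sup>2) * sqrt (\<Sum>i\<in>{b..<n}. (s i)\<^sup>2)"
proof (rule power2_le_imp_le)
  define \<kappa> where "\<kappa> = (\<sigma> (b+1) / \<sigma> b) ^ (4 * q)"
  have sb: "0 \<le> s b" using s_nonneg bn by simp
  have \<kappa>: "0 \<le> \<kappa>" using sb pos by (simp add: \<kappa>_def)
  have head: "(vnorm (R *\<^sub>v (V *\<^sub>v unit_vec n j)))\<^sup>2 \<le> (\<Sum>i\<in>{b..<n}. \<kappa> * ((s i)\<^sup>2 * (F $$ (i - b, j))\<^sup>2))" if j: "j < b" for j
  proof -
    have "(vnorm (R *\<^sub>v (V *\<^sub>v unit_vec n j)))\<^sup>2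
        \<le> (\<Sum>i\<in>{b..<n}. (s i * unit_vec n j $ i - s i ^ p * tail (\<lambda>l. unit_vec n j $ l / s l ^ (2 * q)) i)\<^sup>2)"
      by (rule residual_coords) simp
    also have "\<dots> \<le> (\<Sum>i\<in>{b..<n}. \<kappa> * ((s i)\<^sup>2 * (F $$ (i - b, j))\<^sup>2))"
    proof (intro sum_mono)
      fix i assume i: "i \<in> {b..<n}"
      have "tail (\<lambda>l. unit_vec n j $ l / s l ^ (2 * q)) i = (\<Sum>l<b. if j = l then F $$ (i - b, l) / s l ^ (2 * q) else 0)"
        unfolding tail_def using j bn by (intro sum.cong refl) (auto simp: unit_vec_def)
      also have "\<dots> = F $$ (i - b, j) / s j ^ (2 * q)" using j by simp
      finally have t: "tail (\<lambda>l. unit_vec n j $ l / s l ^ (2 * q)) i = F $$ (i - b, j) / s j ^ (2 * q)" .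
      have "s i ^ (2 * q) / s j ^ (2 * q) \<le> \<sigma> (b+1) ^ (2 * q) / \<sigma> b ^ (2 * q)"
      proof (rule frac_le)
        show "s i ^ (2 * q) \<le> \<sigma> (b+1) ^ (2 * q)" using i s_mono[of b i] s_nonneg[of i] by (intro power_mono) auto
        show "\<sigma> b ^ (2 * q) \<le> s j ^ (2 * q)" using mono[of "j + 1" b] j bn pos by (intro power_mono) auto
      qed (use sb pos in auto)
      moreover have "0 \<le> s i ^ (2 * q) / s j ^ (2 * q)" by (simp add: power_mult)
      ultimately have "(s i ^ (2 * q) / s j ^ (2 * q))\<^sup>2 \<le> (\<sigma> (b+1) ^ (2 * q) / \<sigma> b ^ (2 * q))\<^sup>2" by (rule power_mono)
      also have "\<dots> = \<kappa>" by (simp add: \<kappa>_def power_divide power_mult[symmetric] mult.commute)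
      finally have "(s i ^ (2 * q) / s j ^ (2 * q))\<^sup>2 * ((s i)\<^sup>2 * (F $$ (i - b, j))\<^sup>2) \<le> \<kappa> * ((s i)\<^sup>2 * (F $$ (i - b, j))\<^sup>2)"
        by (intro mult_right_mono) auto
      moreover have "(s i * unit_vec n j $ i - s i ^ p * tail (\<lambda>l. unit_vec n j $ l / s l ^ (2 * q)) i)\<^sup>2
          = (s i ^ (2 * q) / s j ^ (2 * q))\<^sup>2 * ((s i)\<^sup>2 * (F $$ (i - b, j))\<^sup>2)"
        unfolding t using i j bn by (simp add: unit_vec_def power_mult_distrib power_divide mult_ac)
      ultimately show "(s i * unit_vec n j $ i - s i ^ p * tail (\<lambda>l. unit_vec n j $ l / s l ^ (2 * q)) i)\<^sup>2
          \<le> \<kappa> * ((s i)\<^sup>2 * (F $$ (i - b, j))\<^sup>2)" by simp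
    qed
    finally show ?thesis .
  qed
  \<comment> \<open>The first \<open>b\<close> coordinates of the unit vector are 0, so the
    comparison vector on the graph is 0 and only the entry s j is left.\<close>
  have tl: "(vnorm (R *\<^sub>v (V *\<^sub>v unit_vec n j)))\<^sup>2 \<le> (s j)\<^sup>2" if j: "j \<in> {b..<n}" for j
  proof -
    have "(vnorm (R *\<^sub>v (V *\<^sub>v unit_vec n j)))\<^sup>2
        \<le> (\<Sum>i\<in>{b..<n}. (s i * unit_vec n j $ i - s i ^ p * tail (\<lambda>l. unit_vec n j $ l / s l ^ (2 * q)) i)\<^sup>2)"
      by (rule residual_coords) simp
    also have "\<dots> = (\<Sum>i\<in>{b..<n}. if j = i then (s i)\<^sup>2 else 0)"
    proof (intro sum.cong refl)
      fix i assume i: "i \<in> {b..<n}"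
      have "tail (\<lambda>l. unit_vec n j $ l / s l ^ (2 * q)) i = 0"
        unfolding tail_def using j by (intro sum.neutral) (auto simp: unit_vec_def)
      then show "(s i * unit_vec n j $ i - s i ^ p * tail (\<lambda>l. unit_vec n j $ l / s l ^ (2 * q)) i)\<^sup>2 = (if j = i then (s i)\<^sup>2 else 0)"
        using i by (auto simp: unit_vec_def)
    qed
    also have "\<dots> = (s j)\<^sup>2" using j by simp
    finally show ?thesis .
  qed
  have "(frob_norm R)\<^sup>2 = (\<Sum>j<b. (vnorm (R *\<^sub>v (V *\<^sub>v unit_vec n j)))\<^sup>2) + (\<Sum>j\<in>{b..<n}. (vnorm (R *\<^sub>v (V *\<^sub>v unit_vec n j)))\<^sup>2)"
    unfolding frob_norm_square_columns[OF R_carrier] using bn by (intro sum_split_lessThan) simp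
  also have "\<dots> \<le> (\<Sum>j<b. \<Sum>i\<in>{b..<n}. \<kappa> * ((s i)\<^sup>2 * (F $$ (i - b, j))\<^sup>2)) + (\<Sum>j\<in>{b..<n}. (s j)\<^sup>2)"
    by (intro add_mono sum_mono head tl) auto
  also have "(\<Sum>j<b. \<Sum>i\<in>{b..<n}. \<kappa> * ((s i)\<^sup>2 * (F $$ (i - b, j))\<^sup>2)) = (\<Sum>i\<in>{b..<n}. \<kappa> * ((s i)\<^sup>2 * (\<Sum>j<b. (F $$ (i - b, j))\<^sup>2)))"
    by (subst sum.swap) (simp add: sum_distrib_left)
  also have "\<dots> \<le> (\<Sum>i\<in>{b..<n}. \<kappa> * ((s i)\<^sup>2 * E\<^sup>2))"
    using \<kappa> by (intro sum_mono mult_left_mono F_row_le) auto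
  also have "(\<Sum>i\<in>{b..<n}. \<kappa> * ((s i)\<^sup>2 * E\<^sup>2)) + (\<Sum>j\<in>{b..<n}. (s j)\<^sup>2) = (1 + \<kappa> * E\<^sup>2) * (\<Sum>i\<in>{b..<n}. (s i)\<^sup>2)"
    by (simp add: sum_distrib_left sum.distrib[symmetric] algebra_simps)
  also have "\<dots> = (sqrt (1 + \<kappa> * E\<^sup>2) * sqrt (\<Sum>i\<in>{b..<n}. (s i)\<^sup>2))\<^sup>2"
    using \<kappa> by (simp add: power_mult_distrib sum_nonneg)
  finally show "(frob_norm R)\<^sup>2 \<le> (sqrt (1 + (\<sigma> (b+1) / \<sigma> b) ^ (4*q) * E\<^sup>2) * sqrt (\<Sum>i\<in>{b..<n}. (s i)\<^sup>2))\<^sup>2"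
    by (simp add: \<kappa>_def)
  show "0 \<le> sqrt (1 + (\<sigma> (b+1) / \<sigma> b) ^ (4*q) * E\<^sup>2) * sqrt (\<Sum>i\<in>{b..<n}. (s i)\<^sup>2)"
    using \<kappa> by (simp add: \<kappa>_def sum_nonneg)
qed

text \<open>A vector v = Q Q^T y lies on the graph and |v| <= |y|. As t >= b, the coordinates beyond
  t belong to the lower block, where \<Sigma>_2^p F \<Sigma>_1^-p stretches the first
  \<open>b\<close> coordinates, no longer than v, by at most (s t / \<sigma> b)^p * E.\<close>

lemma deviation_bound:
  assumes t: "b \<le> t" "t < n"
  shows "deviation Q (sub_mat U 0 m 0 t) \<le> (\<sigma> (t+1) / \<sigma> b) ^ p * E"
proof -
  define Z where "Z = sub_mat U 0 m 0 t"
  have Z: "Z \<in> carrier_mat m t" by (simp add: Z_def sub_mat_def)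
  have tm: "t \<le> m" using t mn by simp
  have st: "0 \<le> s t" using s_nonneg t by simp
  have QQ: "Q * transpose_mat Q \<in> carrier_mat m m" using Q by simp
  have P: "1\<^sub>m m - Z * transpose_mat Z \<in> carrier_mat m m" using Z by auto
  have M: "(1\<^sub>m m - Z * transpose_mat Z) * (Q * transpose_mat Q) \<in> carrier_mat m m"
    by (rule mult_carrier_mat[OF P QQ])
  have "spec_norm ((1\<^sub>m m - Z * transpose_mat Z) * (Q * transpose_mat Q)) \<le> (\<sigma> (t+1) / \<sigma> b) ^ p * E"
  proof (rule spec_norm_le[OF M])
    show "0 \<le> (\<sigma> (t+1) / \<sigma> b) ^ p * E" using st pos E_nonneg by simp
    fix y :: "real Matrix.vec" assume y: "y \<in> carrier_vec m"
    define v where "v = Q *\<^sub>v (transpose_mat Q *\<^sub>v y)"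
    have Qy: "transpose_mat Q *\<^sub>v y \<in> carrier_vec b" using Q y by simp
    have v: "v \<in> carrier_vec m" using Q Qy by (simp add: v_def)
    have vy: "vnorm v \<le> vnorm y" unfolding v_def by (rule vnorm_minus_proj(2)[OF Q y])
    obtain x where x: "x \<in> carrier_vec b" "v = U *\<^sub>v graph_vec x"
      using range_in_graph[OF Qy] by (auto simp: v_def)
    define c where "c = graph_vec x"
    have c: "c \<in> carrier_vec m" by (simp add: c_def graph_vec_carrier)
    have "((1\<^sub>m m - Z * transpose_mat Z) * (Q * transpose_mat Q)) *\<^sub>v y = (1\<^sub>m m - Z * transpose_mat Z) *\<^sub>v v"
      using assoc_mult_mat_vec[OF P QQ y] assoc_mult_mat_vec[of Q m b "transpose_mat Q" m y] Q y by (simp add: v_def)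
    also have "\<dots> = v - Z *\<^sub>v (transpose_mat Z *\<^sub>v v)" by (rule proj_mult_vec[OF Z v])
    also have "\<dots> = U *\<^sub>v Matrix.vec m (\<lambda>i. if i < t then 0 else c $ i)"
    proof -
      have "(transpose_mat Z *\<^sub>v v) $ i = c $ i" if "i < t" for i
      proof -
        have "col Z i = col U i" using that tm U by (intro eq_vecI) (auto simp: Z_def sub_mat_def)
        then have "(transpose_mat Z *\<^sub>v v) $ i = (transpose_mat U *\<^sub>v v) $ i" using that tm Z U by simp
        also have "transpose_mat U *\<^sub>v v = c" unfolding x(2) c_def[symmetric] by (rule transpose_mult_isometry[OF U c])
        finally show ?thesis .
      qed
      then have Zv: "transpose_mat Z *\<^sub>v v = Matrix.vec t (\<lambda>i. c $ i)" using Z by (intro eq_vecI) auto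
      have ZU: "Z *\<^sub>v Matrix.vec t (\<lambda>i. c $ i) = U *\<^sub>v Matrix.vec m (\<lambda>i. if i < t then c $ i else 0)"
      proof (rule eq_vecI)
        fix i assume "i < dim_vec (U *\<^sub>v Matrix.vec m (\<lambda>i. if i < t then c $ i else 0))"
        then have i: "i < m" using U by simp
        have "(U *\<^sub>v Matrix.vec m (\<lambda>i. if i < t then c $ i else 0)) $ i = (\<Sum>j<m. U $$ (i, j) * (if j < t then c $ j else 0))"
          using i U by (simp add: scalar_prod_def lessThan_atLeast0)
        also have "\<dots> = (\<Sum>j<t. U $$ (i, j) * c $ j)"
          using tm by (intro sum.mono_neutral_cong_right) auto
        also have "\<dots> = (Z *\<^sub>v Matrix.vec t (\<lambda>i. c $ i)) $ i"
          using i by (simp add: scalar_prod_def lessThan_atLeast0 Z_def sub_mat_def)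
        finally show "(Z *\<^sub>v Matrix.vec t (\<lambda>i. c $ i)) $ i = (U *\<^sub>v Matrix.vec m (\<lambda>i. if i < t then c $ i else 0)) $ i" ..
      qed (use Z U in simp)
      have "v - Z *\<^sub>v (transpose_mat Z *\<^sub>v v) = U *\<^sub>v (c - Matrix.vec m (\<lambda>i. if i < t then c $ i else 0))"
        unfolding Zv ZU unfolding x(2) c_def[symmetric] using mult_minus_distrib_mat_vec[OF U(1) c] by simp
      also have "c - Matrix.vec m (\<lambda>i. if i < t then c $ i else 0) = Matrix.vec m (\<lambda>i. if i < t then 0 else c $ i)"
        using c by (intro eq_vecI) auto
      finally show ?thesis .
    qed
    finally have "(vnorm (((1\<^sub>m m - Z * transpose_mat Z) * (Q * transpose_mat Q)) *\<^sub>v y))\<^sup>2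
        = (\<Sum>i<m. (if i < t then 0 else c $ i)\<^sup>2)"
      using vnorm_isometry[OF U, of "Matrix.vec m (\<lambda>i. if i < t then 0 else c $ i)"]
        vnorm_square[of "Matrix.vec m (\<lambda>i. if i < t then 0 else c $ i)" m] by simp
    also have "\<dots> = (\<Sum>i\<in>{t..<n}. (s i ^ p * tail (scaled x) i)\<^sup>2)"
      using t mn by (intro sum.mono_neutral_cong_right) (auto simp: c_def graph_vec_def)
    also have "\<dots> \<le> (s t ^ p)\<^sup>2 * (E\<^sup>2 * (\<Sum>j<b. (scaled x j)\<^sup>2))" by (rule tail_weighted[OF t])
    also have "\<dots> \<le> (s t ^ p)\<^sup>2 * (E\<^sup>2 * ((vnorm y)\<^sup>2 / (\<sigma> b ^ p)\<^sup>2))"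
    proof (intro mult_left_mono)
      have "(\<Sum>j<b. (scaled x j)\<^sup>2) \<le> (\<Sum>j<b. (x $ j)\<^sup>2) / (s (b - 1) ^ p)\<^sup>2"
        unfolding scaled_def by (rule scaled_sum_le) (use bn in auto)
      also have "\<dots> \<le> (vnorm y)\<^sup>2 / (s (b - 1) ^ p)\<^sup>2"
      proof (intro divide_right_mono)
        have "(\<Sum>j<b. (x $ j)\<^sup>2) \<le> (vnorm v)\<^sup>2" unfolding x(2) vnorm_graph_vec[OF x(1)] by (simp add: sum_nonneg)
        also have "\<dots> \<le> (vnorm y)\<^sup>2" using vy by (intro power_mono) auto
        finally show "(\<Sum>j<b. (x $ j)\<^sup>2) \<le> (vnorm y)\<^sup>2" .
      qed simp
      finally show "(\<Sum>j<b. (scaled x j)\<^sup>2) \<le> (vnorm y)\<^sup>2 / (\<sigma> b ^ p)\<^sup>2" using bn by simp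
    qed auto
    also have "\<dots> = ((\<sigma> (t+1) / \<sigma> b) ^ p * E * vnorm y)\<^sup>2"
      by (simp add: power_mult_distrib power_divide)
    finally show "vnorm (((1\<^sub>m m - Z * transpose_mat Z) * (Q * transpose_mat Q)) *\<^sub>v y) \<le> (\<sigma> (t+1) / \<sigma> b) ^ p * E * vnorm y"
      by (rule power2_le_imp_le) (use st pos E_nonneg in simp)
  qed
  then show ?thesis using Z by (simp add: deviation_def Z_def[symmetric])
qed

text \<open>Courant--Fischer, with the diagonal form of \<open>Q\<^sup>T A A\<^sup>T Q\<close> and the singular vectors of \<open>A\<close> as test spaces.\<close>
lemma sing_val_bounds:
  fixes ev :: "nat \<Rightarrow> real"
  assumes diag: "(transpose_mat Q * A) * transpose_mat (transpose_mat Q * A) = mat b b (\<lambda>(i, j). if i = j then ev i else 0)"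
    and ev: "\<And>i j. i \<le> j \<Longrightarrow> j < b \<Longrightarrow> ev j \<le> ev i"
    and j: "1 \<le> j" "j \<le> b"
  shows "sing_val (transpose_mat Q * A) j \<le> \<sigma> j"
    "\<sigma> j / sqrt (1 + (\<sigma> (b+1) / \<sigma> j) ^ (4*q+2) * E\<^sup>2) \<le> sing_val (transpose_mat Q * A) j"
proof -
  define B where "B = transpose_mat Q * A"
  have B: "B \<in> carrier_mat b n" unfolding B_def by (rule mult_carrier_mat[of _ b m]) (use Q A_carrier in auto)
  have BT: "transpose_mat B \<in> carrier_mat n b" using B by simp
  have BTz: "transpose_mat B *\<^sub>v z = transpose_mat A *\<^sub>v (Q *\<^sub>v z)" if z: "z \<in> carrier_vec b" for z
  proof -
    have "transpose_mat B = transpose_mat A * Q"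
      unfolding B_def using transpose_mult[of "transpose_mat Q" b m A n] Q A_carrier by simp
    then show ?thesis using assoc_mult_mat_vec[of "transpose_mat A" n m Q b z] Q A_carrier z by simp
  qed
  have quad: "(vnorm (transpose_mat A *\<^sub>v (Q *\<^sub>v z)))\<^sup>2 = (\<Sum>i<b. ev i * (z $ i)\<^sup>2)" if z: "z \<in> carrier_vec b" for z
  proof -
    have "(vnorm (transpose_mat B *\<^sub>v z))\<^sup>2 = (transpose_mat B *\<^sub>v z) \<bullet> (transpose_mat B *\<^sub>v z)" by (rule vnorm_square_scalar)
    also have "\<dots> = z \<bullet> (B *\<^sub>v (transpose_mat B *\<^sub>v z))"
      by (rule scalar_prod_mult_mat_vec[OF B z, symmetric]) (use B z in simp)
    also have "B *\<^sub>v (transpose_mat B *\<^sub>v z) = (B * transpose_mat B) *\<^sub>v z"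
      using assoc_mult_mat_vec[OF B BT z] by simp
    also have "\<dots> = Matrix.vec b (\<lambda>i. if i < b then ev i * z $ i else 0)"
      unfolding B_def diag by (rule rect_diag_mult_vec[OF z])
    also have "z \<bullet> \<dots> = (\<Sum>i<b. ev i * (z $ i)\<^sup>2)"
      using z by (simp add: scalar_prod_def lessThan_atLeast0 power2_eq_square mult_ac)
    finally show ?thesis using BTz[OF z] by simp
  qed
  \<comment> \<open>The eigenvalue hypothesis gives the order only; the sign comes from evaluating
    the quadratic form at a unit vector.\<close>
  have ev0: "0 \<le> ev i" if i: "i < b" for i
  proof -
    have u: "unit_vec b i \<in> carrier_vec b" by simp
    have "(\<Sum>l<b. ev l * (unit_vec b i $ l)\<^sup>2) = (\<Sum>l<b. if i = l then ev l else 0)"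
      by (intro sum.cong) (auto simp: unit_vec_def)
    also have "\<dots> = ev i" using i by simp
    finally have "ev i = (vnorm (transpose_mat A *\<^sub>v (Q *\<^sub>v unit_vec b i)))\<^sup>2" using quad[OF u] by simp
    then show ?thesis by simp
  qed
  define l where "l = j - 1"
  have l: "l < b" "s l = \<sigma> j" "l < n" "j = l + 1" using j bn by (auto simp: l_def)
  have sv: "sing_val (transpose_mat Q * A) j = sqrt (ev l)"
    unfolding l_def B_def[symmetric] by (rule sing_val_diag[OF B]) (use bn diag ev ev0 j in \<open>auto simp: B_def\<close>)
  have sl: "s l > 0" using s_pos l by simp
  show "sing_val (transpose_mat Q * A) j \<le> \<sigma> j"
  proof -
    \<comment> \<open>\<open>l = j - 1\<close> equations in \<open>j\<close> unknowns. The vector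
      \<open>z\<close> lies in the span of the first \<open>j\<close> eigenvectors of the diagonal
      form, where the form is at least ev l * |z|^2, while Q z is orthogonal to the first
      \<open>l\<close> columns of \<open>U\<close>, which leaves only singular values at most
      \<open>s l\<close>.\<close>
    obtain v where v: "v \<in> carrier_vec j" "v \<noteq> 0\<^sub>v j" "\<And>i. i < l \<Longrightarrow> (\<Sum>k<j. (transpose_mat U * Q) $$ (i, k) * v $ k) = 0"
      using underdetermined_nontrivial_solution[of l j "\<lambda>i k. (transpose_mat U * Q) $$ (i, k)"] l by auto
    define z where "z = Matrix.vec b (\<lambda>k. if k < j then v $ k else 0)"
    have z: "z \<in> carrier_vec b" by (simp add: z_def)
    have Qz: "Q *\<^sub>v z \<in> carrier_vec m" using Q z by simp
    have zsum: "(\<Sum>k<b. (z $ k)\<^sup>2) = (\<Sum>k<j. (v $ k)\<^sup>2)"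
      using j by (intro sum.mono_neutral_cong_right) (auto simp: z_def)
    then have zn: "(vnorm z)\<^sup>2 = (vnorm v)\<^sup>2" using vnorm_square[OF z] vnorm_square[OF v(1)] by simp
    have zpos: "(vnorm z)\<^sup>2 > 0" unfolding zn using vnorm_pos[OF v(1,2)] by simp
    define c where "c = transpose_mat U *\<^sub>v (Q *\<^sub>v z)"
    have c: "c \<in> carrier_vec m" using U Qz by (simp add: c_def)
    have Uc: "U *\<^sub>v c = Q *\<^sub>v z" unfolding c_def
      using assoc_mult_mat_vec[of U m m "transpose_mat U" m "Q *\<^sub>v z"] orthogonal_transpose[OF U] U Qz by simp
    have c0: "c $ i = 0" if "i < l" for i
    proof -
      have UQ: "transpose_mat U * Q \<in> carrier_mat m b" using U Q by simp
      have "c = (transpose_mat U * Q) *\<^sub>v z" unfolding c_def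
        using assoc_mult_mat_vec[of "transpose_mat U" m m Q b z] U Q z by simp
      then have "c $ i = (\<Sum>k<b. (transpose_mat U * Q) $$ (i, k) * z $ k)"
        using mult_mat_vec_index[OF UQ z, of i] that l mn by simp
      also have "\<dots> = (\<Sum>k<j. (transpose_mat U * Q) $$ (i, k) * v $ k)"
        using j by (intro sum.mono_neutral_cong_right) (auto simp: z_def)
      finally show ?thesis using v(3)[OF that] by simp
    qed
    have "ev l * (vnorm z)\<^sup>2 = (\<Sum>i<b. ev l * (z $ i)\<^sup>2)" unfolding vnorm_square[OF z] by (simp add: sum_distrib_left)
    also have "\<dots> \<le> (\<Sum>i<b. ev i * (z $ i)\<^sup>2)"
    proof (intro sum_mono)
      fix i assume i: "i \<in> {..<b}"
      show "ev l * (z $ i)\<^sup>2 \<le> ev i * (z $ i)\<^sup>2"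
      proof (cases "i \<le> l")
        case True
        then show ?thesis using ev[OF True l(1)] by (intro mult_right_mono) auto
      next
        case False
        then show ?thesis using i l by (simp add: z_def)
      qed
    qed
    also have "\<dots> = (\<Sum>i<n. (s i * c $ i)\<^sup>2)" using quad[OF z] transpose_A_mult[OF c] by (simp add: Uc)
    also have "\<dots> \<le> (\<Sum>i<n. (s l)\<^sup>2 * (c $ i)\<^sup>2)"
    proof (intro sum_mono)
      fix i assume i: "i \<in> {..<n}"
      show "(s i * c $ i)\<^sup>2 \<le> (s l)\<^sup>2 * (c $ i)\<^sup>2"
      proof (cases "i < l")
        case True
        then show ?thesis using c0 by simp
      next
        case False
        then have "(s i)\<^sup>2 \<le> (s l)\<^sup>2" using i s_mono[of l i] s_nonneg[of i] by (intro power_mono) auto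
        then show ?thesis unfolding power_mult_distrib by (intro mult_right_mono) auto
      qed
    qed
    also have "\<dots> \<le> (\<Sum>i<m. (s l)\<^sup>2 * (c $ i)\<^sup>2)" using mn by (intro sum_mono2) auto
    also have "\<dots> = (s l)\<^sup>2 * (vnorm c)\<^sup>2" unfolding vnorm_square[OF c] by (simp add: sum_distrib_left)
    also have "vnorm c = vnorm z" using vnorm_isometry[OF U c] vnorm_isometry[OF Q z] by (simp add: Uc)
    finally have "ev l \<le> (s l)\<^sup>2" using zpos by (rule mult_right_le_imp_le)
    then have "sqrt (ev l) \<le> sqrt ((s l)\<^sup>2)" by (rule real_sqrt_le_mono)
    then show ?thesis using sl unfolding sv l(2) by simp
  qed
  show "\<sigma> j / sqrt (1 + (\<sigma> (b+1) / \<sigma> j) ^ (4*q+2) * E\<^sup>2) \<le> sing_val (transpose_mat Q * A) j"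
  proof -
    define G where "G k = transpose_mat Q *\<^sub>v (U *\<^sub>v graph_vec (unit_vec b k))" for k
    define \<kappa> where "\<kappa> = (\<sigma> (b+1) / \<sigma> j) ^ (4*q+2) * E\<^sup>2"
    \<comment> \<open>The same count on the graph side: \<open>x\<close> is supported on the first
      \<open>j\<close> coordinates, and z = Q^T U graph_vec x has no component along the first
      \<open>l\<close> eigenvectors, so the quadratic form at \<open>z\<close> is at most ev l *
      |z|^2.\<close>
    obtain v where v: "v \<in> carrier_vec j" "v \<noteq> 0\<^sub>v j" "\<And>i. i < l \<Longrightarrow> (\<Sum>k<j. G k $ i * v $ k) = 0"
      using underdetermined_nontrivial_solution[of l j "\<lambda>i k. G k $ i"] l by auto
    define x where "x = Matrix.vec b (\<lambda>k. if k < j then v $ k else 0)"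
    have x: "x \<in> carrier_vec b" by (simp add: x_def)
    obtain z where z: "z \<in> carrier_vec b" "U *\<^sub>v graph_vec x = Q *\<^sub>v z" using graph_in_range[OF x] by auto
    have zG: "z = transpose_mat Q *\<^sub>v (U *\<^sub>v graph_vec x)" unfolding z(2) by (rule transpose_mult_isometry[OF Q z(1), symmetric])
    have z0: "z $ i = 0" if i: "i < l" for i
    proof -
      have QU: "transpose_mat Q * U \<in> carrier_mat b m" using Q U by simp
      have lin: "(transpose_mat Q *\<^sub>v (U *\<^sub>v graph_vec w)) $ i = (\<Sum>r<m. (transpose_mat Q * U) $$ (i, r) * graph_vec w $ r)" for w
      proof -
        have "transpose_mat Q *\<^sub>v (U *\<^sub>v graph_vec w) = (transpose_mat Q * U) *\<^sub>v graph_vec w"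
          using assoc_mult_mat_vec[of "transpose_mat Q" b m U m "graph_vec w"] Q U graph_vec_carrier by simp
        then show ?thesis using mult_mat_vec_index[OF QU graph_vec_carrier[of w], of i] i l by simp
      qed
      \<comment> \<open>\<open>graph_vec\<close> is linear, so the conditions imposed on the images
        \<open>G k\<close> of the unit vectors carry over to \<open>x\<close>.\<close>
      have gx: "graph_vec x $ r = (\<Sum>k<b. x $ k * graph_vec (unit_vec b k) $ r)" if r: "r < m" for r
      proof -
        have tu: "tail (scaled (unit_vec b k)) r = F $$ (r - b, k) / s k ^ p" if k: "k < b" for k
        proof -
          have "tail (scaled (unit_vec b k)) r = (\<Sum>i<b. if k = i then F $$ (r - b, i) / s i ^ p else 0)"
            unfolding tail_def scaled_def by (intro sum.cong refl) (auto simp: unit_vec_def)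
          then show ?thesis using k by simp
        qed
        consider "r < b" | "b \<le> r" "r < n" | "n \<le> r" by linarith
        then show ?thesis
        proof cases
          case 1
          have "(\<Sum>k<b. x $ k * graph_vec (unit_vec b k) $ r) = (\<Sum>k<b. if r = k then x $ k else 0)"
            using 1 r by (intro sum.cong refl) (auto simp: graph_vec_def unit_vec_def)
          then show ?thesis using 1 r by (simp add: graph_vec_def)
        next
          case 2
          have "(\<Sum>k<b. x $ k * graph_vec (unit_vec b k) $ r) = (\<Sum>k<b. s r ^ p * (F $$ (r - b, k) * scaled x k))"
            using 2 r by (intro sum.cong refl) (simp add: graph_vec_def tu scaled_def)
          then show ?thesis using 2 r by (simp add: graph_vec_def tail_def sum_distrib_left)
        next
          case 3
          then show ?thesis using r bn by (simp add: graph_vec_def)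
        qed
      qed
      have "z $ i = (\<Sum>r<m. (transpose_mat Q * U) $$ (i, r) * (\<Sum>k<b. x $ k * graph_vec (unit_vec b k) $ r))"
        unfolding zG lin by (intro sum.cong refl) (simp add: gx)
      also have "\<dots> = (\<Sum>k<b. \<Sum>r<m. x $ k * ((transpose_mat Q * U) $$ (i, r) * graph_vec (unit_vec b k) $ r))"
        unfolding sum_distrib_left by (subst sum.swap) (simp add: mult_ac)
      also have "\<dots> = (\<Sum>k<b. G k $ i * x $ k)"
        unfolding G_def lin by (simp add: sum_distrib_left[symmetric] mult.commute)
      also have "\<dots> = (\<Sum>k<j. G k $ i * v $ k)"
        using j by (intro sum.mono_neutral_cong_right) (auto simp: x_def)
      finally show ?thesis using v(3)[OF i] by simp
    qed
    have \<kappa>: "0 \<le> \<kappa>" using sl s_nonneg[of b] bn by (simp add: \<kappa>_def l(2)[symmetric])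
    \<comment> \<open>Numerator and denominator of the Rayleigh quotient are both compared with
      \<open>S\<close>, the squared norm of \<Sigma>_1 x. It bounds the quadratic form from below,
      by dropping the lower block. Since \<open>x\<close> is supported up to \<open>l\<close>, it
      also bounds the squared norm of the graph vector by S / (s l)^2 * (1 + \<kappa>).\<close>
    define S where "S = (\<Sum>k<b. (s k * x $ k)\<^sup>2)"
    have S: "S > 0"
    proof -
      obtain k where k: "k < j" "v $ k \<noteq> 0" using v(1,2) by (metis carrier_vecD eq_vecI index_zero_vec(1) index_zero_vec(2))
      then have "0 < (s k * x $ k)\<^sup>2" using s_pos[of k] j by (simp add: x_def)
      also have "\<dots> \<le> S" unfolding S_def by (rule member_le_sum) (use k j in auto)
      finally show ?thesis .
    qed
    have "(\<Sum>i<b. (s i * graph_vec x $ i)\<^sup>2) = S" unfolding S_def using bn mn by (intro sum.cong refl) (simp add: graph_vec_def)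
    moreover have "(\<Sum>i<b. (s i * graph_vec x $ i)\<^sup>2) \<le> (\<Sum>i<n. (s i * graph_vec x $ i)\<^sup>2)" using bn by (intro sum_mono2) auto
    ultimately have "S \<le> (\<Sum>i<n. (s i * graph_vec x $ i)\<^sup>2)" by simp
    also have "\<dots> = (\<Sum>i<b. ev i * (z $ i)\<^sup>2)" using transpose_A_mult[OF graph_vec_carrier[of x]] quad[OF z(1)] z(2) by simp
    also have "\<dots> \<le> (\<Sum>i<b. ev l * (z $ i)\<^sup>2)"
    proof (intro sum_mono)
      fix i assume i: "i \<in> {..<b}"
      show "ev i * (z $ i)\<^sup>2 \<le> ev l * (z $ i)\<^sup>2"
        using i z0[of i] ev[of l i] by (cases "i < l") (auto intro!: mult_right_mono)
    qed
    also have "\<dots> = ev l * (vnorm (U *\<^sub>v graph_vec x))\<^sup>2"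
      using vnorm_isometry[OF Q z(1)] vnorm_square[OF z(1)] by (simp add: sum_distrib_left z(2))
    also have "\<dots> \<le> ev l * (S / (s l)\<^sup>2 * (1 + \<kappa>))"
    proof (intro mult_left_mono ev0 l(1))
      have sup: "s k * x $ k = 0" if "l < k" "k < b" for k using that l by (simp add: x_def)
      have 1: "(\<Sum>k<b. (x $ k)\<^sup>2) \<le> S / (s l)\<^sup>2"
      proof -
        have "(\<Sum>k<b. (x $ k)\<^sup>2) = (\<Sum>k<b. (s k * x $ k / s k ^ 1)\<^sup>2)"
          using s_pos by (intro sum.cong refl) (auto simp: less_imp_neq[THEN not_sym])
        also have "\<dots> \<le> S / (s l ^ 1)\<^sup>2" unfolding S_def by (rule scaled_sum_le[OF l(1) sup])
        finally show ?thesis by simp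
      qed
      have "(\<Sum>i\<in>{b..<n}. (s i ^ p * tail (scaled x) i)\<^sup>2) \<le> (s b ^ p)\<^sup>2 * (E\<^sup>2 * (\<Sum>j<b. (scaled x j)\<^sup>2))"
        by (rule tail_weighted) (use bn in auto)
      also have "\<dots> \<le> (s b ^ p)\<^sup>2 * (E\<^sup>2 * (S / (s l ^ (p + 1))\<^sup>2))"
      proof (intro mult_left_mono)
        have "(\<Sum>k<b. (scaled x k)\<^sup>2) = (\<Sum>k<b. (s k * x $ k / s k ^ (p + 1))\<^sup>2)"
          unfolding scaled_def using s_pos by (intro sum.cong refl) (auto simp: less_imp_neq[THEN not_sym])
        also have "\<dots> \<le> S / (s l ^ (p + 1))\<^sup>2" unfolding S_def by (rule scaled_sum_le[OF l(1) sup])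
        finally show "(\<Sum>k<b. (scaled x k)\<^sup>2) \<le> S / (s l ^ (p + 1))\<^sup>2" .
      qed auto
      also have "\<dots> = S / (s l)\<^sup>2 * \<kappa>"
      proof -
        have "p * 2 = 4*q+2" by simp
        then have "(s b ^ p)\<^sup>2 = s b ^ (4*q+2)" "(s l ^ p)\<^sup>2 = s l ^ (4*q+2)" unfolding power_mult[symmetric] by metis+
        then show ?thesis using l(2) by (simp add: \<kappa>_def power_divide power_mult_distrib)
      qed
      finally show "(vnorm (U *\<^sub>v graph_vec x))\<^sup>2 \<le> S / (s l)\<^sup>2 * (1 + \<kappa>)"
        unfolding vnorm_graph_vec[OF x] using 1 by (simp add: distrib_left)
    qed
    finally have "S * 1 \<le> S * (ev l * (1 + \<kappa>) / (s l)\<^sup>2)" by (simp add: mult_ac)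
    then have "1 \<le> ev l * (1 + \<kappa>) / (s l)\<^sup>2" using S by (rule mult_left_le_imp_le)
    then have "(s l)\<^sup>2 / (1 + \<kappa>) \<le> ev l" using sl \<kappa> by (simp add: field_simps)
    then have "sqrt ((s l)\<^sup>2 / (1 + \<kappa>)) \<le> sqrt (ev l)" by (rule real_sqrt_le_mono)
    then show ?thesis unfolding sv using sl by (simp add: real_sqrt_divide \<kappa>_def l(2)[symmetric])
  qed
qed

end

text \<open>The product equals Uh^T (Qh^T A A^T Qh) Uh, which is diagonal because the columns of
  \<open>Uh\<close> are orthonormal eigenvectors. In this form the eigenvector hypothesis enters
  \<open>sing_val_bounds\<close>.\<close>

lemma diag_of_eigenvectors:
  fixes ev :: "nat \<Rightarrow> real"
  assumes Qh: "Qh \<in> carrier_mat m b" and A: "A \<in> carrier_mat m n" and Uh: "Uh \<in> carrier_mat b b" "transpose_mat Uh * Uh = 1\<^sub>m b"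
    and ev: "\<And>i. i < b \<Longrightarrow> (transpose_mat Qh * A * transpose_mat A * Qh) *\<^sub>v col Uh i = ev i \<cdot>\<^sub>v col Uh i"
  shows "(transpose_mat (Qh * Uh) * A) * transpose_mat (transpose_mat (Qh * Uh) * A) = mat b b (\<lambda>(i, j). if i = j then ev i else 0)"
proof -
  define N where "N = transpose_mat Qh * A * transpose_mat A * Qh"
  define C where "C = transpose_mat Qh * A"
  have C: "C \<in> carrier_mat b n" unfolding C_def by (rule mult_carrier_mat[of _ b m]) (use Qh A in auto)
  have CT: "transpose_mat C = transpose_mat A * Qh" unfolding C_def using transpose_mult[of "transpose_mat Qh" b m A n] Qh A by simp
  have NC: "N = C * transpose_mat C" unfolding CT unfolding N_def C_def[symmetric]
    by (rule assoc_mult_mat[of _ b n _ m]) (use C A Qh in auto)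
  have N: "N \<in> carrier_mat b b" unfolding NC using C by simp
  have "transpose_mat (Qh * Uh) * A = transpose_mat Uh * C"
    unfolding C_def using transpose_mult[OF Qh Uh(1)] assoc_mult_mat[of "transpose_mat Uh" b b "transpose_mat Qh" m A n] Qh Uh A by simp
  moreover have "transpose_mat (transpose_mat Uh * C) = transpose_mat C * Uh"
    using transpose_mult[of "transpose_mat Uh" b b C n] Uh C by simp
  ultimately have "(transpose_mat (Qh * Uh) * A) * transpose_mat (transpose_mat (Qh * Uh) * A) = (transpose_mat Uh * C) * (transpose_mat C * Uh)" by simp
  also have "\<dots> = transpose_mat Uh * (C * (transpose_mat C * Uh))"
    by (rule assoc_mult_mat[of _ b b _ n _ b]) (use C Uh in auto)
  also have "C * (transpose_mat C * Uh) = N * Uh"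
    unfolding NC by (rule assoc_mult_mat[symmetric, of _ b n _ b _ b]) (use C Uh in auto)
  also have "transpose_mat Uh * (N * Uh) = mat b b (\<lambda>(i, j). if i = j then ev i else 0)"
  proof (rule eq_matI)
    fix i j assume "i < dim_row (mat b b (\<lambda>(i, j). if i = j then ev i else 0))" "j < dim_col (mat b b (\<lambda>(i, j). if i = j then ev i else 0))"
    then have ij: "i < b" "j < b" by auto
    have "(transpose_mat Uh * (N * Uh)) $$ (i, j) = col Uh i \<bullet> col (N * Uh) j" using ij Uh N by simp
    also have "col (N * Uh) j = N *\<^sub>v col Uh j" using ij Uh N by (intro eq_vecI) auto
    also have "\<dots> = ev j \<cdot>\<^sub>v col Uh j" using ev[OF ij(2)] by (simp add: N_def)
    also have "col Uh i \<bullet> (ev j \<cdot>\<^sub>v col Uh j) = ev j * (col Uh i \<bullet> col Uh j)"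
      using Uh by simp
    also have "col Uh i \<bullet> col Uh j = (transpose_mat Uh * Uh) $$ (i, j)" using ij Uh(1) by simp
    also have "\<dots> = (if i = j then 1 else 0)" unfolding Uh(2) using ij by simp
    finally show "(transpose_mat Uh * (N * Uh)) $$ (i, j) = mat b b (\<lambda>(i, j). if i = j then ev i else 0) $$ (i, j)" using ij by simp
  qed (use Uh N in auto)
  finally show ?thesis .
qed

text \<open>The residual bound is proved with the factor \<sigma> (b+1); this inequality, tested on
  the first unit vector, replaces it by the norm of the trailing block.\<close>

lemma spec_norm_rect_diag_ge:
  fixes f :: "nat \<Rightarrow> real"
  assumes "0 < r" "0 < c" "f 0 \<ge> 0"
  shows "f 0 \<le> spec_norm (mat r c (\<lambda>(i, j). if i = j then f i else 0))"
proof -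
  let ?M = "mat r c (\<lambda>(i, j). if i = j then f i else 0)"
  have u: "unit_vec c 0 \<in> carrier_vec c" by simp
  have un: "vnorm (unit_vec k 0) = 1" if "k > 0" for k using that by (simp add: vnorm_def)
  have "?M *\<^sub>v unit_vec c 0 = f 0 \<cdot>\<^sub>v unit_vec r 0"
    unfolding rect_diag_mult_vec[OF u] using assms by (intro eq_vecI) (auto simp: unit_vec_def)
  then have "vnorm (?M *\<^sub>v unit_vec c 0) = f 0" using un[of r] assms by (simp add: vnorm_smult)
  moreover have "vnorm (?M *\<^sub>v unit_vec c 0) \<le> spec_norm ?M * vnorm (unit_vec c 0)" by (rule vnorm_le_spec_norm[of _ r]) auto
  ultimately show ?thesis using un[of c] assms by simp
qed

lemma frob_norm_rect_diag:
  fixes f :: "nat \<Rightarrow> real"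
  assumes "c \<le> r"
  shows "frob_norm (mat r c (\<lambda>(i, j). if i = j then f i else 0)) = sqrt (\<Sum>i<c. (f i)\<^sup>2)"
proof -
  have "(\<Sum>i<r. \<Sum>j<c. (mat r c (\<lambda>(i, j). if i = j then f i else 0) $$ (i, j))\<^sup>2) = (\<Sum>i<r. \<Sum>j<c. if i = j then (f i)\<^sup>2 else 0)"
    by (intro sum.cong refl) auto
  also have "\<dots> = (\<Sum>i<r. if i < c then (f i)\<^sup>2 else 0)" by (intro sum.cong refl) simp
  also have "\<dots> = (\<Sum>i<c. (f i)\<^sup>2)" using assms by (intro sum.mono_neutral_cong_right) auto
  finally show ?thesis by (simp add: frob_norm_def)
qed

text \<open>The sketch reaches the graph point with parameter x at y = O1^-1 \<Sigma>_1^-p x, which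
  exists because the upper block \<open>O1\<close> is invertible and the leading singular values are
  positive. Its range is therefore the whole graph, and the orthogonal factor \<open>Uh\<close> does
  not change the range of \<open>Qh\<close>.\<close>

lemma range_finder_graph_sketch:
  assumes rf: "range_finder m n b \<sigma> A U V (Qh * Uh) (sub_mat (transpose_mat V * \<Omega>) b n 0 b * minv (sub_mat (transpose_mat V * \<Omega>) 0 b 0 b))"
    and Om: "\<Omega> \<in> carrier_mat n b"
    and Qh: "Qh \<in> carrier_mat m b" "col_space Qh = col_space ((A * transpose_mat A) ^\<^sub>m q * A * \<Omega>)"
    and Uh: "Uh \<in> carrier_mat b b" "transpose_mat Uh * Uh = 1\<^sub>m b"
    and nonsing: "invertible_mat (sub_mat (transpose_mat V * \<Omega>) 0 b 0 b)"
  shows "range_finder_graph m n b q \<sigma> A U V (Qh * Uh) (sub_mat (transpose_mat V * \<Omega>) b n 0 b * minv (sub_mat (transpose_mat V * \<Omega>) 0 b 0 b))"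
proof -
  define O1 where "O1 = sub_mat (transpose_mat V * \<Omega>) 0 b 0 b"
  define O2 where "O2 = sub_mat (transpose_mat V * \<Omega>) b n 0 b"
  interpret range_finder m n b q \<sigma> A U V "Qh * Uh" "O2 * minv O1" unfolding O1_def O2_def by (rule rf)
  have VO: "transpose_mat V * \<Omega> \<in> carrier_mat n b" using V Om by simp
  have O1: "O1 \<in> carrier_mat b b" "O2 \<in> carrier_mat (n - b) b" by (simp_all add: O1_def O2_def sub_mat_def)
  have d: "det O1 \<noteq> 0" using nonsing invertible_mat_iff_det[OF O1(1)] by (simp add: O1_def)
  note mi = minv[OF O1(1) d]
  let ?Y = "(A * transpose_mat A) ^\<^sub>m q * A * \<Omega>"
  have AA: "A * transpose_mat A \<in> carrier_mat m m" using A_carrier by simp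
  have Yy: "?Y *\<^sub>v y = U *\<^sub>v graph_vec (Matrix.vec b (\<lambda>i. s i ^ p * (O1 *\<^sub>v y) $ i))" if y: "y \<in> carrier_vec b" for y
  proof -
    have w: "\<Omega> *\<^sub>v y \<in> carrier_vec n" using Om y by simp
    have \<omega>: "transpose_mat V *\<^sub>v (\<Omega> *\<^sub>v y) = (transpose_mat V * \<Omega>) *\<^sub>v y"
      by (rule assoc_mult_mat_vec[symmetric, of _ n n _ b]) (use V Om y in auto)
    have o1: "((transpose_mat V * \<Omega>) *\<^sub>v y) $ i = (O1 *\<^sub>v y) $ i" if i: "i < b" for i
    proof -
      have "i < n" using i bn by simp
      from mult_mat_vec_index[OF VO y this] mult_mat_vec_index[OF O1(1) y i] show ?thesis
        using i by (simp add: O1_def sub_mat_def)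
    qed
    have o2: "((transpose_mat V * \<Omega>) *\<^sub>v y) $ i = (O2 *\<^sub>v y) $ (i - b)" if i: "i \<in> {b..<n}" for i
    proof -
      have "i < n" "i - b < n - b" using i by auto
      moreover have "O2 $$ (i - b, k) = (transpose_mat V * \<Omega>) $$ (i, k)" if "k < b" for k
        using that i \<open>i - b < n - b\<close> unfolding O2_def sub_mat_def by simp
      ultimately show ?thesis
        using mult_mat_vec_index[OF VO y] mult_mat_vec_index[OF O1(2) y] by simp
    qed
    have "((transpose_mat V * \<Omega>) *\<^sub>v y) $ i = tail (($) ((transpose_mat V * \<Omega>) *\<^sub>v y)) i" if i: "i \<in> {b..<n}" for i
    proof -
      have ib: "i - b < n - b" using i by auto
      have O1y: "O1 *\<^sub>v y \<in> carrier_vec b" using O1 y by simp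
      have "tail (($) ((transpose_mat V * \<Omega>) *\<^sub>v y)) i = (\<Sum>j<b. (O2 * minv O1) $$ (i - b, j) * (O1 *\<^sub>v y) $ j)"
        unfolding tail_def by (intro sum.cong refl) (simp add: o1)
      also have "\<dots> = ((O2 * minv O1) *\<^sub>v (O1 *\<^sub>v y)) $ (i - b)"
        by (rule mult_mat_vec_index[OF F O1y ib, symmetric])
      also have "(O2 * minv O1) *\<^sub>v (O1 *\<^sub>v y) = O2 *\<^sub>v (minv O1 *\<^sub>v (O1 *\<^sub>v y))"
        by (rule assoc_mult_mat_vec[OF O1(2) mi(2) O1y])
      also have "minv O1 *\<^sub>v (O1 *\<^sub>v y) = y" using assoc_mult_mat_vec[OF mi(2) O1(1) y] mi(4) y by simp
      finally show ?thesis using o2[OF i] by simp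
    qed
    from sketch_mult_vec[OF w, unfolded \<omega>, OF this]
    have "((A * transpose_mat A) ^\<^sub>m q) *\<^sub>v (A *\<^sub>v (\<Omega> *\<^sub>v y)) = U *\<^sub>v graph_vec (Matrix.vec b (\<lambda>i. s i ^ p * ((transpose_mat V * \<Omega>) *\<^sub>v y) $ i))" .
    also have "Matrix.vec b (\<lambda>i. s i ^ p * ((transpose_mat V * \<Omega>) *\<^sub>v y) $ i) = Matrix.vec b (\<lambda>i. s i ^ p * (O1 *\<^sub>v y) $ i)"
      by (intro eq_vecI) (auto simp: o1)
    also have "((A * transpose_mat A) ^\<^sub>m q) *\<^sub>v (A *\<^sub>v (\<Omega> *\<^sub>v y)) = ?Y *\<^sub>v y"
    proof -
      have PA: "(A * transpose_mat A) ^\<^sub>m q * A \<in> carrier_mat m n" by (rule mult_carrier_mat[OF pow_carrier_mat[OF AA] A_carrier])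
      show ?thesis using assoc_mult_mat_vec[OF PA Om y] assoc_mult_mat_vec[OF pow_carrier_mat[OF AA] A_carrier w] by simp
    qed
    finally show ?thesis .
  qed
  have Yc: "dim_col ?Y = b" using Om by simp
  have QU: "(Qh * Uh) *\<^sub>v z = Qh *\<^sub>v (Uh *\<^sub>v z)" if "z \<in> carrier_vec b" for z
    by (rule assoc_mult_mat_vec[OF Qh(1) Uh(1) that])
  show ?thesis unfolding O1_def[symmetric] O2_def[symmetric]
  proof (unfold_locales)
    fix x :: "real Matrix.vec" assume x: "x \<in> carrier_vec b"
    define u where "u = Matrix.vec b (\<lambda>i. x $ i / s i ^ p)"
    have u: "u \<in> carrier_vec b" by (simp add: u_def)
    have y: "minv O1 *\<^sub>v u \<in> carrier_vec b" using mi(2) u by simp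
    have "O1 *\<^sub>v (minv O1 *\<^sub>v u) = u" using assoc_mult_mat_vec[OF O1(1) mi(2) u] mi(3) u by simp
    then have "?Y *\<^sub>v (minv O1 *\<^sub>v u) = U *\<^sub>v graph_vec (Matrix.vec b (\<lambda>i. s i ^ p * u $ i))" using Yy[OF y] by simp
    also have "Matrix.vec b (\<lambda>i. s i ^ p * u $ i) = x"
    proof (rule eq_vecI)
      fix i assume "i < dim_vec x"
      then have i: "i < b" using x by simp
      then show "Matrix.vec b (\<lambda>i. s i ^ p * u $ i) $ i = x $ i" using s_pos[OF i] by (simp add: u_def)
    qed (use x in simp)
    finally have "U *\<^sub>v graph_vec x \<in> col_space ?Y" unfolding col_space_def Yc using y by (auto intro!: exI[of _ "minv O1 *\<^sub>v u"])
    then have "U *\<^sub>v graph_vec x \<in> col_space Qh" using Qh(2) by simp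
    then obtain z where z: "z \<in> carrier_vec b" "U *\<^sub>v graph_vec x = Qh *\<^sub>v z"
      unfolding col_space_def using Qh(1) by auto
    have Uz: "transpose_mat Uh *\<^sub>v z \<in> carrier_vec b" using Uh z by simp
    have "Uh *\<^sub>v (transpose_mat Uh *\<^sub>v z) = z"
      using assoc_mult_mat_vec[of Uh b b "transpose_mat Uh" b z] orthogonal_transpose[OF Uh] Uh z by simp
    then show "\<exists>z\<in>carrier_vec b. U *\<^sub>v graph_vec x = (Qh * Uh) *\<^sub>v z"
      using QU[OF Uz] z(2) Uz by (intro bexI[of _ "transpose_mat Uh *\<^sub>v z"]) auto
  next
    fix z :: "real Matrix.vec" assume z: "z \<in> carrier_vec b"
    have Uz: "Uh *\<^sub>v z \<in> carrier_vec b" using Uh z by simp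
    have "Qh *\<^sub>v (Uh *\<^sub>v z) \<in> col_space Qh" unfolding col_space_def using Qh(1) Uz by auto
    then have "Qh *\<^sub>v (Uh *\<^sub>v z) \<in> col_space ?Y" using Qh(2) by simp
    then obtain y where "y \<in> carrier_vec b" "Qh *\<^sub>v (Uh *\<^sub>v z) = ?Y *\<^sub>v y"
      unfolding col_space_def Yc by auto
    then show "\<exists>x\<in>carrier_vec b. (Qh * Uh) *\<^sub>v z = U *\<^sub>v graph_vec x"
      using Yy QU[OF z] by (intro bexI[of _ "Matrix.vec b (\<lambda>i. s i ^ p * (O1 *\<^sub>v y) $ i)"]) auto
  qed
qed

section \<open>Assembly of the deterministic bounds and the probability estimate\<close>

theorem theorem3p2:
  fixes m n k b q :: nat and \<theta> :: real and \<sigma> :: "nat \<Rightarrow> real"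
    and A U V \<Omega>1 Qh Uh :: "real mat"
  assumes mn: "m \<ge> n"
    and A: "A \<in> carrier_mat m n"
    and U: "U \<in> carrier_mat m m" "transpose_mat U * U = 1\<^sub>m m"
    and V: "V \<in> carrier_mat n n" "transpose_mat V * V = 1\<^sub>m n"
    and svd: "A = U * mat m n (\<lambda>(i,j). if i = j then \<sigma> (i+1) else 0) * transpose_mat V"
    and sig_mono: "\<And>i j. 1 \<le> i \<Longrightarrow> i \<le> j \<Longrightarrow> j \<le> n \<Longrightarrow> \<sigma> j \<le> \<sigma> i"
    and sig_nonneg: "\<And>i. 1 \<le> i \<Longrightarrow> i \<le> n \<Longrightarrow> 0 \<le> \<sigma> i"
    and theta: "\<theta> > 0" "1 \<le> k" "k < n" "\<sigma> k > \<theta>" "\<theta> > \<sigma> (k+1)"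
    and b: "1 \<le> b" "b \<le> k"
    and Om: "\<Omega>1 \<in> carrier_mat n b"
    and Qh: "Qh \<in> carrier_mat m b" "transpose_mat Qh * Qh = 1\<^sub>m b"
      "col_space Qh = col_space ((A * transpose_mat A) ^\<^sub>m q * A * \<Omega>1)"
    and Uh: "Uh \<in> carrier_mat b b" "transpose_mat Uh * Uh = 1\<^sub>m b"
    and Uh_eig: "\<exists>ev :: nat \<Rightarrow> real.
         (\<forall>i<b. (transpose_mat Qh * A * transpose_mat A * Qh) *\<^sub>v col Uh i = ev i \<cdot>\<^sub>v col Uh i)
       \<and> (\<forall>i j. i \<le> j \<longrightarrow> j < b \<longrightarrow> ev j \<le> ev i)"
    and nonsing: "invertible_mat (sub_mat (transpose_mat V * \<Omega>1) 0 b 0 b)"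
  shows
   "(let Q1 = Qh * Uh;
         Omh = transpose_mat V * \<Omega>1;
         Omh1 = sub_mat Omh 0 b 0 b;
         Omh2 = sub_mat Omh b n 0 b;
         \<Sigma> = mat m n (\<lambda>(i,j). if i = j then \<sigma> (i+1) else 0);
         \<Sigma>perp = sub_mat \<Sigma> b m b n;
         \<tau> = (\<lambda>j. \<sigma> (b+1) / \<sigma> j);
         E = spec_norm (Omh2 * minv Omh1);
         R = (1\<^sub>m m - Q1 * transpose_mat Q1) * A
     in spec_norm R \<le> sqrt (1 + \<tau> b ^ (4*q) * E\<^sup>2) * spec_norm \<Sigma>perp
      \<and> frob_norm R \<le> sqrt (1 + \<tau> b ^ (4*q) * E\<^sup>2) * frob_norm \<Sigma>perp
      \<and> (\<forall>j. 1 \<le> j \<longrightarrow> j \<le> b \<longrightarrow>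
            \<sigma> j \<ge> sing_val (transpose_mat Q1 * A) j
          \<and> sing_val (transpose_mat Q1 * A) j \<ge> \<sigma> j / sqrt (1 + \<tau> j ^ (4*q+2) * E\<^sup>2))
      \<and> (\<forall>t. b \<le> t \<longrightarrow> t \<le> k \<longrightarrow>
            deviation Q1 (sub_mat U 0 m 0 t) \<le> (\<sigma> (t+1) / \<sigma> b) ^ (2*q+1) * E))
  \<and> (\<forall>\<delta>::real. 0 < \<delta> \<longrightarrow> \<delta> < 1 \<longrightarrow>
       measure (gauss_entries n b)
         {f \<in> space (gauss_entries n b).
            let Om' = transpose_mat V * mat n b f
            in invertible_mat (sub_mat Om' 0 b 0 b)
             \<and> spec_norm (sub_mat Om' b n 0 b) * spec_norm (minv (sub_mat Om' 0 b 0 b))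
                 \<le> C_const \<delta> n b b}
       \<ge> 1 - \<delta>)"
proof (rule conjI)
  define Q1 where "Q1 = Qh * Uh"
  define Omh where "Omh = transpose_mat V * \<Omega>1"
  define F where "F = sub_mat Omh b n 0 b * minv (sub_mat Omh 0 b 0 b)"
  define \<Sigma> where "\<Sigma> = mat m n (\<lambda>(i,j). if i = j then \<sigma> (i+1) else 0)"
  have bn: "b < n" using b theta by simp
  have Q1: "Q1 \<in> carrier_mat m b" using Qh Uh by (simp add: Q1_def)
  have Q1o: "transpose_mat Q1 * Q1 = 1\<^sub>m b"
  proof -
    have "transpose_mat Q1 * Q1 = (transpose_mat Uh * transpose_mat Qh) * (Qh * Uh)"
      unfolding Q1_def using transpose_mult[OF Qh(1) Uh(1)] by simp
    also have "\<dots> = transpose_mat Uh * (transpose_mat Qh * (Qh * Uh))"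
      by (rule assoc_mult_mat[of _ b b _ m _ b]) (use Qh Uh in auto)
    also have "transpose_mat Qh * (Qh * Uh) = transpose_mat Qh * Qh * Uh"
      by (rule assoc_mult_mat[symmetric, of _ b m _ b _ b]) (use Qh Uh in auto)
    finally show ?thesis using Qh Uh by simp
  qed
  have O: "sub_mat Omh 0 b 0 b \<in> carrier_mat b b" "sub_mat Omh b n 0 b \<in> carrier_mat (n - b) b"
    by (simp_all add: sub_mat_def)
  have F: "F \<in> carrier_mat (n - b) b"
    unfolding F_def using O minv(2)[OF O(1)] nonsing invertible_mat_iff_det[OF O(1)] by (simp add: Omh_def)
  have "\<sigma> b \<ge> \<sigma> k" using sig_mono[of b k] b theta by simp
  then have pos: "\<sigma> b > 0" using theta by simp
  have rf: "range_finder m n b \<sigma> A U V Q1 F"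
    by (unfold_locales) (use mn b bn U V svd sig_mono sig_nonneg pos F Q1 Q1o in auto)
  have rfg: "range_finder_graph m n b q \<sigma> A U V Q1 F"
    unfolding Q1_def F_def Omh_def
    by (rule range_finder_graph_sketch[OF rf[unfolded Q1_def F_def Omh_def] Om Qh(1) Qh(3) Uh(1) Uh(2) nonsing])
  interpret range_finder_graph m n b q \<sigma> A U V Q1 F by (rule rfg)
  obtain ev :: "nat \<Rightarrow> real" where ev: "\<And>i. i < b \<Longrightarrow> (transpose_mat Qh * A * transpose_mat A * Qh) *\<^sub>v col Uh i = ev i \<cdot>\<^sub>v col Uh i"
    "\<And>i j. i \<le> j \<Longrightarrow> j < b \<Longrightarrow> ev j \<le> ev i" using Uh_eig by (elim exE conjE) metis
  note sv = sing_val_bounds[OF diag_of_eigenvectors[OF Qh(1) A_carrier Uh ev(1), folded Q1_def] ev(2)]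
  have perp: "sub_mat \<Sigma> b m b n = mat (m - b) (n - b) (\<lambda>(i, j). if i = j then \<sigma> (i + b + 1) else 0)"
    unfolding sub_mat_def \<Sigma>_def by (intro eq_matI) auto
  have perp2: "\<sigma> (b + 1) \<le> spec_norm (sub_mat \<Sigma> b m b n)"
    unfolding perp using spec_norm_rect_diag_ge[of "m - b" "n - b" "\<lambda>i. \<sigma> (i + b + 1)"] bn mn sig_nonneg[of "b + 1"] by simp
  have perpF: "frob_norm (sub_mat \<Sigma> b m b n) = sqrt (\<Sum>i\<in>{b..<n}. (\<sigma> (i + 1))\<^sup>2)"
  proof -
    have "(\<Sum>i<n - b. (\<sigma> (i + b + 1))\<^sup>2) = (\<Sum>i\<in>{b..<n}. (\<sigma> (i + 1))\<^sup>2)"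
      by (rule sum.reindex_bij_witness[of _ "\<lambda>i. i - b" "\<lambda>i. i + b"]) auto
    then show ?thesis unfolding perp using frob_norm_rect_diag[of "n - b" "m - b" "\<lambda>i. \<sigma> (i + b + 1)"] mn by simp
  qed
  have 1: "spec_norm R \<le> sqrt (1 + (\<sigma> (b+1) / \<sigma> b) ^ (4*q) * (spec_norm F)\<^sup>2) * spec_norm (sub_mat \<Sigma> b m b n)"
  proof (rule order_trans[OF spec_norm_residual])
    have "0 \<le> (\<sigma> (b+1) / \<sigma> b) ^ (4*q)" using pos sig_nonneg[of "b + 1"] bn by simp
    then show "sqrt (1 + (\<sigma> (b+1) / \<sigma> b) ^ (4*q) * (spec_norm F)\<^sup>2) * \<sigma> (b+1)
      \<le> sqrt (1 + (\<sigma> (b+1) / \<sigma> b) ^ (4*q) * (spec_norm F)\<^sup>2) * spec_norm (sub_mat \<Sigma> b m b n)"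
      by (intro mult_left_mono perp2) simp
  qed
  have 2: "frob_norm R \<le> sqrt (1 + (\<sigma> (b+1) / \<sigma> b) ^ (4*q) * (spec_norm F)\<^sup>2) * frob_norm (sub_mat \<Sigma> b m b n)"
    unfolding perpF by (rule frob_norm_residual)
  have 3: "\<sigma> j \<ge> sing_val (transpose_mat Q1 * A) j \<and>
      sing_val (transpose_mat Q1 * A) j \<ge> \<sigma> j / sqrt (1 + (\<sigma> (b+1) / \<sigma> j) ^ (4*q+2) * (spec_norm F)\<^sup>2)" if "1 \<le> j" "j \<le> b" for j
    using sv that by blast
  have 4: "deviation Q1 (sub_mat U 0 m 0 t) \<le> (\<sigma> (t+1) / \<sigma> b) ^ (2*q+1) * spec_norm F" if "b \<le> t" "t \<le> k" for t
    by (rule deviation_bound) (use that theta in auto)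
  show "let Q1 = Qh * Uh;
         Omh = transpose_mat V * \<Omega>1;
         Omh1 = sub_mat Omh 0 b 0 b;
         Omh2 = sub_mat Omh b n 0 b;
         \<Sigma> = mat m n (\<lambda>(i,j). if i = j then \<sigma> (i+1) else 0);
         \<Sigma>perp = sub_mat \<Sigma> b m b n;
         \<tau> = (\<lambda>j. \<sigma> (b+1) / \<sigma> j);
         E = spec_norm (Omh2 * minv Omh1);
         R = (1\<^sub>m m - Q1 * transpose_mat Q1) * A
     in spec_norm R \<le> sqrt (1 + \<tau> b ^ (4*q) * E\<^sup>2) * spec_norm \<Sigma>perp
      \<and> frob_norm R \<le> sqrt (1 + \<tau> b ^ (4*q) * E\<^sup>2) * frob_norm \<Sigma>perp
      \<and> (\<forall>j. 1 \<le> j \<longrightarrow> j \<le> b \<longrightarrow>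
            \<sigma> j \<ge> sing_val (transpose_mat Q1 * A) j
          \<and> sing_val (transpose_mat Q1 * A) j \<ge> \<sigma> j / sqrt (1 + \<tau> j ^ (4*q+2) * E\<^sup>2))
      \<and> (\<forall>t. b \<le> t \<longrightarrow> t \<le> k \<longrightarrow>
            deviation Q1 (sub_mat U 0 m 0 t) \<le> (\<sigma> (t+1) / \<sigma> b) ^ (2*q+1) * E)"
    unfolding Let_def Q1_def[symmetric] Omh_def[symmetric] F_def[symmetric] \<Sigma>_def[symmetric] R_def[symmetric]
    using 1 2 3 4 by blast
next
  show "\<forall>\<delta>::real. 0 < \<delta> \<longrightarrow> \<delta> < 1 \<longrightarrow>
       measure (gauss_entries n b)
         {f \<in> space (gauss_entries n b).
            let Om' = transpose_mat V * mat n b f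
            in invertible_mat (sub_mat Om' 0 b 0 b)
             \<and> spec_norm (sub_mat Om' b n 0 b) * spec_norm (minv (sub_mat Om' 0 b 0 b))
                 \<le> C_const \<delta> n b b}
       \<ge> 1 - \<delta>"
    using gauss_norm_product_prob[OF b(1) _ V] b theta by auto
qed

end
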